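(* The configuration LP of the restricted submodular Santa Claus problem can be approximated within a factor of $(1-1/e)/2$ in polynomial time: there is a polynomial-time algorithm that computes a value $T$ with $T\ge \frac{1-1/e}{2}\,T_{\mathrm{opt}}$ together with a feasible solution (with polynomially many nonzero variables) of the configuration LP with parameter $T$, where $T_{\mathrm{opt}}$ is the largest $T$ for which the configuration LP with parameter $T$ is feasible.
   Context: Restricted submodular Santa Claus instance: players $P$, resources $R$, a monotone submodular function $f:2^R\to\mathbb{R}_{\ge0}$ with $f(\emptyset)=0$ given by a value oracle, and sets $\Gamma_i\subseteq R$ for each $i\in P$. For $T\ge 0$ and $i\in P$ let $\mathcal{C}(i,T)=\{C\subseteq\Gamma_i: f(C)\ge T\}$ (configurations). The configuration LP with parameter $T$ has a variable $x_{i,C}$ for every $i\in P$, $C\in\mathcal{C}(i,T)$, and constraints $\sum_{C\in\mathcal{C}(i,T)}x_{i,C}\ge 1$ for all $i\in P$; $\sum_{i\in P}\sum_{C\in\mathcal{C}(i,T):\,j\in C}x_{i,C}\le 1$ for all $j\in R$; $x_{i,C}\ge 0$. *)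

theory Defs
  imports Complex_Main "HOL-Library.Log_Nat" "HOL-Computational_Algebra.Polynomial"
begin

section \<open>Restricted submodular Santa Claus and its configuration LP\<close>

definition santa_claus_instance ::
  "'p set \<Rightarrow> 'r set \<Rightarrow> ('p \<Rightarrow> 'r set) \<Rightarrow> ('r set \<Rightarrow> real) \<Rightarrow> bool" where
  "santa_claus_instance P R \<Gamma> f \<longleftrightarrow>
     finite P \<and> finite R \<and> (\<forall>i\<in>P. \<Gamma> i \<subseteq> R) \<and>
     f {} = 0 \<and> (\<forall>A\<subseteq>R. 0 \<le> f A) \<and>
     (\<forall>A B. A \<subseteq> B \<and> B \<subseteq> R \<longrightarrow> f A \<le> f B) \<and>
     (\<forall>A B. A \<subseteq> R \<and> B \<subseteq> R \<longrightarrow> f (A \<union> B) + f (A \<inter> B) \<le> f A + f B)"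

definition configs :: "('p \<Rightarrow> 'r set) \<Rightarrow> ('r set \<Rightarrow> real) \<Rightarrow> 'p \<Rightarrow> real \<Rightarrow> 'r set set" where
  "configs \<Gamma> f i T = {C. C \<subseteq> \<Gamma> i \<and> T \<le> f C}"

text \<open>The LP has variables \<open>x i C\<close> only for \<open>i \<in> P\<close> and \<open>C \<in> configs \<Gamma> f i T\<close>; a solution is
  represented by its extension by zero to all pairs (last conjunct).\<close>

definition config_LP_solution ::
  "'p set \<Rightarrow> 'r set \<Rightarrow> ('p \<Rightarrow> 'r set) \<Rightarrow> ('r set \<Rightarrow> real) \<Rightarrow> real \<Rightarrow>
   ('p \<Rightarrow> 'r set \<Rightarrow> real) \<Rightarrow> bool" where
  "config_LP_solution P R \<Gamma> f T x \<longleftrightarrow>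
     (\<forall>i\<in>P. 1 \<le> (\<Sum>C\<in>configs \<Gamma> f i T. x i C)) \<and>
     (\<forall>j\<in>R. (\<Sum>i\<in>P. \<Sum>C\<in>{C\<in>configs \<Gamma> f i T. j \<in> C}. x i C) \<le> 1) \<and>
     (\<forall>i\<in>P. \<forall>C\<in>configs \<Gamma> f i T. 0 \<le> x i C) \<and>
     (\<forall>i C. \<not> (i \<in> P \<and> C \<in> configs \<Gamma> f i T) \<longrightarrow> x i C = 0)"

definition config_LP_feasible ::
  "'p set \<Rightarrow> 'r set \<Rightarrow> ('p \<Rightarrow> 'r set) \<Rightarrow> ('r set \<Rightarrow> real) \<Rightarrow> real \<Rightarrow> bool" where
  "config_LP_feasible P R \<Gamma> f T \<longleftrightarrow> (\<exists>x. config_LP_solution P R \<Gamma> f T x)"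

definition is_T_opt ::
  "'p set \<Rightarrow> 'r set \<Rightarrow> ('p \<Rightarrow> 'r set) \<Rightarrow> ('r set \<Rightarrow> real) \<Rightarrow> real \<Rightarrow> bool" where
  "is_T_opt P R \<Gamma> f T \<longleftrightarrow>
     0 \<le> T \<and> config_LP_feasible P R \<Gamma> f T \<and>
     (\<forall>T'\<ge>0. config_LP_feasible P R \<Gamma> f T' \<longrightarrow> T' \<le> T)"

text \<open>The optimum exists and is unique as soon as there is a player. (Without players every
  \<open>T \<ge> 0\<close> is feasible.)\<close>

lemma ex1_T_opt:
  assumes inst: "santa_claus_instance P R \<Gamma> f" and "P \<noteq> {}"
  shows "\<exists>!T. is_T_opt P R \<Gamma> f T"
proof -
  define V where "V = {T \<in> f ` Pow R. config_LP_feasible P R \<Gamma> f T}"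
  have fin: "finite V" and finR: "finite (Pow R)"
    using inst by (auto simp: V_def santa_claus_instance_def)
  have \<Gamma>: "\<Gamma> i \<subseteq> R" if "i \<in> P" for i
    using inst that by (auto simp: santa_claus_instance_def)
  have finC: "finite (configs \<Gamma> f i T)" if "i \<in> P" for i T
    using finR \<Gamma>[OF that] by (rule_tac finite_subset[of _ "Pow R"]) (auto simp: configs_def)
  have f0: "f {} = 0" and nonneg: "\<And>A. A \<subseteq> R \<Longrightarrow> 0 \<le> f A"
    using inst by (auto simp: santa_claus_instance_def)
  have up: "\<exists>v\<in>V. T \<le> v" if feas: "config_LP_feasible P R \<Gamma> f T" for T
  proof -
    define W where "W = {v \<in> f ` Pow R. T \<le> v}"
    obtain x where x: "config_LP_solution P R \<Gamma> f T x"
      using feas by (auto simp: config_LP_feasible_def)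
    obtain i where i: "i \<in> P" using \<open>P \<noteq> {}\<close> by blast
    have "configs \<Gamma> f i T \<noteq> {}"
    proof
      assume "configs \<Gamma> f i T = {}"
      with x i show False by (force simp: config_LP_solution_def)
    qed
    then have "W \<noteq> {}" using \<Gamma>[OF i] by (auto simp: W_def configs_def)
    have finW: "finite W" using finR by (auto simp: W_def)
    define v where "v = Min W"
    have v: "v \<in> W" using finW \<open>W \<noteq> {}\<close> by (simp add: v_def)
    have eq: "configs \<Gamma> f k v = configs \<Gamma> f k T" if "k \<in> P" for k
    proof -
      have "v \<le> f C" if "C \<subseteq> \<Gamma> k" "T \<le> f C" for C
        unfolding v_def using that \<Gamma>[OF \<open>k \<in> P\<close>] finW by (intro Min_le) (auto simp: W_def)
      with v show ?thesis by (fastforce simp: configs_def W_def)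
    qed
    have "(\<Sum>k\<in>P. \<Sum>C\<in>{C \<in> configs \<Gamma> f k v. j \<in> C}. x k C) =
          (\<Sum>k\<in>P. \<Sum>C\<in>{C \<in> configs \<Gamma> f k T. j \<in> C}. x k C)" for j
      by (intro sum.cong refl) (simp add: eq)
    with x eq have "config_LP_solution P R \<Gamma> f v x"
      by (auto simp: config_LP_solution_def)
    with v show ?thesis
      by (auto simp: V_def W_def config_LP_feasible_def)
  qed
  have "config_LP_solution P R \<Gamma> f 0 (\<lambda>i C. if i \<in> P \<and> C = {} then 1 else 0)"
  proof -
    have "(\<Sum>C\<in>configs \<Gamma> f i 0. if i \<in> P \<and> C = {} then 1 else 0 :: real) = 1" if "i \<in> P" for i
      using finC[OF that] that f0 by (simp add: configs_def)
    moreover have "(\<Sum>i\<in>P. \<Sum>C\<in>{C \<in> configs \<Gamma> f i 0. j \<in> C}.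
        if i \<in> P \<and> C = {} then 1 else 0 :: real) = 0" for j
      by (intro sum.neutral ballI) auto
    ultimately show ?thesis
      using f0 by (auto simp: config_LP_solution_def configs_def)
  qed
  then have "V \<noteq> {}" using up[of 0] by (auto simp: config_LP_feasible_def)
  have "is_T_opt P R \<Gamma> f (Max V)"
  proof -
    have "Max V \<in> V" using fin \<open>V \<noteq> {}\<close> by simp
    moreover have "T' \<le> Max V" if "config_LP_feasible P R \<Gamma> f T'" for T'
      using up[OF that] fin by (meson Max_ge order_trans)
    ultimately show ?thesis using nonneg by (auto simp: is_T_opt_def V_def)
  qed
  then show ?thesis by (auto simp: is_T_opt_def intro: antisym)
qed


section \<open>Random access machines with a value oracle\<close>

text \<open>Programs work on named arrays of integers and named arrays of reals.
  Integer instructions have logarithmic cost: every evaluated subterm is charged one plus the bit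
  length of its result, so that on integers polynomial cost is polynomial time on a Turing machine.
  Reals, which arise as oracle answers, can only be added, subtracted, compared and multiplied by
  integers, at unit cost plus the cost of the integers.  After cost \<open>t\<close> every real cell is an
  integer combination of \<open>1\<close> and at most \<open>t\<close> oracle answers, with coefficients of \<open>O(t)\<close> bits;
  hence for rational oracle answers a polynomial cost also means polynomially many bit operations
  in the length of these answers, while the model makes sense for arbitrary real ones.\<close>

type_synonym vname = string

record state =
  ints :: "vname \<Rightarrow> int \<Rightarrow> int"
  reals :: "vname \<Rightarrow> int \<Rightarrow> real"

datatype iexp =
    IConst int
  | IRead vname iexp
  | IAdd iexp iexp
  | ISub iexp iexp
  | IMul iexp iexp
  | IDiv iexp iexp

datatype rexp =
    ROf iexp
  | RRead vname iexp
  | RAdd rexp rexp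
  | RSub rexp rexp
  | RScale iexp rexp

datatype bexp =
    ILess iexp iexp
  | RLess rexp rexp
  | BNot bexp
  | BAnd bexp bexp

datatype com =
    Skip
  | IAssign vname iexp iexp
  | RAssign vname iexp rexp
  | Query vname iexp vname iexp
  | Seq com com
  | Cond bexp com com
  | While bexp com

primrec ival :: "iexp \<Rightarrow> state \<Rightarrow> int" where
  "ival (IConst k) s = k"
| "ival (IRead x a) s = ints s x (ival a s)"
| "ival (IAdd a b) s = ival a s + ival b s"
| "ival (ISub a b) s = ival a s - ival b s"
| "ival (IMul a b) s = ival a s * ival b s"
| "ival (IDiv a b) s = ival a s div ival b s"

primrec rval :: "rexp \<Rightarrow> state \<Rightarrow> real" where
  "rval (ROf a) s = real_of_int (ival a s)"
| "rval (RRead x a) s = reals s x (ival a s)"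
| "rval (RAdd u v) s = rval u s + rval v s"
| "rval (RSub u v) s = rval u s - rval v s"
| "rval (RScale a u) s = real_of_int (ival a s) * rval u s"

primrec bval :: "bexp \<Rightarrow> state \<Rightarrow> bool" where
  "bval (ILess a b) s = (ival a s < ival b s)"
| "bval (RLess u v) s = (rval u s < rval v s)"
| "bval (BNot b) s = (\<not> bval b s)"
| "bval (BAnd b c) s = (bval b s \<and> bval c s)"

definition bits :: "int \<Rightarrow> nat" where
  "bits k = floorlog 2 (nat \<bar>k\<bar>)"

primrec icost :: "iexp \<Rightarrow> state \<Rightarrow> nat" where
  "icost (IConst k) s = 1 + bits k"
| "icost (IRead x a) s = icost a s + 1 + bits (ival (IRead x a) s)"
| "icost (IAdd a b) s = icost a s + icost b s + 1 + bits (ival (IAdd a b) s)"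
| "icost (ISub a b) s = icost a s + icost b s + 1 + bits (ival (ISub a b) s)"
| "icost (IMul a b) s = icost a s + icost b s + 1 + bits (ival (IMul a b) s)"
| "icost (IDiv a b) s = icost a s + icost b s + 1 + bits (ival (IDiv a b) s)"

primrec rcost :: "rexp \<Rightarrow> state \<Rightarrow> nat" where
  "rcost (ROf a) s = icost a s + 1"
| "rcost (RRead x a) s = icost a s + 1"
| "rcost (RAdd u v) s = rcost u s + rcost v s + 1"
| "rcost (RSub u v) s = rcost u s + rcost v s + 1"
| "rcost (RScale a u) s = icost a s + rcost u s + 1"

primrec bcost :: "bexp \<Rightarrow> state \<Rightarrow> nat" where
  "bcost (ILess a b) s = icost a s + icost b s + 1"
| "bcost (RLess u v) s = rcost u s + rcost v s + 1"
| "bcost (BNot b) s = bcost b s + 1"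
| "bcost (BAnd b c) s = bcost b s + bcost c s + 1"

definition iupdate :: "vname \<Rightarrow> int \<Rightarrow> int \<Rightarrow> state \<Rightarrow> state" where
  "iupdate x a k s = s\<lparr>ints := (ints s)(x := (ints s x)(a := k))\<rparr>"

definition rupdate :: "vname \<Rightarrow> int \<Rightarrow> real \<Rightarrow> state \<Rightarrow> state" where
  "rupdate x a r s = s\<lparr>reals := (reals s)(x := (reals s x)(a := r))\<rparr>"

text \<open>The set with characteristic vector \<open>x[b], \<dots>, x[b + l - 1]\<close>.\<close>

definition segment_set :: "state \<Rightarrow> vname \<Rightarrow> int \<Rightarrow> int \<Rightarrow> nat set" where
  "segment_set s x b l = {j. int j < l \<and> ints s x (b + int j) \<noteq> 0}"

text \<open>\<open>exec f c s t s'\<close>: started in \<open>s\<close>, program \<open>c\<close> with value oracle \<open>f\<close> halts in \<open>s'\<close> at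
  total cost \<open>t\<close>.  \<open>Query y a x l\<close> stores in \<open>y[a]\<close> the oracle value of the set with characteristic
  vector \<open>x[0], \<dots>, x[l - 1]\<close>.\<close>

inductive exec :: "(nat set \<Rightarrow> real) \<Rightarrow> com \<Rightarrow> state \<Rightarrow> nat \<Rightarrow> state \<Rightarrow> bool" for f where
  Skip: "exec f Skip s 1 s"
| IAssign: "exec f (IAssign x a e) s (1 + icost a s + icost e s)
    (iupdate x (ival a s) (ival e s) s)"
| RAssign: "exec f (RAssign x a u) s (1 + icost a s + rcost u s)
    (rupdate x (ival a s) (rval u s) s)"
| Query: "exec f (Query y a x l) s (1 + icost a s + icost l s + nat (ival l s))
    (rupdate y (ival a s) (f (segment_set s x 0 (ival l s))) s)"
| Seq: "exec f c s t s' \<Longrightarrow> exec f d s' t' s'' \<Longrightarrow> exec f (Seq c d) s (1 + t + t') s''"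
| CondTrue: "bval b s \<Longrightarrow> exec f c s t s' \<Longrightarrow> exec f (Cond b c d) s (1 + bcost b s + t) s'"
| CondFalse: "\<not> bval b s \<Longrightarrow> exec f d s t s' \<Longrightarrow> exec f (Cond b c d) s (1 + bcost b s + t) s'"
| WhileFalse: "\<not> bval b s \<Longrightarrow> exec f (While b c) s (1 + bcost b s) s"
| WhileTrue: "bval b s \<Longrightarrow> exec f c s t s' \<Longrightarrow> exec f (While b c) s' t' s'' \<Longrightarrow>
    exec f (While b c) s (1 + bcost b s + t + t') s''"

lemma exec_deterministic:
  "exec f c s t s' \<Longrightarrow> exec f c s u s'' \<Longrightarrow> t = u \<and> s' = s''"
proof (induction arbitrary: u s'' rule: exec.induct)
  case (Seq c s t s' d t' s1)
  from Seq.prems show ?case by cases (use Seq.IH in blast)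
next
  case (WhileTrue b s c t s' t' s1)
  from WhileTrue.prems show ?case by cases (use WhileTrue.IH WhileTrue.hyps in blast)+
next
  case (CondTrue b s c t s' d)
  from CondTrue.prems show ?case by cases (use CondTrue.IH CondTrue.hyps in blast)+
next
  case (CondFalse b s d t s' c)
  from CondFalse.prems show ?case by cases (use CondFalse.IH CondFalse.hyps in blast)+
qed (auto elim: exec.cases)


section \<open>Input and output of algorithms for the configuration LP\<close>

text \<open>Players are \<open>{..<n}\<close>, resources are \<open>{..<m}\<close>, and the sets \<open>\<Gamma> i\<close> are given by their
  incidence matrix, stored row by row; \<open>f\<close> is accessible only through the oracle.\<close>

definition input_state :: "nat \<Rightarrow> nat \<Rightarrow> (nat \<Rightarrow> nat set) \<Rightarrow> state" where
  "input_state n m \<Gamma> = \<lparr>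
     ints = (\<lambda>x a.
       if x = ''n'' \<and> a = 0 then int n
       else if x = ''m'' \<and> a = 0 then int m
       else if x = ''Gamma'' \<and> (\<exists>i<n. \<exists>j<m. j \<in> \<Gamma> i \<and> a = int (i * m + j)) then 1
       else 0),
     reals = (\<lambda>x a. 0)\<rparr>"

definition output_T :: "state \<Rightarrow> real" where
  "output_T s = reals s ''T'' 0"

text \<open>The LP solution is output as a list of triples: a player, the characteristic vector of a
  configuration, and a rational number given by numerator and denominator, which is added to the
  corresponding variable.\<close>

definition output_length :: "state \<Rightarrow> nat" where
  "output_length s = nat (ints s ''length'' 0)"

definition output_x :: "nat \<Rightarrow> state \<Rightarrow> nat \<Rightarrow> nat set \<Rightarrow> real" where
  "output_x m s i C =
     (\<Sum>k \<in> {k. k < output_length s \<and> ints s ''player'' (int k) = int i \<and>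
               segment_set s ''config'' (int (k * m)) (int m) = C}.
        real_of_int (ints s ''num'' (int k)) / real_of_int (ints s ''den'' (int k)))"

end

theory Submission
  imports Defs
begin

text \<open>
  Fix a target value \<open>\<theta>\<close> and call an item big if its own value is at least \<open>\<theta>\<close>.  A player
  can be served by one big item or by a set of small items.  The big items are handled exactly, as
  integral matchings; only the loads of the small items are balanced, by \<open>N\<close> rounds of
  Blackwell's approachability.  In each round, a small item has a price that grows with its excess
  load, every player computes a set of value at least \<open>\<theta>\<close> by the density greedy algorithm, and the
  players whose sets are most expensive are matched to big items, which is possible greedily because
  matchable sets of players form a matroid.  The average of the \<open>N\<close> assignments is output.

  Since small items have value less than \<open>\<theta>\<close>, the greedy set has value less than \<open>2 * \<theta>\<close>; so
  if \<open>2 * \<theta> \<le> (1 - 1 / e) * T\<close>, its price does not exceed the price of any set of value \<open>T\<close>.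
  As the greedy algorithm adds at most \<open>m\<close> items, there is a gain over \<open>1 - 1 / e\<close> of order
  \<open>1 / m\<close>.  It allows for a price lower by the factor \<open>1 - 1 / (8 * m)\<close>, which turns the approximate
  balance into an exactly feasible solution, and for a polynomial grid of targets \<open>\<theta>\<close>.
\<close>

section \<open>Polynomial bounds\<close>

text \<open>Oracle values are reals that can be added, compared and scaled by integers, but not
  multiplied or divided by each other. Hence all prices are integers, densities are compared by
  cross-multiplication, and the balancing uses prices linear in the excess load instead of
  exponential weights.

  The separation of big and small items is forced by the overshoot of the greedy algorithm: its last
  item may exceed the target by its own value, and only if that item is small does the set stay
  below twice the target. This is the factor 2 in the ratio. The matching is judged against the LP:
  an LP solution serves a fraction of each player by configurations containing big items, and a
  matching of players of maximum total cost removes at least as much cost as these fractions do.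

  Infeasibility is never decided. A target is given up only when some round violates the price
  inequality, which is impossible if the LP is feasible for a value \<open>T\<close> with
  \<open>good_target h T\<close>. A target that survives all rounds yields a solution whether or not
  such a \<open>T\<close> exists. So the optimum enters only through the fact that the grid contains
  a target just above the required value.\<close>

definition poly_bounded :: "(nat \<Rightarrow> nat) \<Rightarrow> bool" where
  "poly_bounded g \<longleftrightarrow> (\<exists>p. \<forall>x. g x \<le> poly p x)"

lemma poly_bounded_const: "poly_bounded (\<lambda>x. c)"
  unfolding poly_bounded_def by (rule exI[of _ "[:c:]"]) simp

lemma poly_bounded_ident: "poly_bounded (\<lambda>x. x)"
  unfolding poly_bounded_def by (rule exI[of _ "[:0, 1:]"]) simp

lemma poly_bounded_add: "poly_bounded g \<Longrightarrow> poly_bounded h \<Longrightarrow> poly_bounded (\<lambda>x. g x + h x)"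
  unfolding poly_bounded_def by (metis add_mono poly_add)

lemma poly_bounded_mult: "poly_bounded g \<Longrightarrow> poly_bounded h \<Longrightarrow> poly_bounded (\<lambda>x. g x * h x)"
  unfolding poly_bounded_def by (metis mult_le_mono poly_mult)

lemma poly_nat_mono: "x \<le> y \<Longrightarrow> poly p x \<le> poly p (y :: nat)"
  by (induction p) (auto intro!: add_mono mult_mono)

lemma poly_bounded_compose: "poly_bounded g \<Longrightarrow> poly_bounded h \<Longrightarrow> poly_bounded (\<lambda>x. g (h x))"
  unfolding poly_bounded_def by (metis order_trans poly_nat_mono poly_pcompose)

lemmas poly_bounded_intros =
  poly_bounded_const poly_bounded_ident poly_bounded_add poly_bounded_mult


section \<open>A calculus for terminating programs\<close>

text \<open>If all integer cells are bounded by \<open>M\<close> and every loop makes at most \<open>M\<close> iterations, then the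
  cost of a program is bounded by a number that depends on \<open>M\<close> and the program text only.  So it
  suffices to establish these two conditions along with functional correctness.\<close>

definition bnd :: "nat \<Rightarrow> state \<Rightarrow> bool" where
  "bnd M s \<longleftrightarrow> (\<forall>x a. \<bar>ints s x a\<bar> \<le> int M)"

section \<open>Cost bounds read off the program text\<close>

primrec ivalb :: "nat \<Rightarrow> iexp \<Rightarrow> nat" where
  "ivalb M (IConst k) = nat \<bar>k\<bar>"
| "ivalb M (IRead x a) = M"
| "ivalb M (IAdd a b) = ivalb M a + ivalb M b"
| "ivalb M (ISub a b) = ivalb M a + ivalb M b"
| "ivalb M (IMul a b) = ivalb M a * ivalb M b"
| "ivalb M (IDiv a b) = ivalb M a"

primrec icostb :: "nat \<Rightarrow> iexp \<Rightarrow> nat" where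
  "icostb M (IConst k) = 1 + nat \<bar>k\<bar>"
| "icostb M (IRead x a) = icostb M a + 1 + M"
| "icostb M (IAdd a b) = icostb M a + icostb M b + 1 + (ivalb M a + ivalb M b)"
| "icostb M (ISub a b) = icostb M a + icostb M b + 1 + (ivalb M a + ivalb M b)"
| "icostb M (IMul a b) = icostb M a + icostb M b + 1 + ivalb M a * ivalb M b"
| "icostb M (IDiv a b) = icostb M a + icostb M b + 1 + ivalb M a"

primrec rcostb :: "nat \<Rightarrow> rexp \<Rightarrow> nat" where
  "rcostb M (ROf a) = icostb M a + 1"
| "rcostb M (RRead x a) = icostb M a + 1"
| "rcostb M (RAdd u v) = rcostb M u + rcostb M v + 1"
| "rcostb M (RSub u v) = rcostb M u + rcostb M v + 1"
| "rcostb M (RScale a u) = icostb M a + rcostb M u + 1"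

primrec bcostb :: "nat \<Rightarrow> bexp \<Rightarrow> nat" where
  "bcostb M (ILess a b) = icostb M a + icostb M b + 1"
| "bcostb M (RLess u v) = rcostb M u + rcostb M v + 1"
| "bcostb M (BNot b) = bcostb M b + 1"
| "bcostb M (BAnd b c) = bcostb M b + bcostb M c + 1"

primrec costb :: "nat \<Rightarrow> com \<Rightarrow> nat" where
  "costb M Skip = 1"
| "costb M (IAssign x a e) = 1 + icostb M a + icostb M e"
| "costb M (RAssign x a u) = 1 + icostb M a + rcostb M u"
| "costb M (Query y a x l) = 1 + icostb M a + icostb M l + ivalb M l"
| "costb M (Seq c d) = 1 + costb M c + costb M d"
| "costb M (Cond b c d) = 1 + bcostb M b + (costb M c + costb M d)"
| "costb M (While b c) = (M + 1) * (1 + bcostb M b + costb M c)"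

text \<open>A crude bound suffices: all cells are polynomially bounded in value, not only in length,
  so values may stand in for bit lengths.\<close>

lemma bits_le: "bits k \<le> nat \<bar>k\<bar>"
proof -
  have "floorlog 2 x \<le> x" for x :: nat
    by (rule floorlog_leI) (auto simp: less_exp)
  then show ?thesis by (simp add: bits_def)
qed

lemma abs_div_le: "\<bar>a div b\<bar> \<le> \<bar>a :: int\<bar>"
proof -
  have pos: "\<bar>a div b\<bar> \<le> \<bar>a\<bar>" if "b > 0" for a b :: int
  proof -
    define q r where "q = a div b" and "r = a mod b"
    have a: "a = b * q + r" and r: "0 \<le> r" "r < b"
      using that by (simp_all add: q_def r_def)
    show ?thesis
    proof (cases "q \<ge> 0")
      case True
      then have "1 * q \<le> b * q" using that by (intro mult_right_mono) auto
      then show ?thesis using True a r by (simp add: q_def[symmetric])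
    next
      case False
      \<comment> \<open>Floor division rounds a negative quotient away from zero; passing to
        \<open>q + 1 \<le> 0\<close> makes up for it.\<close>
      then have "b * (q + 1) \<le> 1 * (q + 1)" using that by (intro mult_right_mono_neg) auto
      then have "a \<le> q" using a r by (simp add: algebra_simps)
      then show ?thesis using False by (simp add: q_def[symmetric])
    qed
  qed
  show ?thesis
  proof (cases b "0 :: int" rule: linorder_cases)
    case less
    then show ?thesis using pos[of "- b" "- a"] by simp
  qed (use pos in auto)
qed

lemma ival_le: "bnd M s \<Longrightarrow> nat \<bar>ival e s\<bar> \<le> ivalb M e"
proof (induction e)
  case (IRead x a)
  then show ?case by (simp add: bnd_def nat_le_iff)
next
  case (IMul a b)
  then show ?case by (simp add: abs_mult nat_mult_distrib mult_le_mono)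
next
  case (IDiv a b)
  then show ?case using abs_div_le[of "ival a s" "ival b s"] by simp
qed auto

lemma icost_le: "bnd M s \<Longrightarrow> icost e s \<le> icostb M e"
proof (induction e)
  case (IConst k)
  then show ?case by (simp add: bits_le)
next
  case (IRead x a)
  then show ?case using bits_le ival_le[OF IRead.prems, of "IRead x a"]
    by (auto intro!: add_mono order_trans[OF bits_le])
next
  case (IAdd a b)
  then show ?case using ival_le[OF IAdd.prems, of "IAdd a b"]
    by (auto intro!: add_mono order_trans[OF bits_le])
next
  case (ISub a b)
  then show ?case using ival_le[OF ISub.prems, of "ISub a b"]
    by (auto intro!: add_mono order_trans[OF bits_le])
next
  case (IMul a b)
  then show ?case using ival_le[OF IMul.prems, of "IMul a b"]
    by (auto intro!: add_mono order_trans[OF bits_le])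
next
  case (IDiv a b)
  then show ?case using ival_le[OF IDiv.prems, of "IDiv a b"]
    by (auto intro!: add_mono order_trans[OF bits_le])
qed

lemma rcost_le: "bnd M s \<Longrightarrow> rcost e s \<le> rcostb M e"
  by (induction e) (auto intro!: add_mono icost_le)

lemma bcost_le: "bnd M s \<Longrightarrow> bcost e s \<le> bcostb M e"
  by (induction e) (auto intro!: add_mono icost_le rcost_le)

lemma poly_bounded_costb: "poly_bounded (\<lambda>M. costb M c)"
proof -
  have i: "poly_bounded (\<lambda>M. ivalb M e)" for e
    by (induction e) (auto intro!: poly_bounded_intros)
  have ic: "poly_bounded (\<lambda>M. icostb M e)" for e
    by (induction e) (simp_all only: icostb.simps, (intro poly_bounded_intros i | assumption)+)
  have rc: "poly_bounded (\<lambda>M. rcostb M e)" for e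
    by (induction e) (simp_all only: rcostb.simps, (intro poly_bounded_intros ic | assumption)+)
  have bc: "poly_bounded (\<lambda>M. bcostb M e)" for e
    by (induction e) (simp_all only: bcostb.simps, (intro poly_bounded_intros ic rc | assumption)+)
  show ?thesis
    by (induction c) (simp_all only: costb.simps, (intro poly_bounded_intros i ic rc bc | assumption)+)
qed

text \<open>\<open>bnd M\<close> is assumed at the start and returned at the end, so it passes
  silently through the rules; only integer assignments have to prove anything about it. Termination
  within \<open>costb M c\<close> is part of the claim, and this bound is the same for all
  states.\<close>

definition wp :: "(nat set \<Rightarrow> real) \<Rightarrow> nat \<Rightarrow> com \<Rightarrow> (state \<Rightarrow> bool) \<Rightarrow> state \<Rightarrow> bool" where
  "wp f M c Q s \<longleftrightarrow> (bnd M s \<longrightarrow> (\<exists>t s'. exec f c s t s' \<and> t \<le> costb M c \<and> Q s' \<and> bnd M s'))"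

lemma ints_iupdate [simp]:
  "ints (iupdate x a k s) y = (if y = x then (ints s x)(a := k) else ints s y)"
  by (simp add: iupdate_def)

lemma reals_iupdate [simp]: "reals (iupdate x a k s) = reals s"
  by (simp add: iupdate_def)

lemma reals_rupdate [simp]:
  "reals (rupdate x a k s) y = (if y = x then (reals s x)(a := k) else reals s y)"
  by (simp add: rupdate_def)

lemma ints_rupdate [simp]: "ints (rupdate x a k s) = ints s"
  by (simp add: rupdate_def)

lemma bnd_iupdate: "bnd M s \<Longrightarrow> \<bar>k\<bar> \<le> int M \<Longrightarrow> bnd M (iupdate x a k s)"
  by (simp add: bnd_def)

lemma bnd_rupdate: "bnd M s \<Longrightarrow> bnd M (rupdate x a k s)"
  by (simp add: bnd_def)

lemma wp_mono: "wp f M c Q s \<Longrightarrow> (\<And>s'. Q s' \<Longrightarrow> Q' s') \<Longrightarrow> wp f M c Q' s"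
  unfolding wp_def by blast

lemma wp_Skip: "Q s \<Longrightarrow> wp f M Skip Q s"
  unfolding wp_def by (auto intro!: exI exec.Skip)

lemma wp_IAssign:
  assumes "bnd M s \<Longrightarrow> \<bar>ival e s\<bar> \<le> int M" "Q (iupdate x (ival a s) (ival e s) s)"
  shows "wp f M (IAssign x a e) Q s"
  unfolding wp_def
proof (intro impI exI conjI)
  assume b: "bnd M s"
  show "exec f (IAssign x a e) s (1 + icost a s + icost e s) (iupdate x (ival a s) (ival e s) s)"
    by (rule exec.IAssign)
  show "1 + icost a s + icost e s \<le> costb M (IAssign x a e)"
    using icost_le[OF b] by (simp add: add_mono)
qed (use assms bnd_iupdate in auto)

lemma wp_RAssign:
  assumes "Q (rupdate x (ival a s) (rval u s) s)"
  shows "wp f M (RAssign x a u) Q s"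
  unfolding wp_def
proof (intro impI exI conjI)
  assume b: "bnd M s"
  show "exec f (RAssign x a u) s (1 + icost a s + rcost u s) (rupdate x (ival a s) (rval u s) s)"
    by (rule exec.RAssign)
  show "1 + icost a s + rcost u s \<le> costb M (RAssign x a u)"
    using icost_le[OF b] rcost_le[OF b] by (simp add: add_mono)
qed (use assms bnd_rupdate in auto)

lemma wp_Query:
  assumes "Q (rupdate y (ival a s) (f (segment_set s x 0 (ival l s))) s)"
  shows "wp f M (Query y a x l) Q s"
  unfolding wp_def
proof (intro impI exI conjI)
  assume b: "bnd M s"
  show "exec f (Query y a x l) s (1 + icost a s + icost l s + nat (ival l s))
      (rupdate y (ival a s) (f (segment_set s x 0 (ival l s))) s)"
    by (rule exec.Query)
  have "nat (ival l s) \<le> ivalb M l" using ival_le[OF b, of l] by linarith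
  then show "1 + icost a s + icost l s + nat (ival l s) \<le> costb M (Query y a x l)"
    using icost_le[OF b] by (simp add: add_mono)
qed (use assms bnd_rupdate in auto)

lemma wp_Seq: "wp f M c (wp f M d Q) s \<Longrightarrow> wp f M (Seq c d) Q s"
  unfolding wp_def
proof (intro impI)
  assume a: "bnd M s \<longrightarrow> (\<exists>t s'. exec f c s t s' \<and> t \<le> costb M c \<and>
    (bnd M s' \<longrightarrow> (\<exists>t s''. exec f d s' t s'' \<and> t \<le> costb M d \<and> Q s'' \<and> bnd M s'')) \<and> bnd M s')"
    and b: "bnd M s"
  from a b obtain t s' t' s'' where
    "exec f c s t s'" "t \<le> costb M c" "exec f d s' t' s''" "t' \<le> costb M d" "Q s''" "bnd M s''"
    by blast
  then show "\<exists>t s'. exec f (Seq c d) s t s' \<and> t \<le> costb M (Seq c d) \<and> Q s' \<and> bnd M s'"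
    by (intro exI[of _ "1 + t + t'"] exI[of _ s'']) (auto dest: exec.Seq)
qed

lemma wp_Cond:
  assumes "bval b s \<Longrightarrow> wp f M c Q s" "\<not> bval b s \<Longrightarrow> wp f M d Q s"
  shows "wp f M (Cond b c d) Q s"
  unfolding wp_def
proof (intro impI)
  assume bn: "bnd M s"
  note cb = bcost_le[OF bn, of b]
  show "\<exists>t s'. exec f (Cond b c d) s t s' \<and> t \<le> costb M (Cond b c d) \<and> Q s' \<and> bnd M s'"
  proof (cases "bval b s")
    case True
    then obtain t s' where "exec f c s t s'" "t \<le> costb M c" "Q s'" "bnd M s'"
      using assms(1) bn by (auto simp: wp_def)
    then show ?thesis using cb True
      by (intro exI[of _ "1 + bcost b s + t"] exI[of _ s']) (use exec.CondTrue[of b s f c t s' d] in auto)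
  next
    case False
    then obtain t s' where "exec f d s t s'" "t \<le> costb M d" "Q s'" "bnd M s'"
      using assms(2) bn by (auto simp: wp_def)
    then show ?thesis using cb False
      by (intro exI[of _ "1 + bcost b s + t"] exI[of _ s']) (use exec.CondFalse[of b s f d t s' c] in auto)
  qed
qed

text \<open>The index of the invariant counts the iterations still allowed and serves as the
  variant. Its initial value must not exceed \<open>M\<close>, because \<open>costb\<close> charges
  \<open>M + 1\<close> passes, the last one for the failing guard.\<close>

lemma wp_While:
  assumes init: "I k s" and "k \<le> M"
    and step: "\<And>k s. I k s \<Longrightarrow> bval b s \<Longrightarrow> 0 < k \<and> wp f M c (I (k - 1)) s"
    and fin: "\<And>k s. I k s \<Longrightarrow> \<not> bval b s \<Longrightarrow> Q s"
  shows "wp f M (While b c) Q s"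
proof -
  define B where "B = 1 + bcostb M b + costb M c"
  have "\<exists>t s'. exec f (While b c) s t s' \<and> t \<le> (k + 1) * B \<and> Q s' \<and> bnd M s'"
    if "I k s" "bnd M s" for k s
    using that
  proof (induction k arbitrary: s)
    case 0
    then have "\<not> bval b s" using step by blast
    then show ?case using 0 fin[OF 0(1)] bcost_le[OF 0(2), of b]
      by (intro exI[of _ "1 + bcost b s"] exI[of _ s]) (use exec.WhileFalse[of b s f c] in \<open>auto simp: B_def\<close>)
  next
    case (Suc k)
    show ?case
    proof (cases "bval b s")
      case True
      then have "wp f M c (I k) s" using step[OF Suc.prems(1)] by simp
      then obtain t s' where 1: "exec f c s t s'" "t \<le> costb M c" "I k s'" "bnd M s'"
        using Suc.prems by (auto simp: wp_def)
      then obtain t' s'' where 2: "exec f (While b c) s' t' s''" "t' \<le> (k + 1) * B" "Q s''" "bnd M s''"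
        using Suc.IH by blast
      have "1 + bcost b s + t \<le> B" using 1 bcost_le[OF Suc.prems(2), of b] by (simp add: B_def)
      with 2 have "1 + bcost b s + t + t' \<le> (Suc k + 1) * B" by simp
      with 1 2 True show ?thesis by (blast intro: exec.WhileTrue)
    next
      case False
      then show ?thesis using Suc.prems fin[OF Suc.prems(1)] bcost_le[OF Suc.prems(2), of b]
        by (intro exI[of _ "1 + bcost b s"] exI[of _ s]) (use exec.WhileFalse[of b s f c] in \<open>auto simp: B_def\<close>)
    qed
  qed
  moreover have "(k + 1) * B \<le> costb M (While b c)"
    unfolding costb.simps B_def using \<open>k \<le> M\<close> by (intro mult_right_mono) auto
  ultimately show ?thesis using init unfolding wp_def by (meson order_trans)
qed

section \<open>Framing: what a program leaves unchanged\<close>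

primrec imods :: "com \<Rightarrow> vname set" where
  "imods Skip = {}"
| "imods (IAssign x a e) = {x}"
| "imods (RAssign x a u) = {}"
| "imods (Query y a x l) = {}"
| "imods (Seq c d) = imods c \<union> imods d"
| "imods (Cond b c d) = imods c \<union> imods d"
| "imods (While b c) = imods c"

primrec rmods :: "com \<Rightarrow> vname set" where
  "rmods Skip = {}"
| "rmods (IAssign x a e) = {}"
| "rmods (RAssign x a u) = {x}"
| "rmods (Query y a x l) = {y}"
| "rmods (Seq c d) = rmods c \<union> rmods d"
| "rmods (Cond b c d) = rmods c \<union> rmods d"
| "rmods (While b c) = rmods c"

definition agree :: "com \<Rightarrow> state \<Rightarrow> state \<Rightarrow> bool" where
  "agree c s s' \<longleftrightarrow> (\<forall>y. y \<notin> imods c \<longrightarrow> ints s' y = ints s y) \<and>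
     (\<forall>y. y \<notin> rmods c \<longrightarrow> reals s' y = reals s y)"

lemma agree_ints: "agree c s s' \<Longrightarrow> y \<notin> imods c \<Longrightarrow> ints s' y = ints s y"
  and agree_reals: "agree c s s' \<Longrightarrow> y \<notin> rmods c \<Longrightarrow> reals s' y = reals s y"
  by (auto simp: agree_def)

lemma exec_agree: "exec f c s t s' \<Longrightarrow> agree c s s'"
  by (induction rule: exec.induct) (auto simp: agree_def)

lemma wp_frame: "wp f M c Q s \<Longrightarrow> (\<And>s'. agree c s s' \<Longrightarrow> Q s' \<Longrightarrow> Q' s') \<Longrightarrow> wp f M c Q' s"
  unfolding wp_def using exec_agree by blast

abbreviation IVar :: "vname \<Rightarrow> iexp" where
  "IVar x \<equiv> IRead x (IConst 0)"

definition For :: "vname \<Rightarrow> iexp \<Rightarrow> com \<Rightarrow> com" where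
  "For x e c = Seq (IAssign x (IConst 0) (IConst 0))
     (While (ILess (IVar x) e) (Seq c (IAssign x (IConst 0) (IAdd (IVar x) (IConst 1)))))"

lemma imods_For [simp]: "imods (For x e c) = insert x (imods c)"
  and rmods_For [simp]: "rmods (For x e c) = rmods c"
  by (auto simp: For_def)

text \<open>The limit \<open>e\<close> is evaluated anew before each iteration, hence the premise
  \<open>expr\<close>. Agreement with the initial state is handed to the premises, so that
  invariants need not mention arrays that the loop never assigns.\<close>

lemma wp_For:
  assumes N: "N \<le> M" and x: "x \<notin> imods c"
    and init: "I 0 (iupdate x 0 0 s)"
    and step: "\<And>k s'. k < N \<Longrightarrow> I k s' \<Longrightarrow> ints s' x 0 = int k \<Longrightarrow> agree (For x e c) s s' \<Longrightarrow>
      wp f M c (\<lambda>s''. I (Suc k) (iupdate x 0 (int (Suc k)) s'')) s'"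
    and expr: "\<And>k s'. k \<le> N \<Longrightarrow> I k s' \<Longrightarrow> agree (For x e c) s s' \<Longrightarrow> ival e s' = int N"
    and fin: "\<And>s'. I N s' \<Longrightarrow> agree (For x e c) s s' \<Longrightarrow> Q s'"
  shows "wp f M (For x e c) Q s"
  unfolding For_def
proof (rule wp_Seq, rule wp_IAssign)
  let ?J = "\<lambda>k s'. k \<le> N \<and> I (N - k) s' \<and> ints s' x 0 = int (N - k) \<and> agree (For x e c) s s'"
  have ag: "agree (For x e c) s (iupdate x 0 0 s)" by (auto simp: agree_def)
  show "wp f M (While (ILess (IVar x) e) (Seq c (IAssign x (IConst 0) (IAdd (IVar x) (IConst 1))))) Q
      (iupdate x (ival (IConst 0) s) (ival (IConst 0) s) s)"
  proof (rule wp_While[where I = ?J and k = N])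
    show "N \<le> N \<and> I (N - N) (iupdate x (ival (IConst 0) s) (ival (IConst 0) s) s) \<and>
       ints (iupdate x (ival (IConst 0) s) (ival (IConst 0) s) s) x 0 = int (N - N) \<and>
       agree (For x e c) s (iupdate x (ival (IConst 0) s) (ival (IConst 0) s) s)"
      using init ag by simp
  next
    fix k s'
    assume J: "?J k s'" and b: "bval (ILess (IVar x) e) s'"
    have lt: "N - k < N" using J b expr[of "N - k" s'] by (auto split: if_splits)
    have eq: "Suc (N - k) = N - (k - 1)" using lt J by linarith
    have "wp f M c (\<lambda>s''. I (Suc (N - k)) (iupdate x 0 (int (Suc (N - k))) s'')) s'"
      using J step[OF lt] by blast
    then have "wp f M c (\<lambda>s''. wp f M (IAssign x (IConst 0) (IAdd (IVar x) (IConst 1))) (?J (k - 1)) s'') s'"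
    proof (rule wp_frame)
      fix s'' assume ag': "agree c s' s''" and I': "I (Suc (N - k)) (iupdate x 0 (int (Suc (N - k))) s'')"
      have v: "ints s'' x 0 = int (N - k)" using J agree_ints[OF ag' x] by simp
      have ag3: "agree (For x e c) s (iupdate x 0 (int (Suc (N - k))) s'')"
        using J ag' by (auto simp: agree_def)
      show "wp f M (IAssign x (IConst 0) (IAdd (IVar x) (IConst 1))) (?J (k - 1)) s''"
      proof (rule wp_IAssign)
        have e: "ival (IAdd (IVar x) (IConst 1)) s'' = int (Suc (N - k))" using v by simp
        show "\<bar>ival (IAdd (IVar x) (IConst 1)) s''\<bar> \<le> int M" unfolding e using lt N by linarith
        show "?J (k - 1) (iupdate x (ival (IConst 0) s'') (ival (IAdd (IVar x) (IConst 1)) s'') s'')"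
          unfolding e using ag3 I' J by (simp only: eq ival.simps) auto
      qed
    qed
    then show "0 < k \<and> wp f M (Seq c (IAssign x (IConst 0) (IAdd (IVar x) (IConst 1)))) (?J (k - 1)) s'"
      using lt by (auto intro: wp_Seq)
  next
    fix k s' assume J: "?J k s'" and b: "\<not> bval (ILess (IVar x) e) s'"
    have "k = 0" using J b expr[of "N - k" s'] by auto
    then show "Q s'" using J fin[of s'] by simp
  qed (rule N)
qed auto

section \<open>Greedy covering with small items\<close>

text \<open>Second-order sharpening of \<open>1 - x \<le> exp (- x)\<close>: the derivative of
  \<open>(1 - x) * exp (x + x\<^sup>2 / 2)\<close> is
  \<open>- x\<^sup>2 * exp (x + x\<^sup>2 / 2)\<close>. The quadratic term is the source of the gain
  of order \<open>1 / m\<close>.\<close>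

lemma one_minus_le_exp:
  fixes x :: real
  assumes "0 \<le> x"
  shows "1 - x \<le> exp (- x - x\<^sup>2 / 2)"
proof -
  define g where "g = (\<lambda>x :: real. (1 - x) * exp (x + x\<^sup>2 / 2))"
  have "g x \<le> g 0"
  proof (rule DERIV_nonpos_imp_nonincreasing[OF assms])
    fix y :: real assume "0 \<le> y"
    have "(g has_real_derivative - y\<^sup>2 * exp (y + y\<^sup>2 / 2)) (at y)"
      unfolding g_def
      by (auto intro!: derivative_eq_intros simp: algebra_simps power2_eq_square)
    then show "\<exists>d. (g has_real_derivative d) (at y) \<and> d \<le> 0"
      by (intro exI[of _ "- y\<^sup>2 * exp (y + y\<^sup>2 / 2)"]) auto
  qed
  then have "(1 - x) * exp (x + x\<^sup>2 / 2) \<le> 1" by (simp add: g_def)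
  then have "1 - x \<le> 1 / exp (x + x\<^sup>2 / 2)" by (simp add: field_simps)
  also have "\<dots> = exp (- x - x\<^sup>2 / 2)" by (simp add: exp_minus inverse_eq_divide[symmetric] flip: exp_minus)
  finally show ?thesis .
qed

text \<open>\<open>X\<close> will be the price of the greedy set relative to a competing set. With
  \<open>d = 1 / m\<close>, scaling the budget costs \<open>d / 8\<close> in the exponent and the
  quadratic term returns at least \<open>3 / 8 * d\<close>. The surplus \<open>d / 4\<close> lowers
  \<open>1 / exp 1\<close> by a factor \<open>1 - d / 8\<close>, and by \<open>exp 1 \<le> 3\<close>
  this is worth a factor \<open>1 + d / 16\<close>.\<close>

lemma greedy_constant:
  fixes m :: nat and X :: real
  assumes "1 \<le> m" and X: "1 - 1 / (8 * real m) \<le> X"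
  shows "(1 - 1 / exp 1) * (1 + 1 / (16 * real m)) \<le> 1 - exp (- X - X\<^sup>2 / (2 * real m))"
proof -
  define d where "d = 1 / real m"
  have d: "0 < d" "d \<le> 1" using assms by (auto simp: d_def)
  have X': "1 - d / 8 \<le> X" using X by (simp add: d_def)
  have "(7 / 8)\<^sup>2 \<le> X\<^sup>2" using X' d by (intro power_mono) auto
  then have "3 / 8 * d \<le> d * X\<^sup>2 / 2" using d by (simp add: power2_eq_square field_simps)
  then have e: "1 + d / 4 \<le> X + d * X\<^sup>2 / 2" using X' by linarith
  have "exp (- X - X\<^sup>2 / (2 * real m)) = exp (- (X + d * X\<^sup>2 / 2))" by (simp add: d_def)
  also have "\<dots> \<le> exp (- (1 + d / 4))" using e by simp
  also have "\<dots> = 1 / exp 1 * exp (- (d / 4))" 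
  proof -
    have "- (1 + d / 4) = - 1 + - (d / 4)" by simp
    then have "exp (- (1 + d / 4)) = exp (- 1) * exp (- (d / 4))" by (simp only: exp_add)
    then show ?thesis by (simp only: exp_minus[of 1] inverse_eq_divide)
  qed
  also have "\<dots> \<le> 1 / exp 1 * (1 - d / 8)"
  proof (rule mult_left_mono)
    have "1 \<le> (1 - d / 8) * (1 + d / 4)" using d by (simp add: field_simps power2_eq_square)
    also have "\<dots> \<le> (1 - d / 8) * exp (d / 4)" using d by (intro mult_left_mono) auto
    finally show "exp (- (d / 4)) \<le> 1 - d / 8" by (simp add: exp_minus field_simps)
  qed simp
  finally have "1 - exp (- X - X\<^sup>2 / (2 * real m)) \<ge> 1 - 1 / exp 1 * (1 - d / 8)" by simp
  moreover have "(1 - 1 / exp 1) * (1 + d / 16) \<le> 1 - 1 / exp 1 * (1 - d / 8)"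
  proof -
    define c :: real where "c = 1 / exp 1"
    have "1 \<le> 3 * c" using exp_le by (simp add: c_def)
    then have "d * 1 \<le> d * (3 * c)" using d by (intro mult_left_mono) auto
    then show ?thesis unfolding c_def[symmetric] by (simp add: algebra_simps)
  qed
  ultimately have "(1 - 1 / exp 1) * (1 + d / 16) \<le> 1 - exp (- X - X\<^sup>2 / (2 * real m))" by linarith
  moreover have "d / 16 = 1 / (16 * real m)" by (simp add: d_def)
  ultimately show ?thesis by simp
qed

locale santa_claus =
  fixes n m :: nat and \<Gamma> :: "nat \<Rightarrow> nat set" and f :: "nat set \<Rightarrow> real"
  assumes inst: "santa_claus_instance {..<n} {..<m} \<Gamma> f"
begin

lemma \<Gamma>_sub: "i < n \<Longrightarrow> \<Gamma> i \<subseteq> {..<m}"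
  and f_empty [simp]: "f {} = 0"
  and f_nonneg: "A \<subseteq> {..<m} \<Longrightarrow> 0 \<le> f A"
  and f_mono: "A \<subseteq> B \<Longrightarrow> B \<subseteq> {..<m} \<Longrightarrow> f A \<le> f B"
  and f_submod: "A \<subseteq> {..<m} \<Longrightarrow> B \<subseteq> {..<m} \<Longrightarrow> f (A \<union> B) + f (A \<inter> B) \<le> f A + f B"
  using inst by (auto simp: santa_claus_instance_def)

abbreviation greedy_factor :: real where
  "greedy_factor \<equiv> (1 - 1 / exp 1) * (1 + 1 / (16 * real m))"

lemma f_Un_le_sum_marginals:
  assumes "G \<subseteq> {..<m}" "C \<subseteq> {..<m}"
  shows "f (G \<union> C) - f G \<le> (\<Sum>j\<in>C - G. f (insert j G) - f G)"
proof -
  have "finite (C - G)" using assms finite_subset by blast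
  have "D \<subseteq> C - G \<Longrightarrow> f (G \<union> D) - f G \<le> (\<Sum>j\<in>D. f (insert j G) - f G)" if "finite D" for D
    using that
  proof (induction D rule: finite_induct)
    case (insert j D)
    have sub: "G \<union> D \<subseteq> {..<m}" "insert j G \<subseteq> {..<m}" using insert.prems assms by auto
    have "(G \<union> D) \<inter> insert j G = G" using insert by auto
    moreover have "(G \<union> D) \<union> insert j G = G \<union> insert j D" by auto
    ultimately have "f (G \<union> insert j D) + f G \<le> f (G \<union> D) + f (insert j G)"
      using f_submod[OF sub] by simp
    then show ?case using insert by simp
  qed simp
  from this[of "C - G"] \<open>finite (C - G)\<close> show ?thesis by simp
qed

lemma f_insert_le: "G \<subseteq> {..<m} \<Longrightarrow> j < m \<Longrightarrow> f (insert j G) \<le> f G + f {j}"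
  using f_submod[of G "{j}"] f_nonneg[of "G \<inter> {j}"] by (auto simp: le_infI1)

lemma f_le_sum: "C \<subseteq> {..<m} \<Longrightarrow> f C \<le> (\<Sum>j\<in>C. f {j})"
  using f_Un_le_sum_marginals[of "{}" C] by simp

text \<open>Averaging over \<open>C - G\<close>: some item is at least as dense as the whole set,
  hence so is the densest item \<open>g\<close>. Densities are cross-multiplied because this is the
  comparison that the program can carry out.\<close>

lemma greedy_marginal:
  fixes z :: "nat \<Rightarrow> nat"
  assumes G: "G \<subseteq> {..<m}" "C \<subseteq> {..<m}" and g: "g < m"
    and best: "\<And>j. j \<in> C - G \<Longrightarrow>
      (f (insert j G) - f G) * real (z g) \<le> (f (insert g G) - f G) * real (z j)"
  shows "real (z g) * (f C - f G) \<le> (f (insert g G) - f G) * real (sum z C)"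
proof -
  have "real (z g) * (f C - f G) \<le> real (z g) * (f (G \<union> C) - f G)"
    using f_mono[of C "G \<union> C"] G by (intro mult_left_mono) auto
  also have "\<dots> \<le> real (z g) * (\<Sum>j\<in>C - G. f (insert j G) - f G)"
    using f_Un_le_sum_marginals[OF G] by (intro mult_left_mono) auto
  also have "\<dots> = (\<Sum>j\<in>C - G. (f (insert j G) - f G) * real (z g))"
    by (simp add: sum_distrib_left mult.commute)
  also have "\<dots> \<le> (\<Sum>j\<in>C - G. (f (insert g G) - f G) * real (z j))"
    by (intro sum_mono best)
  also have "\<dots> = (f (insert g G) - f G) * real (sum z (C - G))"
    by (simp add: sum_distrib_left)
  also have "\<dots> \<le> (f (insert g G) - f G) * real (sum z C)"
  proof (rule mult_left_mono)
    have "finite C" using G finite_subset by blast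
    then show "real (sum z (C - G)) \<le> real (sum z C)"
      by (simp only: of_nat_le_iff) (intro sum_mono2, auto)
    show "0 \<le> f (insert g G) - f G" using f_mono[of G "insert g G"] G g by auto
  qed
  finally show ?thesis .
qed

text \<open>The quadratic term measures how much faster than \<open>exp (- z(G) / z(C))\<close> the greedy algorithm
  makes progress because it uses at most \<open>m\<close> items.  This gain pays for the scaled down budget
  and for the discretization of the target value.\<close>

definition greedy_progress :: "(nat \<Rightarrow> nat) \<Rightarrow> nat set \<Rightarrow> nat set \<Rightarrow> bool" where
  "greedy_progress z C G \<longleftrightarrow> f C - f G \<le> f C *
     exp (- (\<Sum>j\<in>G. real (z j) / real (sum z C)) - (\<Sum>j\<in>G. (real (z j) / real (sum z C))\<^sup>2) / 2)"

lemma greedy_progress_empty: "greedy_progress z C {}"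
  by (simp add: greedy_progress_def)

lemma greedy_progress_insert:
  assumes prog: "greedy_progress z C G" and G: "G \<subseteq> {..<m}" "C \<subseteq> {..<m}" and g: "g < m" "g \<notin> G"
    and z: "\<And>j. j < m \<Longrightarrow> 0 < z j"
    and best: "\<And>j. j \<in> C - G \<Longrightarrow>
      (f (insert j G) - f G) * real (z g) \<le> (f (insert g G) - f G) * real (z j)"
  shows "greedy_progress z C (insert g G)"
proof (cases "C = {}")
  case True
  then show ?thesis using f_nonneg[of "insert g G"] G g by (simp add: greedy_progress_def)
next
  case False
  define c where "c = real (sum z C)"
  have fin: "finite G" "finite C" using G finite_subset by blast+
  have "0 < sum z C" using False fin z G by (intro sum_pos) blast+
  then have c: "0 < c" by (simp only: c_def of_nat_0_less_iff)
  define x where "x = real (z g) / c"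
  have x: "0 \<le> x" using c by (simp add: x_def)
  define P where "P = exp (- (\<Sum>j\<in>G. real (z j) / c) - (\<Sum>j\<in>G. (real (z j) / c)\<^sup>2) / 2)"
  have fC: "0 \<le> f C" using f_nonneg G by simp
  have P': "exp (- (\<Sum>j\<in>insert g G. real (z j) / c) - (\<Sum>j\<in>insert g G. (real (z j) / c)\<^sup>2) / 2)
      = P * exp (- x - x\<^sup>2 / 2)"
    using fin g unfolding P_def x_def exp_add[symmetric] by (simp add: algebra_simps)
  have "real (z g) * (f C - f G) \<le> (f (insert g G) - f G) * c"
    unfolding c_def by (rule greedy_marginal[OF G g(1) best])
  then have "x * (f C - f G) \<le> f (insert g G) - f G" using c by (simp add: x_def field_simps)
  then have step: "f C - f (insert g G) \<le> (1 - x) * (f C - f G)" by (simp add: algebra_simps)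
  have "f C - f (insert g G) \<le> f C * (P * exp (- x - x\<^sup>2 / 2))"
  \<comment> \<open>Once \<open>C\<close> is matched in value nothing is left to show; otherwise the
    gap was nonnegative before the step, and the bound on \<open>1 - x\<close> may be multiplied by
    it.\<close>
  proof (cases "f C - f (insert g G) \<le> 0")
    case True
    moreover have "0 \<le> f C * (P * exp (- x - x\<^sup>2 / 2))" using fC by (simp add: P_def)
    ultimately show ?thesis by linarith
  next
    case False
    have "f G \<le> f (insert g G)" using G g by (intro f_mono) auto
    then have nn: "0 \<le> f C - f G" using False by simp
    have "f C - f (insert g G) \<le> (1 - x) * (f C - f G)" by (rule step)
    also have "\<dots> \<le> exp (- x - x\<^sup>2 / 2) * (f C - f G)"
      using one_minus_le_exp[OF x] nn by (intro mult_right_mono)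
    also have "\<dots> \<le> exp (- x - x\<^sup>2 / 2) * (f C * P)"
      using prog by (intro mult_left_mono) (auto simp: greedy_progress_def P_def c_def)
    finally show ?thesis by (simp add: algebra_simps)
  qed
  then show ?thesis unfolding greedy_progress_def c_def[symmetric] P' .
qed

text \<open>By contradiction: if the greedy set were expensive relative to \<open>C\<close>, its
  progress would have carried it to the value \<open>greedy_factor * f C\<close>. Spread over at
  most \<open>m\<close> items, relative prices with sum \<open>X\<close> have a square sum of at
  least \<open>X\<^sup>2 / m\<close>, which is what \<open>greedy_constant\<close> asks for.\<close>

lemma greedy_cost:
  assumes prog: "greedy_progress z C G" and G: "G \<subseteq> {..<m}" "C \<subseteq> {..<m}"
    and z: "\<And>j. j < m \<Longrightarrow> 0 < z j"
    and lt: "f G < greedy_factor * f C"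
  shows "8 * m * sum z G \<le> (8 * m - 1) * sum z C"
proof (rule ccontr)
  assume "\<not> ?thesis"
  then have big: "(8 * m - 1) * sum z C < 8 * m * sum z G" by simp
  have fC: "0 < f C"
  proof -
    have "0 \<le> f C" "0 \<le> f G" using f_nonneg G by auto
    then show ?thesis using lt by (cases "f C = 0") auto
  qed
  then have "C \<noteq> {}" by auto
  then have m: "1 \<le> m" using G by (cases m) auto
  have fin: "finite G" "finite C" using G finite_subset by blast+
  have "0 < sum z C" using \<open>C \<noteq> {}\<close> fin z G by (intro sum_pos) blast+
  define c where "c = real (sum z C)"
  have c: "0 < c" using \<open>0 < sum z C\<close> by (simp only: c_def of_nat_0_less_iff)
  define X where "X = (\<Sum>j\<in>G. real (z j) / c)"
  have "real ((8 * m - 1) * sum z C) < real (8 * m * sum z G)" using big by (simp only: of_nat_less_iff)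
  then have "(8 * real m - 1) * c < 8 * real m * (c * X)"
    using m c by (simp add: c_def X_def of_nat_diff sum_divide_distrib[symmetric] of_nat_sum)
  then have "(8 * real m - 1) < 8 * real m * X" using c by (simp add: mult.left_commute mult.commute)
  then have X: "1 - 1 / (8 * real m) \<le> X" using m by (simp add: field_simps)
  have "X\<^sup>2 / real m \<le> (\<Sum>j\<in>G. (real (z j) / c)\<^sup>2)"
  proof -
    \<comment> \<open>Cauchy-Schwarz, by expanding the squared deviations from \<open>X / m\<close>;
      fewer than \<open>m\<close> items only help.\<close>
    have "0 \<le> (\<Sum>j\<in>G. (real (z j) / c - X / m)\<^sup>2)" by (intro sum_nonneg) auto
    also have "\<dots> = (\<Sum>j\<in>G. (real (z j) / c)\<^sup>2 - 2 * (X / m) * (real (z j) / c) + (X / m)\<^sup>2)"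
      by (intro sum.cong) (simp_all add: power2_diff mult_ac)
    also have "\<dots> = (\<Sum>j\<in>G. (real (z j) / c)\<^sup>2) - 2 * (X / m) * X + card G * (X / m)\<^sup>2"
      by (simp only: sum.distrib sum_subtractf X_def sum_distrib_left) simp
    also have "card G * (X / m)\<^sup>2 \<le> real m * (X / m)\<^sup>2"
      using card_mono[OF _ G(1)] by (intro mult_right_mono) auto
    finally show ?thesis using m by (simp add: power2_eq_square)
  qed
  then have q: "X\<^sup>2 / (2 * real m) \<le> (\<Sum>j\<in>G. (real (z j) / c)\<^sup>2) / 2" using m by (simp add: field_simps)
  have "f C - f G \<le> f C * exp (- X - (\<Sum>j\<in>G. (real (z j) / c)\<^sup>2) / 2)"
    using prog by (simp add: greedy_progress_def X_def c_def)
  also have "\<dots> \<le> f C * exp (- X - X\<^sup>2 / (2 * real m))" using q fC by simp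
  finally have "f C * (1 - exp (- X - X\<^sup>2 / (2 * real m))) \<le> f G" by (simp add: algebra_simps)
  moreover have "f C * (greedy_factor)
      \<le> f C * (1 - exp (- X - X\<^sup>2 / (2 * real m)))"
    using greedy_constant[OF m X] fC by (intro mult_left_mono) auto
  ultimately show False using lt by (simp add: mult.commute)
qed

end


section \<open>Weighted bipartite matching\<close>

text \<open>Fractional Hall condition. The inequalities describe the independence polytope of the
  transversal matroid, whose independent sets are the sets of players matchable to distinct
  items.\<close>

definition hall :: "nat \<Rightarrow> nat \<Rightarrow> (nat \<Rightarrow> nat \<Rightarrow> bool) \<Rightarrow> (nat \<Rightarrow> real) \<Rightarrow> bool" where
  "hall n m E b \<longleftrightarrow> (\<forall>i<n. 0 \<le> b i \<and> b i \<le> 1) \<and>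
     (\<forall>X\<subseteq>{..<n}. sum b X \<le> card {j. j < m \<and> (\<exists>i\<in>X. E i j)})"

text \<open>The easy half of the matroid rank formula, with \<open>S\<close> as the matched players
  of \<open>A\<close> and \<open>X\<close> as a Koenig-type certificate. All neighbours of
  \<open>X\<close> are partners of players in \<open>X \<inter> S\<close>, which limits the mass of
  \<open>b\<close> on \<open>X\<close>; on \<open>A - X\<close>, where everybody is matched, the
  mass is at most one per player.\<close>

lemma hall_sum_le_card:
  assumes hall: "hall n m E b" and A: "A \<subseteq> {..<n}" and "S \<subseteq> A" "X \<subseteq> A" "A - S \<subseteq> X"
    and own: "\<And>i j. i \<in> X \<Longrightarrow> j < m \<Longrightarrow> E i j \<Longrightarrow> \<exists>i'\<in>X \<inter> S. p i' = Suc j"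
  shows "sum b A \<le> card S"
proof -
  have fin: "finite A" using A finite_subset by blast
  then have fins: "finite X" "finite S" using assms finite_subset by blast+
  let ?N = "{j. j < m \<and> (\<exists>i\<in>X. E i j)}"
  have "Suc ` ?N \<subseteq> p ` (X \<inter> S)" using own by force
  then have "card (Suc ` ?N) \<le> card (X \<inter> S)"
    using fins by (meson card_image_le card_mono finite_Int finite_imageI order_trans)
  then have N: "card ?N \<le> card (X \<inter> S)" by (simp add: card_image)
  have "sum b A = sum b (A - X) + sum b X"
    using fin \<open>X \<subseteq> A\<close> by (simp add: sum.subset_diff)
  also have "sum b (A - X) \<le> (\<Sum>i\<in>A - X. 1)"
    using hall A by (intro sum_mono) (auto simp: hall_def)
  also have "sum b X \<le> card ?N" using hall A \<open>X \<subseteq> A\<close> by (auto simp: hall_def)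
  finally have "sum b A \<le> card (A - X) + card (X \<inter> S)" using N by simp
  also have "card (A - X) + card (X \<inter> S) = card ((A - X) \<union> (X \<inter> S))"
    using fin fins by (intro card_Un_disjoint[symmetric]) auto
  also have "(A - X) \<union> (X \<inter> S) = S" using assms by blast
  finally show ?thesis by simp
qed

text \<open>The threshold \<open>\<tau>\<close> strengthens the comparison for an induction over
  decreasing weights, in the manner of Abel summation. The intended inequality is the case
  \<open>\<tau> = 0\<close>.\<close>

definition weight_dominates :: "(nat \<Rightarrow> real) \<Rightarrow> (nat \<Rightarrow> real) \<Rightarrow> nat set \<Rightarrow> nat set \<Rightarrow> bool" where
  "weight_dominates b w A S \<longleftrightarrow> (\<forall>\<tau>. (\<forall>i\<in>A. \<tau> \<le> w i) \<longrightarrow>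
     (\<Sum>i\<in>A. b i * (w i - \<tau>)) \<le> (\<Sum>i\<in>S. w i - \<tau>))"

text \<open>Raising the threshold to \<open>w u\<close> makes the new player weightless, so the old
  comparison applies. Lowering it back to \<open>\<tau>\<close> adds \<open>w u - \<tau>\<close> per
  unit of mass on each side, and \<open>card\<close> compares these masses.\<close>

lemma weight_dominates_insert:
  assumes dom: "weight_dominates b w A S" and "finite A" "finite S" "u \<notin> A" "u \<notin> S"
    and le: "\<And>i. i \<in> A \<Longrightarrow> w u \<le> w i"
    and S': "S' = S \<or> S' = insert u S" and card: "sum b (insert u A) \<le> card S'"
  shows "weight_dominates b w (insert u A) S'"
  unfolding weight_dominates_def
proof (intro allI impI)
  fix \<tau> assume "\<forall>i\<in>insert u A. \<tau> \<le> w i"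
  then have \<tau>: "0 \<le> w u - \<tau>" by simp
  have 1: "(\<Sum>i\<in>S'. w i - \<tau>) = (\<Sum>i\<in>S. w i - w u) + (w u - \<tau>) * card S'"
  proof -
    have "(\<Sum>i\<in>S'. w i - \<tau>) = (\<Sum>i\<in>S'. (w i - w u) + (w u - \<tau>))" by simp
    also have "\<dots> = (\<Sum>i\<in>S'. w i - w u) + (w u - \<tau>) * card S'" by (simp only: sum.distrib) simp
    also have "(\<Sum>i\<in>S'. w i - w u) = (\<Sum>i\<in>S. w i - w u)" using S' assms by auto
    finally show ?thesis .
  qed
  have "(\<Sum>i\<in>insert u A. b i * (w i - \<tau>)) = (\<Sum>i\<in>insert u A. b i * (w i - w u) + (w u - \<tau>) * b i)"
    by (simp add: algebra_simps)
  also have "\<dots> = (\<Sum>i\<in>A. b i * (w i - w u)) + (w u - \<tau>) * sum b (insert u A)"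
    using assms by (simp add: sum.distrib sum_distrib_left distrib_left)
  also have "\<dots> \<le> (\<Sum>i\<in>S. w i - w u) + (w u - \<tau>) * card S'"
    using dom le \<tau> card by (intro add_mono mult_left_mono) (auto simp: weight_dominates_def)
  finally show "(\<Sum>i\<in>insert u A. b i * (w i - \<tau>)) \<le> (\<Sum>i\<in>S'. w i - \<tau>)" using 1 by simp
qed

section \<open>Approachability\<close>

text \<open>\<open>D * L j - (D - 1) * r\<close> measures by how much the load \<open>L j\<close> of item \<open>j\<close> after \<open>r\<close> rounds
  exceeds the target \<open>(1 - 1 / D) * r\<close>.\<close>

definition overload :: "nat \<Rightarrow> nat \<Rightarrow> nat \<Rightarrow> int" where
  "overload D r L = max 0 (int D * int L - (int D - 1) * int r)"

lemma overload_nonneg: "0 \<le> overload D r L"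
  by (simp add: overload_def)

text \<open>Blackwell's condition, with prices \<open>1 + y j\<close> in place of
  \<open>y j\<close>. By \<open>check\<close>, the inner product of the prices with the change
  \<open>d\<close> is not positive; the summand 1, which keeps prices positive for the greedy
  algorithm, costs at most \<open>m * D\<close>. The square sum therefore grows by at most twice
  this error plus the \<open>m\<close> squared changes, each at most the square of
  \<open>D * n\<close>.\<close>

lemma sum_overload_square_step:
  fixes l :: "nat \<Rightarrow> nat"
  assumes "1 \<le> D" "1 \<le> n" and l: "\<And>j. j < m \<Longrightarrow> l j \<le> n"
    and check: "int D * (\<Sum>j<m. (1 + overload D r (L j)) * int (l j))
      \<le> (int D - 1) * (\<Sum>j<m. 1 + overload D r (L j))"
  shows "(\<Sum>j<m. (overload D (Suc r) (L j + l j))\<^sup>2)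
    \<le> (\<Sum>j<m. (overload D r (L j))\<^sup>2) + 3 * int m * (int D)\<^sup>2 * (int n)\<^sup>2"
proof -
  define y d where "y = (\<lambda>j. overload D r (L j))" and "d = (\<lambda>j. int D * int (l j) - (int D - 1))"
  have y0: "0 \<le> y j" for j by (simp add: y_def overload_nonneg)
  have d_lb: "- int D \<le> d j" for j by (simp add: d_def)
  have d_ub: "d j \<le> int D * int n" if "j < m" for j
  proof -
    have "int D * int (l j) \<le> int D * int n" using l[OF that] by (intro mult_left_mono) auto
    then show ?thesis using assms(1) unfolding d_def by linarith
  qed
  have Dn: "int D \<le> int D * int n" using assms(2) by (simp add: mult_le_cancel_left1)
  have d2: "(d j)\<^sup>2 \<le> (int D)\<^sup>2 * (int n)\<^sup>2" if "j < m" for j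
  proof -
    have "\<bar>d j\<bar> \<le> \<bar>int D * int n\<bar>" using d_lb[of j] d_ub[OF that] Dn by (simp add: abs_le_iff)
    then have "(d j)\<^sup>2 \<le> (int D * int n)\<^sup>2" by (simp only: abs_le_square_iff)
    then show ?thesis by (simp only: power_mult_distrib)
  qed
  have step: "(overload D (Suc r) (L j + l j))\<^sup>2 \<le> (y j)\<^sup>2 + 2 * (y j * d j) + (d j)\<^sup>2" for j
  proof -
    define a where "a = int D * int (L j) - (int D - 1) * int r"
    have o: "overload D (Suc r) (L j + l j) = max 0 (a + d j)"
      by (simp add: overload_def a_def d_def algebra_simps)
    have ay: "a \<le> y j" by (simp add: y_def overload_def a_def)
    have "(max 0 (a + d j))\<^sup>2 \<le> (y j + d j)\<^sup>2"
    proof (cases "0 \<le> a + d j")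
      case True
      then show ?thesis using ay by (simp add: power_mono)
    qed auto
    then show ?thesis unfolding o by (simp add: power2_sum algebra_simps)
  qed
  have "(\<Sum>j<m. (1 + y j) * d j) = int D * (\<Sum>j<m. (1 + y j) * int (l j)) - (int D - 1) * (\<Sum>j<m. 1 + y j)"
    unfolding d_def sum_distrib_left sum_subtractf[symmetric] by (intro sum.cong) (auto simp: algebra_simps)
  also have "\<dots> \<le> 0" using check by (simp add: y_def)
  finally have "(\<Sum>j<m. y j * d j) \<le> (\<Sum>j<m. - d j)"
    by (simp add: distrib_right sum.distrib sum_negf)
  also have "\<dots> \<le> (\<Sum>j<m. int D)" using d_lb by (intro sum_mono) (simp add: minus_le_iff)
  finally have yd: "(\<Sum>j<m. y j * d j) \<le> int m * int D" by simp
  have Dn2: "int D \<le> (int D)\<^sup>2 * (int n)\<^sup>2"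
  proof -
    have "1 * int D \<le> int D * int D" using assms(1) by (intro mult_right_mono) auto
    also have "\<dots> = (int D)\<^sup>2 * 1" by (simp add: power2_eq_square)
    also have "\<dots> \<le> (int D)\<^sup>2 * (int n)\<^sup>2" using assms(2) by (intro mult_left_mono) auto
    finally show ?thesis by simp
  qed
  have "(\<Sum>j<m. (overload D (Suc r) (L j + l j))\<^sup>2) \<le> (\<Sum>j<m. (y j)\<^sup>2 + 2 * (y j * d j) + (d j)\<^sup>2)"
    by (intro sum_mono step)
  also have "\<dots> = (\<Sum>j<m. (y j)\<^sup>2) + 2 * (\<Sum>j<m. y j * d j) + (\<Sum>j<m. (d j)\<^sup>2)"
    by (simp add: sum.distrib sum_distrib_left)
  also have "(\<Sum>j<m. (d j)\<^sup>2) \<le> (\<Sum>j<m. (int D)\<^sup>2 * (int n)\<^sup>2)" using d2 by (intro sum_mono) auto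
  also have "(\<Sum>j<m. (int D)\<^sup>2 * (int n)\<^sup>2) = int m * ((int D)\<^sup>2 * (int n)\<^sup>2)" by simp
  also have "(\<Sum>j<m. y j * d j) \<le> int m * ((int D)\<^sup>2 * (int n)\<^sup>2)"
    using yd mult_left_mono[OF Dn2, of "int m"] by simp
  finally show ?thesis by (simp add: y_def algebra_simps)
qed

text \<open>Overloads are scaled by \<open>D\<close>, so an overload of \<open>N\<close> is an
  excess of \<open>N / D\<close> over the target load, exactly the room left up to the capacity
  \<open>N\<close>. This turns approximate balance into exact feasibility.\<close>

lemma load_le_of_sum_overload_square:
  fixes j m :: nat
  assumes "(\<Sum>j<m. (overload D N (L j))\<^sup>2) \<le> (int N)\<^sup>2" "j < m" "1 \<le> D"
  shows "L j \<le> N"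
proof -
  have "(overload D N (L j))\<^sup>2 \<le> (\<Sum>j<m. (overload D N (L j))\<^sup>2)"
    using assms(2) by (intro member_le_sum) auto
  then have "(overload D N (L j))\<^sup>2 \<le> (int N)\<^sup>2" using assms(1) by simp
  then have "overload D N (L j) \<le> int N" by (rule power2_le_imp_le) simp
  then have "int D * int (L j) \<le> int D * int N" by (simp add: overload_def algebra_simps)
  then show ?thesis using assms(3) by (simp add: mult_le_cancel_left_pos)
qed

context santa_claus
begin

section \<open>The configuration LP\<close>

lemma finite_configs: "i < n \<Longrightarrow> finite (configs \<Gamma> f i T)"
  by (rule finite_subset[of _ "Pow {..<m}"]) (use \<Gamma>_sub in \<open>auto simp: configs_def\<close>)

text \<open>\<open>b i\<close> is the LP mass of player \<open>i\<close> on configurations that meet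
  \<open>B\<close>, capped at 1. Each of these occupies an item of \<open>B\<close>, so the packing
  constraints give Hall's condition. The remaining mass, at least \<open>1 - b i\<close>, lies on
  configurations avoiding \<open>B\<close>, whose prices scaled by \<open>\<rho>\<close> pay for
  \<open>w i\<close>; by packing, all configurations together cost at most the sum of the
  prices.\<close>

lemma LP_solution_matching:
  fixes z :: "nat \<Rightarrow> nat" and w :: "nat \<Rightarrow> real"
  assumes x: "config_LP_solution {..<n} {..<m} \<Gamma> f T x"
    and w0: "\<And>i. i < n \<Longrightarrow> 0 \<le> w i" and \<rho>: "0 \<le> \<rho>"
    and w: "\<And>i C. i < n \<Longrightarrow> C \<subseteq> \<Gamma> i \<Longrightarrow> C \<inter> B = {} \<Longrightarrow> T \<le> f C \<Longrightarrow> w i \<le> \<rho> * real (sum z C)"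
  shows "\<exists>b. hall n m (\<lambda>i j. j \<in> \<Gamma> i \<and> j \<in> B) b \<and>
    (\<Sum>i<n. (1 - b i) * w i) \<le> \<rho> * real (\<Sum>j<m. z j)"
proof -
  let ?cf = "\<lambda>i. configs \<Gamma> f i T"
  define Bc Sc where "Bc = (\<lambda>i. {C \<in> ?cf i. C \<inter> B \<noteq> {}})" and "Sc = (\<lambda>i. {C \<in> ?cf i. C \<inter> B = {}})"
  have cover: "1 \<le> sum (x i) (?cf i)" if "i < n" for i
    using x that by (auto simp: config_LP_solution_def)
  have pack: "(\<Sum>i<n. \<Sum>C\<in>{C \<in> ?cf i. j \<in> C}. x i C) \<le> 1" if "j < m" for j
    using x that by (auto simp: config_LP_solution_def)
  have x0: "0 \<le> x i C" if "i < n" "C \<in> ?cf i" for i C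
    using x that by (auto simp: config_LP_solution_def)
  have split: "sum (x i) (?cf i) = sum (x i) (Bc i) + sum (x i) (Sc i)" if "i < n" for i
  proof -
    have "?cf i = Bc i \<union> Sc i" "Bc i \<inter> Sc i = {}" by (auto simp: Bc_def Sc_def)
    moreover have "finite (Bc i)" "finite (Sc i)"
      using finite_configs[OF that] by (auto simp: Bc_def Sc_def)
    ultimately show ?thesis by (simp add: sum.union_disjoint)
  qed
  have Bc0: "0 \<le> sum (x i) (Bc i)" and Sc0: "0 \<le> sum (x i) (Sc i)" if "i < n" for i
    using x0 that by (auto intro!: sum_nonneg simp: Bc_def Sc_def)
  define b where "b = (\<lambda>i. min 1 (sum (x i) (Bc i)))"
  have "hall n m (\<lambda>i j. j \<in> \<Gamma> i \<and> j \<in> B) b"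
    unfolding hall_def
  proof (intro conjI allI impI)
    fix X assume X: "X \<subseteq> {..<n}"
    let ?N = "{j. j < m \<and> (\<exists>i\<in>X. j \<in> \<Gamma> i \<and> j \<in> B)}"
    have "sum b X \<le> (\<Sum>i\<in>X. sum (x i) (Bc i))" by (intro sum_mono) (simp add: b_def)
    also have "\<dots> \<le> (\<Sum>i\<in>X. \<Sum>j\<in>?N. sum (x i) {C \<in> ?cf i. j \<in> C})"
    proof (intro sum_mono)
      fix i assume i: "i \<in> X"
      then have "i < n" using X by auto
      have "sum (x i) (Bc i) \<le> (\<Sum>C\<in>Bc i. \<Sum>j\<in>?N. if j \<in> C then x i C else 0)"
      proof (intro sum_mono)
        fix C assume C: "C \<in> Bc i"
        then obtain j where j: "j \<in> C" "j \<in> ?N"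
          using i \<Gamma>_sub[OF \<open>i < n\<close>] by (fastforce simp: Bc_def configs_def)
        then show "x i C \<le> (\<Sum>j\<in>?N. if j \<in> C then x i C else 0)"
          using member_le_sum[of j ?N "\<lambda>j. if j \<in> C then x i C else 0"] x0[OF \<open>i < n\<close>] C
          by (auto simp: Bc_def)
      qed
      also have "\<dots> = (\<Sum>j\<in>?N. \<Sum>C\<in>Bc i. if j \<in> C then x i C else 0)" by (rule sum.swap)
      also have "\<dots> \<le> (\<Sum>j\<in>?N. \<Sum>C\<in>?cf i. if j \<in> C then x i C else 0)"
        using finite_configs[OF \<open>i < n\<close>] x0[OF \<open>i < n\<close>]
        by (intro sum_mono sum_mono2) (auto simp: Bc_def)
      also have "\<dots> = (\<Sum>j\<in>?N. sum (x i) {C \<in> ?cf i. j \<in> C})"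
        using finite_configs[OF \<open>i < n\<close>] by (intro sum.cong refl sum.inter_filter[symmetric])
      finally show "sum (x i) (Bc i) \<le> (\<Sum>j\<in>?N. sum (x i) {C \<in> ?cf i. j \<in> C})" .
    qed
    also have "\<dots> = (\<Sum>j\<in>?N. \<Sum>i\<in>X. sum (x i) {C \<in> ?cf i. j \<in> C})" by (rule sum.swap)
    also have "\<dots> \<le> (\<Sum>j\<in>?N. 1)"
    proof (intro sum_mono)
      fix j assume j: "j \<in> ?N"
      have "(\<Sum>i\<in>X. sum (x i) {C \<in> ?cf i. j \<in> C}) \<le> (\<Sum>i<n. sum (x i) {C \<in> ?cf i. j \<in> C})"
        using X x0 by (intro sum_mono2) (auto intro!: sum_nonneg)
      then show "(\<Sum>i\<in>X. sum (x i) {C \<in> ?cf i. j \<in> C}) \<le> 1" using pack[of j] j by auto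
    qed
    finally show "sum b X \<le> card ?N" by simp
  qed (use Bc0 in \<open>auto simp: b_def\<close>)
  moreover have "(\<Sum>i<n. (1 - b i) * w i) \<le> \<rho> * real (\<Sum>j<m. z j)"
  proof -
    have "(\<Sum>i<n. (1 - b i) * w i) \<le> (\<Sum>i<n. \<Sum>C\<in>Sc i. x i C * w i)"
    proof (intro sum_mono)
      fix i assume "i \<in> {..<n}"
      then have i: "i < n" by simp
      have "1 - b i \<le> sum (x i) (Sc i)" using cover[OF i] split[OF i] Sc0[OF i] by (auto simp: b_def)
      then have "(1 - b i) * w i \<le> sum (x i) (Sc i) * w i" using w0[OF i] by (intro mult_right_mono)
      then show "(1 - b i) * w i \<le> (\<Sum>C\<in>Sc i. x i C * w i)" by (simp add: sum_distrib_right)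
    qed
    also have "\<dots> \<le> (\<Sum>i<n. \<Sum>C\<in>Sc i. x i C * (\<rho> * real (sum z C)))"
      using x0 w by (intro sum_mono mult_left_mono) (auto simp: Sc_def configs_def)
    also have "\<dots> \<le> (\<Sum>i<n. \<Sum>C\<in>?cf i. x i C * (\<rho> * real (sum z C)))"
      using x0 \<rho> finite_configs
      by (intro sum_mono sum_mono2) (auto simp: Sc_def intro!: mult_nonneg_nonneg sum_nonneg)
    also have "\<dots> = (\<Sum>i<n. \<Sum>C\<in>?cf i. \<Sum>j<m. if j \<in> C then x i C * (\<rho> * real (z j)) else 0)"
    proof (intro sum.cong refl)
      fix i C assume "i \<in> {..<n}" "C \<in> ?cf i"
      then have C: "C \<subseteq> {..<m}" using \<Gamma>_sub by (fastforce simp: configs_def)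
      have "(\<Sum>j<m. if j \<in> C then x i C * (\<rho> * real (z j)) else 0) = (\<Sum>j\<in>{..<m} \<inter> C. x i C * (\<rho> * real (z j)))"
        by (simp add: sum.inter_restrict)
      also have "{..<m} \<inter> C = C" using C by auto
      finally show "x i C * (\<rho> * real (sum z C)) = (\<Sum>j<m. if j \<in> C then x i C * (\<rho> * real (z j)) else 0)"
        by (simp add: sum_distrib_left)
    qed
    also have "\<dots> = (\<Sum>i<n. \<Sum>j<m. \<Sum>C\<in>?cf i. if j \<in> C then x i C * (\<rho> * real (z j)) else 0)"
      by (intro sum.cong refl sum.swap)
    also have "\<dots> = (\<Sum>i<n. \<Sum>j<m. \<Sum>C\<in>{C \<in> ?cf i. j \<in> C}. x i C * (\<rho> * real (z j)))"
      using finite_configs by (intro sum.cong refl sum.inter_filter[symmetric]) auto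
    also have "\<dots> = (\<Sum>j<m. \<Sum>i<n. \<Sum>C\<in>{C \<in> ?cf i. j \<in> C}. x i C * (\<rho> * real (z j)))"
      by (rule sum.swap)
    also have "\<dots> = (\<Sum>j<m. (\<Sum>i<n. \<Sum>C\<in>{C \<in> ?cf i. j \<in> C}. x i C) * (\<rho> * real (z j)))"
      by (simp add: sum_distrib_right)
    also have "\<dots> \<le> (\<Sum>j<m. 1 * (\<rho> * real (z j)))"
      using pack \<rho> by (intro sum_mono mult_right_mono) auto
    finally show ?thesis by (simp add: sum_distrib_left)
  qed
  ultimately show ?thesis by blast
qed

text \<open>If no singleton had a value between \<open>T / m\<close> and \<open>T\<close>, every set
  of value at least \<open>T\<close> would contain an item of value above \<open>T\<close>, since
  otherwise subadditivity would push it below \<open>T\<close>. Raising \<open>T\<close> to the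
  least such singleton value would then change no configuration, contrary to maximality.\<close>

lemma T_opt_near_singleton:
  assumes opt: "is_T_opt {..<n} {..<m} \<Gamma> f T" and T: "0 < T"
  shows "\<exists>a<m. 0 < f {a} \<and> f {a} \<le> T \<and> T \<le> real m * f {a}"
proof (rule ccontr)
  assume neg: "\<not> ?thesis"
  obtain x where x: "config_LP_solution {..<n} {..<m} \<Gamma> f T x"
    using opt by (auto simp: is_T_opt_def config_LP_feasible_def)
  have max: "T' \<le> T" if "0 \<le> T'" "config_LP_feasible {..<n} {..<m} \<Gamma> f T'" for T'
    using opt that by (auto simp: is_T_opt_def)
  define V where "V = {v \<in> (\<lambda>j. f {j}) ` {..<m}. T < v}"
  have finV: "finite V" by (simp add: V_def)
  have ex: "\<exists>j\<in>C. f {j} \<in> V" if C: "C \<subseteq> {..<m}" "T \<le> f C" for C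
  proof (rule ccontr)
    assume "\<not> ?thesis"
    then have small: "real m * f {j} < T" if "j \<in> C" for j
    proof (cases "0 < f {j}")
      case True
      have "j < m" using that C by auto
      moreover have "f {j} \<le> T" using \<open>\<not> (\<exists>j\<in>C. f {j} \<in> V)\<close> that \<open>j < m\<close> by (auto simp: V_def)
      ultimately show ?thesis using neg True by force
    next
      case False
      then have "real m * f {j} \<le> 0" by (simp add: mult_nonneg_nonpos)
      then show ?thesis using T by linarith
    qed
    have "C \<noteq> {}" using C T by auto
    have fin: "finite C" using C finite_subset by blast
    have cm: "card C \<le> m" using card_mono[OF _ C(1)] by simp
    have "real m * f C \<le> real m * (\<Sum>j\<in>C. f {j})" using f_le_sum[OF C(1)] by (intro mult_left_mono) auto
    also have "\<dots> = (\<Sum>j\<in>C. real m * f {j})" by (simp add: sum_distrib_left)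
    also have "\<dots> < (\<Sum>j\<in>C. T)" using fin \<open>C \<noteq> {}\<close> small by (intro sum_strict_mono) auto
    also have "\<dots> \<le> real m * T" using cm T by simp
    also have "\<dots> \<le> real m * f C" using C by (intro mult_left_mono) auto
    finally show False by simp
  qed
  have "n \<noteq> 0"
  proof
    assume "n = 0"
    then have "config_LP_feasible {..<n} {..<m} \<Gamma> f (T + 1)"
      by (auto simp: config_LP_feasible_def config_LP_solution_def intro!: exI[of _ "\<lambda>_ _. 0"])
    then show False using max[of "T + 1"] T by auto
  qed
  then have "1 \<le> sum (x 0) (configs \<Gamma> f 0 T)" using x by (auto simp: config_LP_solution_def)
  then have "configs \<Gamma> f 0 T \<noteq> {}" by auto
  then obtain C where "C \<subseteq> \<Gamma> 0" "T \<le> f C" by (auto simp: configs_def)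
  then have "V \<noteq> {}" using ex[of C] \<Gamma>_sub[of 0] \<open>n \<noteq> 0\<close> by auto
  define T' where "T' = Min V"
  have T': "T' \<in> V" using finV \<open>V \<noteq> {}\<close> by (simp add: T'_def)
  then have lt: "T < T'" by (simp add: V_def)
  have eq: "configs \<Gamma> f i T' = configs \<Gamma> f i T" if "i < n" for i
  proof -
    have "T' \<le> f C" if C: "C \<subseteq> \<Gamma> i" "T \<le> f C" for C
    proof -
      have sub: "C \<subseteq> {..<m}" using C \<Gamma>_sub[OF \<open>i < n\<close>] by auto
      then obtain j where j: "j \<in> C" "f {j} \<in> V" using ex C by blast
      then have "T' \<le> f {j}" unfolding T'_def using finV by (intro Min_le)
      also have "\<dots> \<le> f C" using f_mono[of "{j}" C] j sub by auto
      finally show ?thesis .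
    qed
    then show ?thesis using lt by (auto simp: configs_def)
  qed
  have "(\<Sum>i<n. \<Sum>C\<in>{C \<in> configs \<Gamma> f i T'. j \<in> C}. x i C) =
      (\<Sum>i<n. \<Sum>C\<in>{C \<in> configs \<Gamma> f i T. j \<in> C}. x i C)" for j
    by (intro sum.cong refl) (simp add: eq)
  then have "config_LP_solution {..<n} {..<m} \<Gamma> f T' x"
    using x by (auto simp: config_LP_solution_def eq)
  then have "T' \<le> T" using max[of T'] lt T by (auto simp: config_LP_feasible_def)
  then show False using lt by simp
qed

text \<open>The multiplier \<open>u\<close> hits the required value exactly and \<open>k\<close>
  rounds it up. As \<open>f {a} \<le> T\<close> and \<open>1 / 4 \<le> \<alpha>\<close>, it is at
  least \<open>16 * m\<close>, so rounding costs a factor of at most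
  \<open>1 + 1 / (16 * m)\<close>, precisely the slack in \<open>greedy_factor\<close>. As
  \<open>T \<le> m * f {a}\<close>, polynomially many multipliers suffice.\<close>

lemma target_grid:
  assumes opt: "is_T_opt {..<n} {..<m} \<Gamma> f T" and T: "0 < T"
  shows "\<exists>a<m. \<exists>k\<le>64 * m * m. (1 - 1 / exp 1) / 2 * T * (64 * real m) \<le> real k * f {a} \<and>
    2 * (real k * f {a}) \<le> 64 * real m * (greedy_factor * T)"
proof -
  obtain a where a: "a < m" "0 < f {a}" "f {a} \<le> T" "T \<le> real m * f {a}"
    using T_opt_near_singleton[OF opt T] by blast
  define \<alpha> :: real where "\<alpha> = (1 - 1 / exp 1) / 2"
  have e2: "2 \<le> exp (1 :: real)" using exp_ge_add_one_self[of 1] by simp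
  have \<alpha>: "1 / 4 \<le> \<alpha>" "\<alpha> \<le> 1 / 2" using e2 by (auto simp: \<alpha>_def field_simps)
  have m: "1 \<le> real m" using a by auto
  define u where "u = \<alpha> * T * (64 * real m) / f {a}"
  define k where "k = nat \<lceil>u\<rceil>"
  have u_lb: "16 * real m \<le> u"
  proof -
    have "16 * real m * f {a} \<le> 16 * real m * T" using a m by (intro mult_left_mono) auto
    also have "\<dots> \<le> \<alpha> * 64 * (real m * T)" using \<alpha> m T mult_right_mono[of "16" "\<alpha> * 64" "real m * T"] by simp
    finally show ?thesis using a by (simp add: u_def field_simps)
  qed
  have u_ub: "u \<le> 32 * real m * real m"
  proof -
    have "\<alpha> * T * (64 * real m) \<le> 1 / 2 * T * (64 * real m)" using \<alpha> T m by (intro mult_right_mono) auto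
    also have "\<dots> = 32 * real m * T" by simp
    also have "\<dots> \<le> 32 * real m * (real m * f {a})" using a m by (intro mult_left_mono) auto
    finally show ?thesis using a by (simp add: u_def field_simps)
  qed
  have k: "u \<le> real k" "real k \<le> u + 1"
    using u_lb m by (auto simp: k_def)
  have "real k \<le> 64 * real m * real m"
    using k u_ub mult_mono[OF m m] by simp
  then have "real k \<le> real (64 * m * m)" by simp
  then have kle: "k \<le> 64 * m * m" by (simp only: of_nat_le_iff)
  have ufa: "u * f {a} = \<alpha> * T * (64 * real m)" using a by (simp add: u_def)
  have 1: "\<alpha> * T * (64 * real m) \<le> real k * f {a}"
    unfolding ufa[symmetric] using k a by (intro mult_right_mono) auto
  have "1 \<le> u / (16 * real m)" using u_lb m by simp
  then have "real k \<le> u * (1 + 1 / (16 * real m))" using k by (simp add: distrib_left)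
  then have "real k * f {a} \<le> u * (1 + 1 / (16 * real m)) * f {a}" using a by (intro mult_right_mono) auto
  also have "\<dots> = (u * f {a}) * (1 + 1 / (16 * real m))" by (simp only: mult_ac)
  also have "\<dots> = \<alpha> * T * (64 * real m) * (1 + 1 / (16 * real m))" by (simp only: ufa)
  finally have "2 * (real k * f {a}) \<le> 2 * (\<alpha> * T * (64 * real m) * (1 + 1 / (16 * real m)))" by linarith
  also have "\<dots> = 64 * real m * ((2 * \<alpha>) * (1 + 1 / (16 * real m)) * T)" by (simp only: mult_ac)
  also have "2 * \<alpha> = 1 - 1 / exp 1" by (simp add: \<alpha>_def)
  finally show ?thesis using a kle 1 unfolding \<alpha>_def by blast
qed

text \<open>Row \<open>q\<close> belongs to player \<open>q mod n\<close> in round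
  \<open>q div n\<close>. Weighting all rows by \<open>1 / N\<close> gives each player mass 1, and
  the bound \<open>N\<close> on the occurrences of an item becomes its packing constraint.\<close>

definition valid_rows :: "nat \<Rightarrow> real \<Rightarrow> (nat \<Rightarrow> nat set) \<Rightarrow> bool" where
  "valid_rows N T W \<longleftrightarrow> (\<forall>q<N * n. W q \<subseteq> \<Gamma> (q mod n) \<and> T \<le> f (W q)) \<and>
     (\<forall>j<m. card {q. q < N * n \<and> j \<in> W q} \<le> N)"

lemma card_mod_eq:
  assumes "i < n"
  shows "card {q. q < N * n \<and> q mod n = i} = N"
proof -
  have "{q. q < N * n \<and> q mod n = i} = (\<lambda>t. t * n + i) ` {..<N}"
  proof (intro equalityI subsetI)
    fix q assume "q \<in> {q. q < N * n \<and> q mod n = i}"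
    then have "q = q div n * n + i" "q div n < N"
      using div_mult_mod_eq[of q n] by (auto simp: less_mult_imp_div_less)
    then show "q \<in> (\<lambda>t. t * n + i) ` {..<N}" by blast
  next
    fix q assume "q \<in> (\<lambda>t. t * n + i) ` {..<N}"
    then obtain t where t: "t < N" "q = t * n + i" by auto
    have "t * n + i < Suc t * n" using assms by simp
    also have "\<dots> \<le> N * n" using t by (intro mult_le_mono1) simp
    finally show "q \<in> {q. q < N * n \<and> q mod n = i}" using t assms by simp
  qed
  moreover have "inj_on (\<lambda>t. t * n + i) {..<N}" using assms by (auto simp: inj_on_def)
  ultimately show ?thesis by (simp add: card_image)
qed

lemma valid_rows_LP_solution:
  assumes W: "valid_rows N T W" and N: "1 \<le> N"
    and x: "\<And>i C. x i C = (\<Sum>q \<in> {q. q < N * n \<and> q mod n = i \<and> W q = C}. 1 / real N)"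
  shows "config_LP_solution {..<n} {..<m} \<Gamma> f T x" "card {(i, C). x i C \<noteq> 0} \<le> N * n"
proof -
  let ?Q = "\<lambda>i C. {q. q < N * n \<and> q mod n = i \<and> W q = C}"
  have x': "x i C = real (card (?Q i C)) / real N" for i C by (simp add: x)
  have cf: "W q \<in> configs \<Gamma> f (q mod n) T" if "q < N * n" for q
    using W that by (auto simp: valid_rows_def configs_def)
  have sum_x: "sum (x i) K = real (card {q. q < N * n \<and> q mod n = i \<and> W q \<in> K}) / real N"
    if "finite K" for i K
  proof -
    have "{q. q < N * n \<and> q mod n = i \<and> W q \<in> K} = (\<Union>C\<in>K. ?Q i C)" by auto
    also have "card \<dots> = (\<Sum>C\<in>K. card (?Q i C))"
      using that by (intro card_UN_disjoint) auto
    finally show ?thesis by (simp add: x' sum_divide_distrib)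
  qed
  show "config_LP_solution {..<n} {..<m} \<Gamma> f T x"
    unfolding config_LP_solution_def
  proof (intro conjI ballI allI impI)
    fix i assume "i \<in> {..<n}"
    then have i: "i < n" by simp
    have "{q. q < N * n \<and> q mod n = i \<and> W q \<in> configs \<Gamma> f i T} = {q. q < N * n \<and> q mod n = i}"
      using cf by auto
    then show "1 \<le> sum (x i) (configs \<Gamma> f i T)"
      using N card_mod_eq[OF i] by (simp add: sum_x[OF finite_configs[OF i]])
  next
    fix j assume "j \<in> {..<m}"
    let ?J = "\<lambda>i. {q. q < N * n \<and> q mod n = i \<and> W q \<in> {C \<in> configs \<Gamma> f i T. j \<in> C}}"
    have "(\<Sum>i<n. sum (x i) {C \<in> configs \<Gamma> f i T. j \<in> C}) = (\<Sum>i<n. real (card (?J i)) / real N)"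
      using finite_configs by (intro sum.cong refl sum_x) auto
    also have "\<dots> = real (\<Sum>i<n. card (?J i)) / real N" by (simp add: sum_divide_distrib)
    also have "(\<Sum>i<n. card (?J i)) = card (\<Union>i<n. ?J i)"
      by (intro card_UN_disjoint[symmetric]) auto
    also have "\<dots> \<le> card {q. q < N * n \<and> j \<in> W q}" by (intro card_mono) auto
    also have "\<dots> \<le> N" using W \<open>j \<in> {..<m}\<close> by (auto simp: valid_rows_def)
    finally show "(\<Sum>i<n. sum (x i) {C \<in> configs \<Gamma> f i T. j \<in> C}) \<le> 1" using N by (simp add: divide_le_eq)
  next
    fix i C assume nc: "\<not> (i \<in> {..<n} \<and> C \<in> configs \<Gamma> f i T)"
    have "?Q i C = {}"
    proof -
      have False if "q < N * n" "q mod n = i" "W q = C" for q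
      proof -
        have "0 < n" using that by (cases n) auto
        then have "i < n" using that by auto
        then show False using nc cf[OF that(1)] that by auto
      qed
      then show ?thesis by blast
    qed
    then show "x i C = 0" by (simp add: x')
  qed (simp add: x')
  have "{(i, C). x i C \<noteq> 0} \<subseteq> (\<lambda>q. (q mod n, W q)) ` {..<N * n}"
  proof clarify
    fix i C assume "x i C \<noteq> 0"
    then have "?Q i C \<noteq> {}" by (auto simp: x')
    then show "(i, C) \<in> (\<lambda>q. (q mod n, W q)) ` {..<N * n}" by auto
  qed
  then show "card {(i, C). x i C \<noteq> 0} \<le> N * n"
    using card_mono[OF finite_imageI[OF finite_lessThan]] card_image_le[OF finite_lessThan, of _ "N * n"]
    by (fastforce intro: order_trans)
qed

end

section \<open>The program\<close>

text \<open>
  Integer cells: \<open>N\<close> rounds; \<open>r\<close> current round; \<open>L\<close> loads, \<open>z\<close> prices of the items, \<open>y\<close> sum of the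
  prices; \<open>G\<close> greedy set, \<open>c\<close> its price; \<open>C\<close> prices of the sets of all players; \<open>W\<close> rows of
  assigned sets, one for each round and player; \<open>d\<close> players already considered for the matching, \<open>p\<close>
  and \<open>o\<close> partners of players and items; \<open>R\<close> and \<open>V\<close> players and items reached by alternating paths
  from player \<open>u\<close>, \<open>P\<close> predecessors of the items, \<open>E\<close> free item found; \<open>X\<close> total price paid; \<open>O\<close>
  whether the target is still considered feasible.  Real cells: \<open>s\<close> values of single items; \<open>h\<close> target, scaled by
  \<open>64 * m\<close>; \<open>w\<close> values of the assigned sets, \<open>t\<close> their minimum.
\<close>

notation Seq (infixr ";;" 55)

abbreviation (input) ISet :: "vname \<Rightarrow> iexp \<Rightarrow> com" where
  "ISet x e \<equiv> IAssign x (IConst 0) e"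

abbreviation (input) RSet :: "vname \<Rightarrow> rexp \<Rightarrow> com" where
  "RSet x u \<equiv> RAssign x (IConst 0) u"

abbreviation (input) RVar :: "vname \<Rightarrow> rexp" where
  "RVar x \<equiv> RRead x (IConst 0)"

abbreviation (input) IRow :: "iexp \<Rightarrow> iexp \<Rightarrow> iexp" where
  "IRow q j \<equiv> IAdd (IMul q (IVar ''m'')) j"

abbreviation (input) current_cell :: "iexp \<Rightarrow> iexp" where
  "current_cell j \<equiv> IRow (IAdd (IMul (IVar ''r'') (IVar ''n'')) (IVar ''i'')) j"

abbreviation (input) pos :: "iexp \<Rightarrow> bexp" where
  "pos e \<equiv> ILess (IConst 0) e"

abbreviation (input) zero :: "iexp \<Rightarrow> bexp" where
  "zero e \<equiv> ILess e (IConst 1)"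

abbreviation (input) below_target :: "rexp \<Rightarrow> bexp" where
  "below_target u \<equiv> RLess (RScale (IMul (IConst 64) (IVar ''m'')) u) (RVar ''h'')"

abbreviation (input) excess :: iexp where
  "excess \<equiv> ISub (IMul (IMul (IConst 8) (IVar ''m'')) (IRead ''L'' (IVar ''j'')))
     (IMul (ISub (IMul (IConst 8) (IVar ''m'')) (IConst 1)) (IVar ''r''))"

definition prices_prog :: com where
  "prices_prog =
     ISet ''y'' (IConst 0) ;;
     For ''j'' (IVar ''m'') (
       IAssign ''z'' (IVar ''j'') (IConst 1) ;;
       Cond (pos excess) (IAssign ''z'' (IVar ''j'') (IAdd (IConst 1) excess)) Skip ;;
       ISet ''y'' (IAdd (IVar ''y'') (IRead ''z'' (IVar ''j''))))"

text \<open>The integer cell \<open>b\<close> is the index of the best item, the real cell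
  \<open>b\<close> its gain, \<open>x\<close> its price. The initial gain -1 at price 1 loses
  against every candidate, since gains are nonnegative and prices positive; a final index
  \<open>m\<close> means that there was no candidate.\<close>

definition best_item_prog :: com where
  "best_item_prog =
     ISet ''b'' (IVar ''m'') ;;
     ISet ''x'' (IConst 1) ;;
     RSet ''b'' (ROf (IConst (- 1))) ;;
     For ''j'' (IVar ''m'') (
       Cond (BAnd (pos (IRead ''Gamma'' (IRow (IVar ''i'') (IVar ''j''))))
              (BAnd (zero (IRead ''G'' (IVar ''j''))) (below_target (RRead ''s'' (IVar ''j'')))))
         (IAssign ''G'' (IVar ''j'') (IConst 1) ;;
          Query ''v'' (IConst 0) ''G'' (IVar ''m'') ;;
          IAssign ''G'' (IVar ''j'') (IConst 0) ;;
          RSet ''v'' (RSub (RVar ''v'') (RVar ''g'')) ;;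
          Cond (RLess (RScale (IRead ''z'' (IVar ''j'')) (RVar ''b''))
                      (RScale (IVar ''x'') (RVar ''v'')))
            (ISet ''b'' (IVar ''j'') ;;
             ISet ''x'' (IRead ''z'' (IVar ''j'')) ;;
             RSet ''b'' (RVar ''v''))
            Skip)
         Skip)"

definition greedy_step_prog :: com where
  "greedy_step_prog =
     Cond (below_target (RVar ''g''))
       (best_item_prog ;;
        Cond (ILess (IVar ''b'') (IVar ''m''))
          (IAssign ''G'' (IVar ''b'') (IConst 1) ;;
           RSet ''g'' (RAdd (RVar ''g'') (RVar ''b'')) ;;
           ISet ''c'' (IAdd (IVar ''c'') (IVar ''x'')))
          Skip)
       Skip"

text \<open>A set that misses the target is charged \<open>y + 1\<close>, more than all prices
  together, so that the check at the end of the round notices if its player stays unmatched.\<close>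

definition greedy_prog :: com where
  "greedy_prog =
     For ''j'' (IVar ''m'') (IAssign ''G'' (IVar ''j'') (IConst 0)) ;;
     RSet ''g'' (ROf (IConst 0)) ;;
     ISet ''c'' (IConst 0) ;;
     For ''e'' (IVar ''m'') greedy_step_prog ;;
     Cond (below_target (RVar ''g''))
       (ISet ''c'' (IAdd (IVar ''y'') (IConst 1))) Skip ;;
     IAssign ''C'' (IVar ''i'') (IVar ''c'') ;;
     RAssign ''w'' (IVar ''i'') (RVar ''g'') ;;
     For ''j'' (IVar ''m'')
       (IAssign ''W'' (current_cell (IVar ''j''))
          (IRead ''G'' (IVar ''j'')))"

definition next_player_prog :: com where
  "next_player_prog =
     ISet ''B'' (IConst (- 1)) ;;
     For ''i'' (IVar ''n'') (
       Cond (BAnd (zero (IRead ''d'' (IVar ''i''))) (ILess (IVar ''B'') (IRead ''C'' (IVar ''i''))))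
         (ISet ''u'' (IVar ''i'') ;;
          ISet ''B'' (IRead ''C'' (IVar ''i'')))
         Skip) ;;
     IAssign ''d'' (IVar ''u'') (IConst 1)"

abbreviation (input) edge_item :: "iexp \<Rightarrow> iexp" where
  "edge_item e \<equiv> ISub e (IMul (IVar ''m'') (IDiv e (IVar ''m'')))"

abbreviation (input) edge_player :: "iexp \<Rightarrow> iexp" where
  "edge_player e \<equiv> IDiv e (IVar ''m'')"

text \<open>Pairs are addressed by their position in the incidence matrix, so that one loop covers
  all of them. \<open>F\<close> holds a position plus one, and 0 means that none was found.\<close>

definition find_edge_prog :: com where
  "find_edge_prog =
     ISet ''F'' (IConst 0) ;;
     For ''v'' (IMul (IVar ''n'') (IVar ''m'')) (
       Cond (BAnd (pos (IRead ''Gamma'' (IVar ''v'')))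
              (BAnd (pos (IRead ''R'' (edge_player (IVar ''v''))))
                (BAnd (zero (IRead ''V'' (edge_item (IVar ''v''))))
                  (BNot (below_target (RRead ''s'' (edge_item (IVar ''v''))))))))
         (ISet ''F'' (IAdd (IVar ''v'') (IConst 1))) Skip)"

definition visit_prog :: com where
  "visit_prog =
     find_edge_prog ;;
     Cond (pos (IVar ''F''))
       (ISet ''f'' (edge_item (ISub (IVar ''F'') (IConst 1))) ;;
        IAssign ''V'' (IVar ''f'') (IConst 1) ;;
        IAssign ''P'' (IVar ''f'') (edge_player (ISub (IVar ''F'') (IConst 1))) ;;
        Cond (pos (IRead ''o'' (IVar ''f'')))
          (IAssign ''R'' (ISub (IRead ''o'' (IVar ''f'')) (IConst 1)) (IConst 1))
          (ISet ''E'' (IAdd (IVar ''f'') (IConst 1))))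
       Skip"

definition search_prog :: com where
  "search_prog =
     For ''i'' (IVar ''n'') (IAssign ''R'' (IVar ''i'') (IConst 0)) ;;
     For ''j'' (IVar ''m'') (IAssign ''V'' (IVar ''j'') (IConst 0)) ;;
     IAssign ''R'' (IVar ''u'') (IConst 1) ;;
     ISet ''E'' (IConst 0) ;;
     For ''l'' (IVar ''m'') visit_prog"

definition flip_prog :: com where
  "flip_prog =
     While (pos (IVar ''E''))
       (ISet ''f'' (IRead ''P'' (ISub (IVar ''E'') (IConst 1))) ;;
        ISet ''A'' (IRead ''p'' (IVar ''f'')) ;;
        IAssign ''p'' (IVar ''f'') (IVar ''E'') ;;
        IAssign ''o'' (ISub (IVar ''E'') (IConst 1)) (IAdd (IVar ''f'') (IConst 1)) ;;
        ISet ''E'' (IVar ''A''))"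

definition matching_prog :: com where
  "matching_prog =
     For ''i'' (IVar ''n'')
       (IAssign ''p'' (IVar ''i'') (IConst 0) ;; IAssign ''d'' (IVar ''i'') (IConst 0)) ;;
     For ''j'' (IVar ''m'') (IAssign ''o'' (IVar ''j'') (IConst 0)) ;;
     For ''g'' (IVar ''n'') (next_player_prog ;; search_prog ;; flip_prog)"

definition assign_prog :: com where
  "assign_prog =
     Cond (pos (IRead ''p'' (IVar ''i'')))
       (For ''j'' (IVar ''m'') (IAssign ''W'' (current_cell (IVar ''j'')) (IConst 0)) ;;
        IAssign ''W'' (current_cell (ISub (IRead ''p'' (IVar ''i'')) (IConst 1))) (IConst 1) ;;
        RAssign ''w'' (IVar ''i'') (RRead ''s'' (ISub (IRead ''p'' (IVar ''i'')) (IConst 1))))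
       (For ''j'' (IVar ''m'')
          (IAssign ''L'' (IVar ''j'')
             (IAdd (IRead ''L'' (IVar ''j'')) (IRead ''W'' (current_cell (IVar ''j''))))) ;;
        ISet ''X'' (IAdd (IVar ''X'') (IRead ''C'' (IVar ''i'')))) ;;
     Cond (RLess (RRead ''w'' (IVar ''i'')) (RVar ''t''))
       (RSet ''t'' (RRead ''w'' (IVar ''i''))) Skip"

definition round_prog :: com where
  "round_prog =
     prices_prog ;;
     For ''i'' (IVar ''n'') greedy_prog ;;
     matching_prog ;;
     ISet ''X'' (IConst 0) ;;
     For ''i'' (IVar ''n'') assign_prog ;;
     Cond (ILess (IMul (ISub (IMul (IConst 8) (IVar ''m'')) (IConst 1)) (IVar ''y''))
                 (IMul (IMul (IConst 8) (IVar ''m'')) (IVar ''X'')))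
       (ISet ''O'' (IConst 0)) Skip"

definition try_target_prog :: com where
  "try_target_prog =
     For ''j'' (IVar ''m'') (IAssign ''L'' (IVar ''j'') (IConst 0)) ;;
     ISet ''O'' (IConst 1) ;;
     RSet ''t'' (RVar ''h'') ;;
     For ''r'' (IVar ''N'') round_prog"

text \<open>The rows are copied because the next target reuses \<open>W\<close>.\<close>

definition keep_best_prog :: com where
  "keep_best_prog =
     Cond (BAnd (pos (IVar ''O'')) (RLess (RVar ''T'') (RVar ''t'')))
       (For ''q'' (IMul (IMul (IVar ''N'') (IVar ''n'')) (IVar ''m''))
          (IAssign ''config'' (IVar ''q'') (IRead ''W'' (IVar ''q''))) ;;
        RSet ''T'' (RVar ''t''))
       Skip"

definition setup_prog :: com where
  "setup_prog =
     ISet ''N'' (IAdd (IConst 1) (IMul (IMul (IMul (IMul (IMul (IConst 192) (IVar ''m''))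
       (IVar ''m'')) (IVar ''m'')) (IVar ''n'')) (IVar ''n''))) ;;
     ISet ''length'' (IMul (IVar ''N'') (IVar ''n'')) ;;
     For ''q'' (IMul (IVar ''N'') (IVar ''n'')) (
       IAssign ''player'' (IVar ''q'') (ISub (IVar ''q'') (IMul (IVar ''n'') (IDiv (IVar ''q'') (IVar ''n'')))) ;;
       IAssign ''num'' (IVar ''q'') (IConst 1) ;;
       IAssign ''den'' (IVar ''q'') (IVar ''N'')) ;;
     For ''j'' (IVar ''m'') (
       IAssign ''G'' (IVar ''j'') (IConst 1) ;;
       Query ''s'' (IVar ''j'') ''G'' (IVar ''m'') ;;
       IAssign ''G'' (IVar ''j'') (IConst 0))"

definition santa_claus_prog :: com where
  "santa_claus_prog =
     setup_prog ;;
     For ''a'' (IVar ''m'') (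
       For ''k'' (IAdd (IMul (IMul (IConst 64) (IVar ''m'')) (IVar ''m'')) (IConst 1)) (
         RSet ''h'' (RScale (IVar ''k'') (RRead ''s'' (IVar ''a''))) ;;
         try_target_prog ;;
         keep_best_prog))"

lemma mods_prices [simp]: "imods prices_prog = {''y'', ''j'', ''z''}" "rmods prices_prog = {}"
  by (auto simp: prices_prog_def)

lemma mods_best_item [simp]:
  "imods best_item_prog = {''b'', ''x'', ''j'', ''G''}" "rmods best_item_prog = {''b'', ''v''}"
  by (auto simp: best_item_prog_def)

lemma mods_greedy_step [simp]:
  "imods greedy_step_prog = {''b'', ''x'', ''j'', ''G'', ''c''}"
  "rmods greedy_step_prog = {''b'', ''v'', ''g''}"
  by (auto simp: greedy_step_prog_def)

lemma mods_greedy [simp]: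
  "imods greedy_prog = {''b'', ''x'', ''j'', ''G'', ''c'', ''e'', ''C'', ''W''}"
  "rmods greedy_prog = {''b'', ''v'', ''g'', ''w''}"
  by (auto simp: greedy_prog_def)

lemma mods_next_player [simp]:
  "imods next_player_prog = {''B'', ''i'', ''u'', ''d''}" "rmods next_player_prog = {}"
  by (auto simp: next_player_prog_def)

lemma mods_find_edge [simp]:
  "imods find_edge_prog = {''F'', ''v''}" "rmods find_edge_prog = {}"
  by (auto simp: find_edge_prog_def)

lemma mods_visit [simp]:
  "imods visit_prog = {''F'', ''v'', ''f'', ''V'', ''P'', ''R'', ''E''}" "rmods visit_prog = {}"
  by (auto simp: visit_prog_def)

lemma mods_search [simp]:
  "imods search_prog = {''F'', ''v'', ''f'', ''V'', ''P'', ''R'', ''E'', ''i'', ''j'', ''l''}"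
  "rmods search_prog = {}"
  by (auto simp: search_prog_def)

lemma mods_flip [simp]:
  "imods flip_prog = {''f'', ''A'', ''p'', ''o'', ''E''}" "rmods flip_prog = {}"
  by (auto simp: flip_prog_def)

lemma mods_matching [simp]:
  "imods matching_prog = {''i'', ''p'', ''d'', ''j'', ''o'', ''g''} \<union> imods next_player_prog \<union>
     imods search_prog \<union> imods flip_prog"
  "rmods matching_prog = {}"
  by (auto simp: matching_prog_def)

lemma mods_assign [simp]:
  "imods assign_prog = {''j'', ''W'', ''L'', ''X''}" "rmods assign_prog = {''w'', ''t''}"
  by (auto simp: assign_prog_def)

lemma mods_round [simp]:
  "imods round_prog = {''i'', ''X'', ''O''} \<union> imods prices_prog \<union> imods greedy_prog \<union>
     imods matching_prog \<union> imods assign_prog"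
  "rmods round_prog = rmods greedy_prog \<union> rmods assign_prog"
  by (auto simp: round_prog_def)

lemma mods_try_target [simp]:
  "imods try_target_prog = {''j'', ''L'', ''O'', ''r''} \<union> imods round_prog"
  "rmods try_target_prog = insert ''t'' (rmods round_prog)"
  by (auto simp: try_target_prog_def)

lemma mods_keep_best [simp]:
  "imods keep_best_prog = {''q'', ''config''}" "rmods keep_best_prog = {''T''}"
  by (auto simp: keep_best_prog_def)

text \<open>\<open>192 * m * m * m * n * n\<close> bounds the growth per round in
  \<open>sum_overload_square_step\<close> for \<open>D = 8 * m\<close>, as
  \<open>3 * 8 * 8 = 192\<close>. With at least that many rounds the sum of squares stays below the
  square of their number. The summand 1 keeps the number positive in degenerate cases.\<close>

definition rounds :: "nat \<Rightarrow> nat \<Rightarrow> nat" where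
  "rounds n m = 1 + 192 * m * m * m * n * n"

definition price_bound :: "nat \<Rightarrow> nat \<Rightarrow> nat" where
  "price_bound n m = 1 + 8 * m * (n * rounds n m)"

text \<open>The largest possible cost is the penalty for missing the target, one more than the sum
  of all prices.\<close>

definition cost_bound :: "nat \<Rightarrow> nat \<Rightarrow> nat" where
  "cost_bound n m = m * price_bound n m + 1"

text \<open>A plain sum of the quantities that cells hold and loops count, so that each is bounded
  by it without comparing them with each other.\<close>

definition cell_bound :: "nat \<Rightarrow> nat \<Rightarrow> nat" where
  "cell_bound n m = 2 + n + m + n * m + rounds n m + rounds n m * n + rounds n m * n * m
     + 64 * m * m + n * rounds n m + price_bound n m + cost_bound n m + n * cost_bound n m"

lemmas wp_intros = wp_Seq wp_Skip wp_IAssign wp_RAssign wp_Query wp_Cond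

context santa_claus
begin

abbreviation "N \<equiv> rounds n m"
abbreviation "M \<equiv> cell_bound n m"

lemma M_bounds:
  "2 \<le> M" "n < M" "m < M" "n * m \<le> M" "N \<le> M" "N * n \<le> M" "N * n * m \<le> M" "64 * m * m + 1 \<le> M"
  "n * N \<le> M" "price_bound n m \<le> M" "cost_bound n m \<le> M" "n * cost_bound n m \<le> M"
  by (simp_all add: cell_bound_def)

text \<open>The target value is \<open>h / (64 * m)\<close>.\<close>

definition env :: "real \<Rightarrow> state \<Rightarrow> bool" where
  "env h s \<longleftrightarrow> ints s ''n'' 0 = int n \<and> ints s ''m'' 0 = int m \<and> ints s ''N'' 0 = int N \<and>
     (\<forall>i<n. \<forall>j<m. ints s ''Gamma'' (int i * int m + int j) = (if j \<in> \<Gamma> i then 1 else 0)) \<and>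
     (\<forall>j<m. reals s ''s'' (int j) = f {j}) \<and> reals s ''h'' 0 = h"

lemma env_agree:
  assumes "env h s" "agree c s s'"
    and "imods c \<inter> {''n'', ''m'', ''N'', ''Gamma''} = {}" "rmods c \<inter> {''s'', ''h''} = {}"
  shows "env h s'"
proof -
  have "ints s' ''n'' = ints s ''n''" "ints s' ''m'' = ints s ''m''" "ints s' ''N'' = ints s ''N''"
    "ints s' ''Gamma'' = ints s ''Gamma''" "reals s' ''s'' = reals s ''s''" "reals s' ''h'' = reals s ''h''"
    using assms by (auto intro!: agree_ints agree_reals)
  then show ?thesis using assms(1) by (simp add: env_def)
qed

lemma env_iupdate [simp]:
  "x \<noteq> ''n'' \<Longrightarrow> x \<noteq> ''m'' \<Longrightarrow> x \<noteq> ''N'' \<Longrightarrow> x \<noteq> ''Gamma'' \<Longrightarrow> env h (iupdate x a k s) = env h s"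
  by (simp add: env_def)

lemma env_rupdate [simp]:
  "x \<noteq> ''s'' \<Longrightarrow> x \<noteq> ''h'' \<Longrightarrow> env h (rupdate x a k s) = env h s"
  by (simp add: env_def)

text \<open>With \<open>D = 8 * m\<close> the target load after \<open>r\<close> rounds is
  \<open>(1 - 1 / (8 * m)) * r\<close>; the factor is the one by which \<open>greedy_cost\<close>
  undercuts the price of a competing set.\<close>

definition price :: "nat \<Rightarrow> (nat \<Rightarrow> nat) \<Rightarrow> nat \<Rightarrow> nat" where
  "price r L j = nat (1 + overload (8 * m) r (L j))"

lemma price_pos: "0 < price r L j"
  using overload_nonneg[of "8 * m" r "L j"] by (simp add: price_def)

lemma int_price: "int (price r L j) = 1 + overload (8 * m) r (L j)"
  using overload_nonneg[of "8 * m" r "L j"] by (simp add: price_def)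

lemma price_le: "0 < m \<Longrightarrow> L j \<le> n * N \<Longrightarrow> price r L j \<le> price_bound n m"
proof -
  assume "0 < m" and L: "L j \<le> n * N"
  have "int (8 * m) * int (L j) - (int (8 * m) - 1) * int r \<le> int (8 * m) * int (n * N)" if "m \<noteq> 0"
  proof -
    have "int (8 * m) * int (L j) \<le> int (8 * m) * int (n * N)"
      using L by (intro mult_left_mono) (simp_all only: of_nat_le_iff of_nat_0_le_iff)
    moreover have "0 \<le> (int (8 * m) - 1) * int r" using that by (intro mult_nonneg_nonneg) auto
    ultimately show ?thesis by linarith
  qed
  then have "overload (8 * m) r (L j) \<le> int (8 * m * (n * N))"
    if "m \<noteq> 0" using that by (simp add: overload_def)
  then have "int (price r L j) \<le> int (price_bound n m)" if "m \<noteq> 0"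
    using that unfolding int_price price_bound_def by simp
  then show ?thesis using \<open>0 < m\<close> by simp
qed


section \<open>Correctness of the greedy sets\<close>

lemma env_simps:
  assumes "env h s"
  shows "ints s ''n'' 0 = int n" "ints s ''m'' 0 = int m" "ints s ''N'' 0 = int N" "reals s ''h'' 0 = h"
    "j < m \<Longrightarrow> reals s ''s'' (int j) = f {j}"
    "i < n \<Longrightarrow> j < m \<Longrightarrow> ints s ''Gamma'' (int i * int m + int j) = (if j \<in> \<Gamma> i then 1 else 0)"
  using assms by (auto simp: env_def)

lemma price_le_M: "j < m \<Longrightarrow> L j \<le> n * N \<Longrightarrow> price r L j \<le> M"
  using price_le[of L j r] M_bounds(10) by simp

lemma prices_wp:
  assumes env: "env h s" and r: "ints s ''r'' 0 = int r"
    and L: "\<And>j. j < m \<Longrightarrow> ints s ''L'' (int j) = int (L j)" "\<And>j. j < m \<Longrightarrow> L j \<le> n * N"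
  shows "wp f M prices_prog (\<lambda>s'. (\<forall>j<m. ints s' ''z'' (int j) = int (price r L j)) \<and>
    ints s' ''y'' 0 = int (\<Sum>j<m. price r L j)) s"
  unfolding prices_prog_def
proof (intro wp_Seq wp_IAssign, goal_cases _ loop)
  case loop
  let ?I = "\<lambda>k s'. (\<forall>j<k. ints s' ''z'' (int j) = int (price r L j)) \<and>
    ints s' ''y'' 0 = int (\<Sum>j<k. price r L j)"
  show ?case
  proof (rule wp_For[where I = ?I and N = m], goal_cases N x init step expr fin)
    case (step k s')
    have v: "ints s' ''m'' 0 = int m" "ints s' ''r'' 0 = int r" "ints s' ''L'' (int k) = int (L k)"
      using agree_ints[OF step(4)] env_simps[OF env] r L(1)[OF step(1)] by simp_all
    have "(\<Sum>j<Suc k. price r L j) \<le> (\<Sum>j<m. price r L j)"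
      using step(1) by (intro sum_mono2) auto
    also have "\<dots> \<le> m * price_bound n m"
      using sum_bounded_above[of "{..<m}" "price r L" "price_bound n m"] price_le L(2) step(1) by simp
    also have "\<dots> \<le> M" using M_bounds(11) by (simp add: cost_bound_def)
    finally have y: "int (price r L k) + int (\<Sum>j<k. price r L j) \<le> int M"
      by (simp only: of_nat_add[symmetric] of_nat_le_iff) simp
    have z: "int (price r L k) \<le> int M"
      using price_le_M[of k L r] L(2) step(1) by simp
    have pr: "int (price r L k) = 1 + max 0 (8 * int m * int (L k) - (8 * int m - 1) * int r)"
      by (simp add: int_price overload_def)
    have y0: "0 \<le> (\<Sum>j<k. int (price r L j))" by (intro sum_nonneg) simp
    show ?case
      by (intro wp_intros) (use v step(2,3) y y0 z M_bounds(1) in \<open>simp_all add: pr less_Suc_eq\<close>)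
  qed (use M_bounds(3) env_simps[OF env] in \<open>simp_all add: agree_ints\<close>)
qed simp

definition indicates :: "nat \<Rightarrow> (int \<Rightarrow> int) \<Rightarrow> nat set \<Rightarrow> bool" where
  "indicates k g A \<longleftrightarrow> A \<subseteq> {..<k} \<and> (\<forall>j<k. g (int j) = (if j \<in> A then 1 else 0))"

lemma indicates_segment_set: "indicates m (ints s x) A \<Longrightarrow> segment_set s x 0 (int m) = A"
  by (auto simp: indicates_def segment_set_def split: if_splits)

lemma indicates_insert:
  "indicates k g A \<Longrightarrow> j < k \<Longrightarrow> indicates k (g(int j := 1)) (insert j A)"
  by (auto simp: indicates_def)

lemma indicates_remove:
  "indicates k g A \<Longrightarrow> j < k \<Longrightarrow> j \<notin> A \<Longrightarrow> indicates k (g(int j := 0)) A"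
  by (auto simp: indicates_def)

definition small_items :: "real \<Rightarrow> nat \<Rightarrow> nat set" where
  "small_items h i = {j \<in> \<Gamma> i. 64 * real m * f {j} < h}"

lemma small_items_sub: "i < n \<Longrightarrow> small_items h i \<subseteq> {..<m}"
  using \<Gamma>_sub by (auto simp: small_items_def)

definition best_item :: "nat set \<Rightarrow> (nat \<Rightarrow> nat) \<Rightarrow> nat set \<Rightarrow> nat \<Rightarrow> bool" where
  "best_item K z G b \<longleftrightarrow> b \<in> K - G \<and>
     (\<forall>j\<in>K - G. (f (insert j G) - f G) * real (z b) \<le> (f (insert b G) - f G) * real (z j))"

lemma best_item_wp:
  assumes env: "env h s" and i: "i < n" "ints s ''i'' 0 = int i"
    and G: "indicates m (ints s ''G'') G" and g: "reals s ''g'' 0 = f G"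
    and z: "\<And>j. j < m \<Longrightarrow> ints s ''z'' (int j) = int (z j)" "\<And>j. j < m \<Longrightarrow> 0 < z j"
      "\<And>j. j < m \<Longrightarrow> z j \<le> M"
  shows "wp f M best_item_prog (\<lambda>s'. indicates m (ints s' ''G'') G \<and>
    (small_items h i \<subseteq> G \<and> ints s' ''b'' 0 = int m \<or>
     (\<exists>b. best_item (small_items h i) z G b \<and> ints s' ''b'' 0 = int b \<and> ints s' ''x'' 0 = int (z b) \<and>
       reals s' ''b'' 0 = f (insert b G) - f G))) s"
  unfolding best_item_prog_def
proof (intro wp_Seq wp_IAssign wp_RAssign, goal_cases _ _ loop)
  case loop
  let ?K = "small_items h i"
  have K: "?K \<subseteq> {..<m}" using small_items_sub i by blast
  have Gm: "G \<subseteq> {..<m}" using G by (simp add: indicates_def)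
  define D where "D = (\<lambda>j. f (insert j G) - f G)"
  have D0: "0 \<le> D j" if "j < m" for j
    using f_mono[of G "insert j G"] Gm that by (auto simp: D_def)
  let ?I = "\<lambda>k s'. indicates m (ints s' ''G'') G \<and>
    (?K \<inter> {..<k} \<subseteq> G \<and> ints s' ''b'' 0 = int m \<and> ints s' ''x'' 0 = 1 \<and> reals s' ''b'' 0 = - 1 \<or>
     (\<exists>b. best_item (?K \<inter> {..<k}) z G b \<and> ints s' ''b'' 0 = int b \<and> ints s' ''x'' 0 = int (z b) \<and>
       reals s' ''b'' 0 = D b))"
  show ?case
  proof (rule wp_For[where I = ?I and N = m], goal_cases N x init step expr fin)
    case init
    then show ?case using env_simps[OF env] G by simp
  next
    case (step k s')
    have v: "ints s' ''m'' 0 = int m" "ints s' ''i'' 0 = int i" "ints s' ''z'' (int k) = int (z k)"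
      "reals s' ''g'' 0 = f G" "reals s' ''h'' 0 = h" "reals s' ''s'' (int k) = f {k}"
      "ints s' ''Gamma'' (int i * int m + int k) = (if k \<in> \<Gamma> i then 1 else 0)"
      using agree_ints[OF step(4)] agree_reals[OF step(4)] env_simps[OF env] i z(1) step(1) g by simp_all
    have G': "indicates m (ints s' ''G'') G" using step(2) by simp
    have guard: "ints s' ''G'' (int k) = (if k \<in> G then 1 else 0)"
      using G' step(1) by (simp add: indicates_def)
    show ?case
    proof (rule wp_Cond, goal_cases T F)
      case T
      then have kK: "k \<in> ?K" "k \<notin> G"
        using v step(3) guard by (auto simp: small_items_def split: if_splits)
      have ins: "indicates m ((ints s' ''G'')(int k := 1)) (insert k G)"
        using indicates_insert[OF G' step(1)] .
      have rem: "indicates m ((ints s' ''G'')(int k := 0)) G"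
        using indicates_remove[OF G' step(1) kK(2)] .
      have seg: "segment_set (iupdate ''G'' (int k) 1 s') ''G'' 0 (int m) = insert k G"
        using ins by (intro indicates_segment_set) simp
      have zk: "0 < z k" "z k \<le> M" using z(2,3)[OF step(1)] by simp_all
      have split_K: "?K \<inter> {..<Suc k} - G = insert k (?K \<inter> {..<k} - G)"
        using kK by (auto simp: less_Suc_eq)
      have D_best: "best_item K' z G b \<longleftrightarrow>
          b \<in> K' - G \<and> (\<forall>j\<in>K' - G. D j * real (z b) \<le> D b * real (z j))" for K' b
        by (simp add: best_item_def D_def)
      have upd: "best_item (?K \<inter> {..<Suc k}) z G k"
        if lt: "real (z k) * reals s' ''b'' 0 < real_of_int (ints s' ''x'' 0) * D k"
      proof -
        have "D j * real (z k) \<le> D k * real (z j)" if j: "j \<in> ?K \<inter> {..<k} - G" for j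
        proof -
          obtain b where b: "best_item (?K \<inter> {..<k}) z G b" "ints s' ''x'' 0 = int (z b)"
              "reals s' ''b'' 0 = D b"
            using step(2) j by auto
          have zb: "0 < z b" using b(1) K z(2) by (auto simp: best_item_def)
          \<comment> \<open>The previous best item \<open>b\<close> mediates between
            \<open>j\<close> and \<open>k\<close>; its positive price is cancelled at the
            end.\<close>
          have "D j * real (z b) * real (z k) \<le> D b * real (z j) * real (z k)"
            using b(1) j by (intro mult_right_mono) (auto simp: D_best)
          also have "\<dots> = real (z k) * D b * real (z j)" by simp
          also have "\<dots> \<le> real (z b) * D k * real (z j)"
            using lt b by (intro mult_right_mono) auto
          finally show ?thesis using zb by (simp add: mult_ac)
        qed
        then show ?thesis unfolding D_best split_K using kK by auto
      qed
      have keep: "\<exists>b. best_item (?K \<inter> {..<Suc k}) z G b \<and> ints s' ''b'' 0 = int b \<and>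
          ints s' ''x'' 0 = int (z b) \<and> reals s' ''b'' 0 = D b"
        if ge: "\<not> real (z k) * reals s' ''b'' 0 < real_of_int (ints s' ''x'' 0) * D k"
      proof -
        \<comment> \<open>Candidate \<open>k\<close> would have beaten the initial gain -1, so a
          genuine item must be stored.\<close>
        have "\<not> (ints s' ''x'' 0 = 1 \<and> reals s' ''b'' 0 = - 1)"
          using ge zk(1) D0[OF step(1)] by auto
        then obtain b where b: "best_item (?K \<inter> {..<k}) z G b" "ints s' ''b'' 0 = int b"
            "ints s' ''x'' 0 = int (z b)" "reals s' ''b'' 0 = D b"
          using step(2) by blast
        have "best_item (?K \<inter> {..<Suc k}) z G b"
          unfolding D_best split_K using b ge by (auto simp: D_best mult.commute)
        then show ?thesis using b by blast
      qed
      show ?case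
      proof (intro wp_intros, goal_cases _ _ _ _ better worse)
        case better
        then have "real (z k) * reals s' ''b'' 0 < real_of_int (ints s' ''x'' 0) * D k"
          using v step(3) seg by (simp add: D_def)
        from upd[OF this] show ?case using v step(3) seg rem by (simp add: D_def)
      next
        case worse
        then have "\<not> real (z k) * reals s' ''b'' 0 < real_of_int (ints s' ''x'' 0) * D k"
          using v step(3) seg by (simp add: D_def)
        from keep[OF this] show ?case using v step(3) rem by simp
      qed (use v step(1,3) zk M_bounds(1,3) in simp_all)
    next
      case F
      then have eq: "?K \<inter> {..<Suc k} - G = ?K \<inter> {..<k} - G"
        using v step(3) guard by (auto simp: small_items_def less_Suc_eq split: if_splits)
      then have "?K \<inter> {..<Suc k} \<subseteq> G \<longleftrightarrow> ?K \<inter> {..<k} \<subseteq> G"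
        by (simp only: Diff_eq_empty_iff[symmetric])
      moreover have "best_item (?K \<inter> {..<Suc k}) z G b \<longleftrightarrow> best_item (?K \<inter> {..<k}) z G b" for b
        unfolding best_item_def eq ..
      ultimately show ?case using step(2) by (intro wp_Skip) simp
    qed
  next
    case (fin s')
    then show ?case using K by (auto simp: D_def Int_absorb2)
  qed (use M_bounds(3) env_simps[OF env] in \<open>simp_all add: agree_ints\<close>)
qed (use M_bounds env_simps[OF env] in simp_all)

text \<open>The guard \<open>G \<noteq> {}\<close> is for \<open>h = 0\<close>, where the empty set
  already meets the target but the strict bound fails. The last conjunct measures progress by
  \<open>card G\<close>: after \<open>m\<close> steps the target is reached or no small item is
  left.\<close>

definition greedy_inv :: "real \<Rightarrow> nat \<Rightarrow> (nat \<Rightarrow> nat) \<Rightarrow> nat \<Rightarrow> nat set \<Rightarrow> bool" where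
  "greedy_inv h i z k G \<longleftrightarrow> G \<subseteq> small_items h i \<and>
     (\<forall>C\<subseteq>small_items h i. greedy_progress z C G) \<and>
     (G \<noteq> {} \<longrightarrow> 64 * real m * f G < 2 * h) \<and>
     (h \<le> 64 * real m * f G \<or> k \<le> card G \<or> small_items h i \<subseteq> G)"

lemma greedy_inv_insert:
  assumes inv: "greedy_inv h i z k G" and b: "best_item (small_items h i) z G b" and i: "i < n"
    and z: "\<And>j. j < m \<Longrightarrow> 0 < z j" and lt: "64 * real m * f G < h"
  shows "greedy_inv h i z (Suc k) (insert b G)"
proof -
  let ?K = "small_items h i"
  have K: "?K \<subseteq> {..<m}" using small_items_sub i by blast
  have bK: "b \<in> ?K" "b \<notin> G" using b by (auto simp: best_item_def)
  have G: "G \<subseteq> ?K" using inv by (simp add: greedy_inv_def)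
  have bm: "b < m" "G \<subseteq> {..<m}" "finite G" using bK G K by (auto intro: finite_subset)
  have "greedy_progress z C (insert b G)" if C: "C \<subseteq> ?K" for C
  proof (rule greedy_progress_insert)
    show "greedy_progress z C G" using inv C by (simp add: greedy_inv_def)
    show "C \<subseteq> {..<m}" using C K by auto
    show "(f (insert j G) - f G) * real (z b) \<le> (f (insert b G) - f G) * real (z j)"
      if "j \<in> C - G" for j using b that C by (auto simp: best_item_def)
  qed (use bm bK z in auto)
  moreover have "64 * real m * f (insert b G) < 2 * h"
  proof -
    have "64 * real m * f (insert b G) \<le> 64 * real m * (f G + f {b})"
      using f_insert_le[OF bm(2,1)] by (intro mult_left_mono) auto
    also have "\<dots> = 64 * real m * f G + 64 * real m * f {b}" by (simp add: algebra_simps)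
    also have "\<dots> < 2 * h" using lt bK by (simp add: small_items_def)
    finally show ?thesis .
  qed
  moreover have "h \<le> 64 * real m * f (insert b G) \<or> Suc k \<le> card (insert b G) \<or> ?K \<subseteq> insert b G"
    using inv lt bm bK by (auto simp: greedy_inv_def)
  ultimately show ?thesis using G bK by (auto simp: greedy_inv_def)
qed

lemma greedy_step_wp:
  assumes env: "env h s" and i: "i < n" "ints s ''i'' 0 = int i"
    and G: "indicates m (ints s ''G'') G" and g: "reals s ''g'' 0 = f G"
    and c: "ints s ''c'' 0 = int (sum z G)" and inv: "greedy_inv h i z k G"
    and z: "\<And>j. j < m \<Longrightarrow> ints s ''z'' (int j) = int (z j)" "\<And>j. j < m \<Longrightarrow> 0 < z j"
      "(\<Sum>j<m. z j) \<le> M"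
  shows "wp f M greedy_step_prog (\<lambda>s'. \<exists>G. indicates m (ints s' ''G'') G \<and> reals s' ''g'' 0 = f G \<and>
    ints s' ''c'' 0 = int (sum z G) \<and> greedy_inv h i z (Suc k) G) s"
proof -
  have zM: "z j \<le> M" if "j < m" for j
    using member_le_sum[of j "{..<m}" z] that z(3) by simp
  show ?thesis
    unfolding greedy_step_prog_def
  proof (rule wp_Cond, goal_cases T F)
    case T
    then have lt: "64 * real m * f G < h" using env_simps[OF env] g by simp
    show ?case
    proof (rule wp_Seq, rule wp_frame[OF best_item_wp[OF env i G g z(1,2) zM]], goal_cases _ _ _ post)
      case (post s')
      have v: "ints s' ''m'' 0 = int m" "reals s' ''g'' 0 = f G" "ints s' ''c'' 0 = int (sum z G)"
        using agree_ints[OF post(1)] agree_reals[OF post(1)] env_simps[OF env] g c by simp_all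
      show ?case
      proof (cases "ints s' ''b'' 0 = int m \<and> small_items h i \<subseteq> G")
        case True
        then have "greedy_inv h i z (Suc k) G" using inv by (simp add: greedy_inv_def)
        then show ?thesis
          by (intro wp_intros) (use True v post(2) in auto)
      next
        case False
        then obtain b where b: "best_item (small_items h i) z G b" "ints s' ''b'' 0 = int b"
            "ints s' ''x'' 0 = int (z b)" "reals s' ''b'' 0 = f (insert b G) - f G"
          using post(2) by blast
        have bm: "b < m" "b \<notin> G" using b(1) small_items_sub[OF i(1)] by (auto simp: best_item_def)
        have Gm: "G \<subseteq> {..<m}" "finite G" using G by (auto simp: indicates_def intro: finite_subset)
        have "sum z (insert b G) \<le> (\<Sum>j<m. z j)" using bm Gm by (intro sum_mono2) auto
        then have sM: "sum z G + z b \<le> M" using z(3) bm Gm by simp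
        have ins: "indicates m ((ints s' ''G'')(int b := 1)) (insert b G)"
          using post(2) bm by (intro indicates_insert) auto
        have inv': "greedy_inv h i z (Suc k) (insert b G)"
          by (rule greedy_inv_insert[OF inv b(1) i(1) z(2) lt])
        show ?thesis
        proof (intro wp_intros, goal_cases _ _ fin)
          case fin
          show ?case
            by (rule exI[of _ "insert b G"]) (use v b ins inv' bm Gm in simp)
        qed (use v b bm sM M_bounds(1) in \<open>simp_all del: of_nat_sum\<close>)
      qed
    qed simp_all
  next
    case F
    then have "greedy_inv h i z (Suc k) G" using inv env_simps[OF env] g by (simp add: greedy_inv_def)
    then show ?case using G g c by (intro wp_Skip) blast
  qed
qed

text \<open>For the target \<open>\<theta> = h / (64 * m)\<close> this is
  \<open>2 * \<theta> \<le> greedy_factor * v\<close>; the 2 accounts for the overshoot of the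
  greedy set.\<close>

definition good_target :: "real \<Rightarrow> real \<Rightarrow> bool" where
  "good_target h v \<longleftrightarrow> 2 * h \<le> 64 * real m * (greedy_factor * v)"

definition greedy_spec :: "real \<Rightarrow> nat \<Rightarrow> (nat \<Rightarrow> nat) \<Rightarrow> nat set \<Rightarrow> nat \<Rightarrow> bool" where
  "greedy_spec h i z G cst \<longleftrightarrow> G \<subseteq> small_items h i \<and> cst \<le> (\<Sum>j<m. z j) + 1 \<and>
     (cst = (\<Sum>j<m. z j) + 1 \<or> h \<le> 64 * real m * f G \<and> cst = sum z G) \<and>
     (\<forall>C\<subseteq>small_items h i. good_target h (f C) \<longrightarrow> 8 * m * cst \<le> (8 * m - 1) * sum z C)"

text \<open>If the target is missed, all small items are in \<open>G\<close>, and as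
  \<open>greedy_factor \<le> 2\<close> no set of small items is good, so the price comparison is
  vacuous. If it is reached by a nonempty set, that set has less than twice the target value, and
  \<open>greedy_cost\<close> applies.\<close>

lemma greedy_inv_spec:
  assumes inv: "greedy_inv h i z m G" and i: "i < n" and z: "\<And>j. j < m \<Longrightarrow> 0 < z j"
  shows "greedy_spec h i z G (if 64 * real m * f G < h then (\<Sum>j<m. z j) + 1 else sum z G)"
proof -
  let ?K = "small_items h i"
  have K: "?K \<subseteq> {..<m}" using small_items_sub i by blast
  have G: "G \<subseteq> ?K" using inv by (simp add: greedy_inv_def)
  then have Gm: "G \<subseteq> {..<m}" using K by auto
  have sG: "sum z G \<le> (\<Sum>j<m. z j)" using Gm by (intro sum_mono2) auto
  show ?thesis
  proof (cases "64 * real m * f G < h")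
    case True
    have all: "?K \<subseteq> G"
    proof -
      have "G = {..<m}" if "m \<le> card G" using Gm that card_subset_eq[of "{..<m}" G] card_mono[OF _ Gm] by simp
      then show ?thesis using inv True K by (auto simp: greedy_inv_def)
    qed
    have "\<not> good_target h (f C)" if C: "C \<subseteq> ?K" for C
    proof
      assume good: "good_target h (f C)"
      have fC: "0 \<le> f C" "f C \<le> f G" using C K all Gm by (auto intro!: f_nonneg f_mono)
      have "greedy_factor \<le> (1 :: real) * 2"
      proof (rule mult_mono)
        show "1 + 1 / (16 * real m) \<le> 2" by (cases m) (auto simp: field_simps)
      qed auto
      then have "greedy_factor * f C \<le> 2 * f C"
        using fC by (intro mult_right_mono) auto
      then have "greedy_factor * f C \<le> 2 * f G" using fC by linarith
      then have "64 * real m * (greedy_factor * f C) \<le> 64 * real m * (2 * f G)"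
        by (intro mult_left_mono) auto
      then show False using good True unfolding good_target_def by linarith
    qed
    then show ?thesis using True G by (auto simp: greedy_spec_def)
  next
    case False
    have "8 * m * sum z G \<le> (8 * m - 1) * sum z C" if C: "C \<subseteq> ?K" "good_target h (f C)" for C
    proof (cases "G = {}")
      case ne: False
      have m: "0 < m" using ne Gm by (cases m) auto
      have "64 * real m * f G < 64 * real m * (greedy_factor * f C)"
        using inv ne C(2) unfolding greedy_inv_def good_target_def by (meson less_le_trans)
      then have "f G < greedy_factor * f C"
        using m by (subst (asm) mult_less_cancel_left_pos) simp_all
      then show ?thesis
        using inv C K Gm z by (intro greedy_cost) (auto simp: greedy_inv_def)
    qed simp
    then show ?thesis using False G sG by (auto simp: greedy_spec_def)
  qed
qed

lemma cell_eq_iff: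
  "j < m \<Longrightarrow> j' < m \<Longrightarrow> int q * int m + int j = int q' * int m + int j' \<longleftrightarrow> q = q' \<and> j = j'"
proof
  assume m: "j < m" "j' < m" and "int q * int m + int j = int q' * int m + int j'"
  then have eq: "q * m + j = q' * m + j'" by (simp flip: of_nat_mult of_nat_add)
  have "(q * m + j) div m = q" "(q' * m + j') div m = q'" using m by auto
  then show "q = q' \<and> j = j'" using eq by auto
qed simp

abbreviation row :: "state \<Rightarrow> nat \<Rightarrow> nat set \<Rightarrow> bool" where
  "row s q A \<equiv> indicates m (\<lambda>j. ints s ''W'' (int q * int m + j)) A"

lemma greedy_wp:
  assumes env: "env h s" and i: "i < n" "ints s ''i'' 0 = int i" and r: "ints s ''r'' 0 = int r"
    and z: "\<And>j. j < m \<Longrightarrow> ints s ''z'' (int j) = int (z j)" "\<And>j. j < m \<Longrightarrow> 0 < z j"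
      "(\<Sum>j<m. z j) + 1 \<le> M"
    and y: "ints s ''y'' 0 = int (\<Sum>j<m. z j)"
  shows "wp f M greedy_prog (\<lambda>s'. \<exists>G cst. greedy_spec h i z G cst \<and> row s' (r * n + i) G \<and>
    (\<forall>q A. q \<noteq> r * n + i \<longrightarrow> row s q A \<longrightarrow> row s' q A) \<and>
    ints s' ''C'' = (ints s ''C'')(int i := int cst) \<and> reals s' ''w'' = (reals s ''w'')(int i := f G)) s" (is "wp f M _ ?Q s")
  unfolding greedy_prog_def
proof (rule wp_Seq, rule wp_For[where I = "\<lambda>k s'. \<forall>j<k. ints s' ''G'' (int j) = 0" and N = m],
    goal_cases _ _ init step expr fin)
  case (step k s')
  then show ?case using M_bounds by (intro wp_intros) (auto simp: less_Suc_eq)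
next
  case (fin s')
  note ag1 = fin(2)
  have v1: "ints s' ''m'' 0 = int m" "ints s' ''i'' 0 = int i" "ints s' ''r'' 0 = int r" "env h s'"
    using agree_ints[OF ag1] env_simps[OF env] i r env_agree[OF env ag1] by simp_all
  have G0: "indicates m (ints s' ''G'') {}" using fin by (simp add: indicates_def)
  show ?case
  proof (intro wp_Seq wp_IAssign wp_RAssign, goal_cases _ loop)
    case loop
    let ?I = "\<lambda>k s'. \<exists>G. indicates m (ints s' ''G'') G \<and> reals s' ''g'' 0 = f G \<and>
      ints s' ''c'' 0 = int (sum z G) \<and> greedy_inv h i z k G"
    show ?case
    proof (rule wp_For[where I = ?I and N = m], goal_cases _ _ init step expr fin)
      case init
      have "greedy_inv h i z 0 {}" by (simp add: greedy_inv_def greedy_progress_empty)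
      then show ?case using G0 by (intro exI[of _ "{}"]) simp
    next
      case (step k s'')
      then obtain G where G: "indicates m (ints s'' ''G'') G" "reals s'' ''g'' 0 = f G"
        "ints s'' ''c'' 0 = int (sum z G)" "greedy_inv h i z k G" by blast
      have v2: "ints s'' ''i'' 0 = int i" "env h s''"
        "\<And>j. j < m \<Longrightarrow> ints s'' ''z'' (int j) = int (z j)"
        using agree_ints[OF step(4)] agree_ints[OF ag1] v1 z(1) env_agree[OF _ step(4)] by simp_all
      show ?case
        by (rule wp_mono[OF greedy_step_wp[OF v2(2) i(1) v2(1) G v2(3) z(2)]]) (use z(3) in simp_all)
    next
      case (fin s'')
      then obtain G where G: "indicates m (ints s'' ''G'') G" "reals s'' ''g'' 0 = f G"
        "ints s'' ''c'' 0 = int (sum z G)" "greedy_inv h i z m G" by blast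
      note ag2 = fin(2)
      have v2: "ints s'' ''i'' 0 = int i" "env h s''" "ints s'' ''r'' 0 = int r"
        "ints s'' ''y'' 0 = int (\<Sum>j<m. z j)" "ints s'' ''C'' = ints s ''C''" "reals s'' ''w'' = reals s ''w''"
        "ints s'' ''W'' = ints s ''W''"
        using agree_ints[OF ag2] agree_ints[OF ag1] agree_reals[OF ag2] agree_reals[OF ag1] v1 y
          env_agree[OF _ ag2] by simp_all
      define cst where "cst = (if 64 * real m * f G < h then (\<Sum>j<m. z j) + 1 else sum z G)"
      have spec: "greedy_spec h i z G cst" unfolding cst_def by (rule greedy_inv_spec[OF G(4) i(1) z(2)])
      have cM: "cst \<le> M" using spec z(3) by (simp add: greedy_spec_def)
      \<comment> \<open>The rest of the program is verified once for both outcomes of the last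
        comparison, which differ in \<open>c\<close> only.\<close>
      have final: "wp f M (IAssign ''C'' (IVar ''i'') (IVar ''c'') ;;
         RAssign ''w'' (IVar ''i'') (RVar ''g'') ;;
         For ''j'' (IVar ''m'')
           (IAssign ''W'' (current_cell (IVar ''j''))
              (IRead ''G'' (IVar ''j''))))
         ?Q t"
        if t: "ints t ''c'' 0 = int cst" "agree (ISet ''c'' (IConst 0)) s'' t" for t
      proof -
        have v3: "ints t ''i'' 0 = int i" "env h t" "ints t ''r'' 0 = int r" "ints t ''n'' 0 = int n"
          "ints t ''m'' 0 = int m"
          "ints t ''C'' = ints s ''C''" "reals t ''w'' = reals s ''w''"
          "ints t ''W'' = ints s ''W''" "ints t ''G'' = ints s'' ''G''" "reals t ''g'' 0 = f G"
          using agree_ints[OF t(2)] agree_reals[OF t(2)] env_simps[OF v2(2)] v2 G(2) env_agree[OF v2(2) t(2)] by simp_all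
        let ?q = "r * n + i"
        let ?J = "\<lambda>k s'. (\<forall>j<k. ints s' ''W'' (int ?q * int m + int j) = ints s'' ''G'' (int j)) \<and>
          (\<forall>q j. q \<noteq> ?q \<longrightarrow> j < m \<longrightarrow> ints s' ''W'' (int q * int m + int j) = ints s ''W'' (int q * int m + int j))"
        show ?thesis
        proof (intro wp_Seq wp_IAssign wp_RAssign, goal_cases _ loop)
          case loop
          show ?case
          proof (rule wp_For[where I = ?J and N = m], goal_cases _ _ init step expr fin)
            case init
            then show ?case using v3 by simp
          next
            case (step k s3)
            have "ints s3 ''i'' 0 = int i" "ints s3 ''r'' 0 = int r" "ints s3 ''n'' 0 = int n"
              "ints s3 ''m'' 0 = int m" "ints s3 ''G'' = ints s'' ''G''"
              using agree_ints[OF step(4)] v3 by simp_all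
            note v4 = this
            have Gk: "\<bar>ints s'' ''G'' (int k)\<bar> \<le> int M" using G(1) step(1) M_bounds(1) by (simp add: indicates_def)
            show ?case
            proof (intro wp_intros, goal_cases _ fin)
              case fin
              have ix: "(int r * int n + int i) * int m + int k = int ?q * int m + int k" by simp
              show ?case using step v4 cell_eq_iff[of _ k _ ?q]
                by (simp add: ix less_Suc_eq del: of_nat_add of_nat_mult)
            qed (use Gk v4 step(3) in simp)
          next
            case (fin s3)
            have "ints s3 ''C'' = (ints s ''C'')(int i := int cst)" "reals s3 ''w'' = (reals s ''w'')(int i := f G)"
              using agree_ints[OF fin(2)] agree_reals[OF fin(2)] v3 t by simp_all
            moreover have "row s3 ?q G" using fin(1) G(1) by (simp add: indicates_def)
            moreover have "\<forall>q A. q \<noteq> ?q \<longrightarrow> row s q A \<longrightarrow> row s3 q A" using fin(1) by (simp add: indicates_def)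
            ultimately show ?case using spec by blast
          qed (use v3 M_bounds in \<open>simp_all add: agree_ints\<close>)
        qed (use cM t in simp)
      qed
      show ?case
        by (rule wp_Seq, intro wp_Cond wp_IAssign wp_Skip final)
          (use G v2 env_simps[OF v2(2)] z(3) in \<open>auto simp: cst_def agree_def simp del: of_nat_sum\<close>)
    qed (use v1 M_bounds in \<open>simp_all add: agree_ints\<close>)
  qed simp
qed (use M_bounds env_simps[OF env] in \<open>simp_all add: agree_ints\<close>)


section \<open>Correctness of the matching\<close>

definition big_items :: "real \<Rightarrow> nat set" where
  "big_items h = {j. h \<le> 64 * real m * f {j}}"

definition big_edge :: "real \<Rightarrow> nat \<Rightarrow> nat \<Rightarrow> bool" where
  "big_edge h i j \<longleftrightarrow> i < n \<and> j < m \<and> j \<in> \<Gamma> i \<and> j \<in> big_items h"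

text \<open>In the arrays \<open>p\<close> and \<open>o\<close> of partners, entry \<open>0\<close> means unmatched and entry \<open>k + 1\<close> means
  matched to \<open>k\<close>.  \<open>H\<close> contains the free items whose entry in \<open>o\<close> is outdated.\<close>

definition matching :: "real \<Rightarrow> (nat \<Rightarrow> nat) \<Rightarrow> (nat \<Rightarrow> nat) \<Rightarrow> nat set \<Rightarrow> bool" where
  "matching h p ow H \<longleftrightarrow>
     (\<forall>i<n. p i \<noteq> 0 \<longrightarrow> big_edge h i (p i - 1) \<and> ow (p i - 1) = Suc i \<and> p i - 1 \<notin> H) \<and>
     (\<forall>j<m. j \<notin> H \<longrightarrow> ow j \<noteq> 0 \<longrightarrow> ow j \<le> n \<and> p (ow j - 1) = Suc j)"

text \<open>The shape of the players reached by a failed alternating search, and the certificate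
  that \<open>hall_sum_le_card\<close> consumes.\<close>

definition blocked :: "real \<Rightarrow> (nat \<Rightarrow> nat) \<Rightarrow> nat set \<Rightarrow> bool" where
  "blocked h p X \<longleftrightarrow> X \<subseteq> {..<n} \<and> (\<forall>i\<in>X. \<forall>j. big_edge h i j \<longrightarrow> (\<exists>i'\<in>X. p i' = Suc j))"

definition holds :: "nat \<Rightarrow> (int \<Rightarrow> int) \<Rightarrow> (nat \<Rightarrow> nat) \<Rightarrow> bool" where
  "holds k g \<phi> \<longleftrightarrow> (\<forall>i<k. g (int i) = int (\<phi> i))"

definition holds_on :: "nat set \<Rightarrow> (int \<Rightarrow> int) \<Rightarrow> (nat \<Rightarrow> nat) \<Rightarrow> bool" where
  "holds_on A g \<phi> \<longleftrightarrow> (\<forall>i\<in>A. g (int i) = int (\<phi> i))"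

lemma holds_upd: "holds k g \<phi> \<Longrightarrow> a = int i \<Longrightarrow> v = int w \<Longrightarrow> holds k (g(a := v)) (\<phi>(i := w))"
  by (simp add: holds_def)

lemma next_player_wp:
  assumes env: "env h s" and d: "indicates n (ints s ''d'') D" and D: "D \<noteq> {..<n}"
    and c: "holds n (ints s ''C'') c" "\<And>i. i < n \<Longrightarrow> c i \<le> M"
  shows "wp f M next_player_prog (\<lambda>s'. \<exists>u. u < n \<and> u \<notin> D \<and> (\<forall>i<n. i \<notin> D \<longrightarrow> c i \<le> c u) \<and>
    ints s' ''u'' 0 = int u \<and> indicates n (ints s' ''d'') (insert u D)) s"
  unfolding next_player_prog_def
proof (intro wp_Seq wp_IAssign, goal_cases _ loop)
  case loop
  let ?I = "\<lambda>k s'. ints s' ''d'' = ints s ''d'' \<and> (ints s' ''B'' 0 = - 1 \<and> {..<k} \<subseteq> D \<or>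
    (\<exists>u. u < n \<and> u \<notin> D \<and> (\<forall>i<k. i \<notin> D \<longrightarrow> c i \<le> c u) \<and> ints s' ''u'' 0 = int u \<and> ints s' ''B'' 0 = int (c u)))"
  show ?case
  proof (rule wp_For[where I = ?I and N = n], goal_cases _ _ init step expr fin)
    case (step k s')
    have v: "ints s' ''C'' (int k) = int (c k)" "ints s' ''d'' (int k) = (if k \<in> D then 1 else 0)"
      using agree_ints[OF step(4)] c(1) d step(1,2) by (auto simp: holds_def indicates_def)
    show ?case
    proof (rule wp_Cond, goal_cases T F)
      case T
      then have T': "k \<notin> D" "ints s' ''B'' 0 < int (c k)" using v step(3) by (auto split: if_splits)
      then have max: "\<forall>i<Suc k. i \<notin> D \<longrightarrow> c i \<le> c k"
        using step(2) by (auto simp: less_Suc_eq)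
      show ?case
      proof (intro wp_intros, goal_cases _ _ fin)
        case fin
        show ?case using step(1,2,3) v T' max by simp
      qed (use step(1,3) v c(2)[OF step(1)] M_bounds(2) in simp_all)
    next
      case F
      then have "k \<in> D \<or> int (c k) \<le> ints s' ''B'' 0" using v step(3) by (auto split: if_splits)
      then show ?case using step(2) by (intro wp_Skip) (auto simp: less_Suc_eq)
    qed
  next
    case (fin s')
    have "\<not> {..<n} \<subseteq> D" using D d by (auto simp: indicates_def)
    then obtain u where u: "u < n" "u \<notin> D" "\<forall>i<n. i \<notin> D \<longrightarrow> c i \<le> c u" "ints s' ''u'' 0 = int u"
      using fin(1) by blast
    have "indicates n ((ints s' ''d'')(int u := 1)) (insert u D)"
      using fin(1) d u(1) by (intro indicates_insert) auto
    then show ?case using u M_bounds(1) by (intro wp_IAssign) auto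
  qed (use M_bounds env_simps[OF env] in \<open>simp_all add: agree_ints\<close>)
qed (use M_bounds in simp)

section \<open>Search for an augmenting path\<close>

lemma edge_index:
  assumes "v < n * m"
  shows "v div m < n" "v mod m < m" "int v div int m = int (v div m)"
    "int v - int m * int (v div m) = int (v mod m)"
    "int v = int (v div m) * int m + int (v mod m)"
proof -
  have m: "0 < m" using assms by (cases m) auto
  show "v div m < n" "v mod m < m" "int v div int m = int (v div m)"
    using assms m by (auto simp: less_mult_imp_div_less zdiv_int)
  show eq: "int v = int (v div m) * int m + int (v mod m)"
    by (metis div_mult_mod_eq of_nat_add of_nat_mult)
  then show "int v - int m * int (v div m) = int (v mod m)" by (simp add: mult.commute)
qed

lemma find_edge_wp:
  assumes env: "env h s" and R: "indicates n (ints s ''R'') R" and V: "indicates m (ints s ''V'') V"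
  shows "wp f M find_edge_prog (\<lambda>s'.
    ints s' ''F'' 0 = 0 \<and> (\<forall>i\<in>R. \<forall>j. big_edge h i j \<longrightarrow> j \<in> V) \<or>
    (\<exists>v. v < n * m \<and> ints s' ''F'' 0 = int v + 1 \<and> v div m \<in> R \<and> v mod m \<notin> V \<and>
       big_edge h (v div m) (v mod m))) s"
  unfolding find_edge_prog_def
proof (intro wp_Seq wp_IAssign, goal_cases _ loop)
  case loop
  let ?ok = "\<lambda>v. v div m \<in> R \<and> v mod m \<notin> V \<and> big_edge h (v div m) (v mod m)"
  let ?I = "\<lambda>k s'. ints s' ''F'' 0 = 0 \<and> (\<forall>v<k. \<not> ?ok v) \<or>
    (\<exists>v. v < n * m \<and> ints s' ''F'' 0 = int v + 1 \<and> ?ok v)"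
  show ?case
  proof (rule wp_For[where I = ?I and N = "n * m"], goal_cases _ _ init step expr fin)
    case (step k s')
    note ix = edge_index[OF step(1)]
    have G: "ints s' ''Gamma'' (int k) = (if k mod m \<in> \<Gamma> (k div m) then 1 else 0)"
      using agree_ints[OF step(4), of "''Gamma''"] env_simps(6)[OF env ix(1,2)] ix(5)
      by (simp del: of_nat_mod of_nat_div)
    have v: "ints s' ''m'' 0 = int m" "reals s' ''h'' 0 = h"
      "ints s' ''R'' (int (k div m)) = (if k div m \<in> R then 1 else 0)"
      "ints s' ''V'' (int (k mod m)) = (if k mod m \<in> V then 1 else 0)"
      "reals s' ''s'' (int (k mod m)) = f {k mod m}"
      using agree_ints[OF step(4)] agree_reals[OF step(4)] env_simps[OF env] R V ix(1,2)
      by (simp_all add: indicates_def del: of_nat_mod of_nat_div)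
    have km: "k + 1 \<le> M" using step(1) M_bounds(4) by simp
    show ?case
    proof (rule wp_Cond, goal_cases T F)
      case T
      then have "?ok k" using v G ix(1-4) step(3)
        by (auto simp: big_edge_def big_items_def simp del: of_nat_mod of_nat_div split: if_splits)
      then show ?case using step(1,3) km by (intro wp_intros) auto
    next
      case F
      then have "\<not> ?ok k" using v G ix(1-4) step(3)
        by (auto simp: big_edge_def big_items_def simp del: of_nat_mod of_nat_div split: if_splits)
      then show ?case using step(2) by (intro wp_Skip) (auto simp: less_Suc_eq)
    qed
  next
    case (fin s')
    have "j \<in> V" if none: "\<forall>v<n * m. \<not> ?ok v" and i: "i \<in> R" "big_edge h i j" for i j
    proof -
      have ij: "i < n" "j < m" using i by (auto simp: big_edge_def)
      have "i * m + j < Suc i * m" using ij by simp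
      also have "\<dots> \<le> n * m" using ij by (intro mult_le_mono1) simp
      finally show ?thesis using none[rule_format, of "i * m + j"] ij i by simp
    qed
    then show ?case using fin(1) by blast
  qed (use M_bounds env_simps[OF env] in \<open>simp_all add: agree_ints\<close>)
qed (use M_bounds in simp)

text \<open>\<open>ord\<close> is a time stamp kept only in the proof: it decreases along
  predecessors and so makes the path back to \<open>u\<close> finite. By the last conjunct,
  \<open>k\<close> visits have reached \<open>k\<close> distinct items unless the reached set was
  already closed, hence \<open>m\<close> visits suffice.\<close>

definition search_inv :: "real \<Rightarrow> nat \<Rightarrow> (nat \<Rightarrow> nat) \<Rightarrow> (nat \<Rightarrow> nat) \<Rightarrow> nat \<Rightarrow>
    nat set \<Rightarrow> nat set \<Rightarrow> (nat \<Rightarrow> nat) \<Rightarrow> nat \<Rightarrow> (nat \<Rightarrow> nat) \<Rightarrow> bool" where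
  "search_inv h u p ow k R V P e ord \<longleftrightarrow> R = insert u {i. \<exists>j\<in>V. ow j = Suc i} \<and>
     (\<forall>j\<in>V. ord j < k \<and> big_edge h (P j) j \<and>
        (P j = u \<or> (\<exists>j'\<in>V. p (P j) = Suc j' \<and> ord j' < ord j))) \<and>
     (e = 0 \<and> (\<forall>j\<in>V. ow j \<noteq> 0) \<or> (\<exists>j\<in>V. e = Suc j \<and> ow j = 0)) \<and>
     ((\<forall>i\<in>R. \<forall>j. big_edge h i j \<longrightarrow> j \<in> V) \<or> k \<le> card V)"

text \<open>The predecessor \<open>i\<close> of the new item is \<open>u\<close> or the partner of
  an item visited earlier. Stamping the new item with \<open>k\<close>, which exceeds all earlier
  stamps, keeps the chains of predecessors descending.\<close>

lemma search_inv_visit: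
  assumes inv: "search_inv h u p ow k R V P e ord" and mat: "matching h p ow {}" and V: "V \<subseteq> {..<m}"
    and i: "i \<in> R" and j: "j \<notin> V" "big_edge h i j"
  shows "search_inv h u p ow (Suc k) (if ow j = 0 then R else insert (ow j - 1) R) (insert j V) (P(j := i))
    (if ow j = 0 then Suc j else e) (ord(j := k))"
proof -
  have fin: "finite V" using V finite_subset by blast
  have R: "R = insert u {i. \<exists>j\<in>V. ow j = Suc i}" using inv by (simp add: search_inv_def)
  have new: "i = u \<or> (\<exists>j'\<in>V. p i = Suc j')"
  proof (cases "i = u")
    case False
    then obtain j' where j': "j' \<in> V" "ow j' = Suc i" using i R by auto
    then have "p i = Suc j'" using mat V unfolding matching_def by fastforce
    then show ?thesis using j' by blast
  qed simp
  have ord: "ord j' < k" "big_edge h (P j') j'"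
    "P j' = u \<or> (\<exists>j''\<in>V. p (P j') = Suc j'' \<and> ord j'' < ord j')" if "j' \<in> V" for j'
    using inv that by (auto simp: search_inv_def)
  have R': "(if ow j = 0 then R else insert (ow j - 1) R) = insert u {i. \<exists>j\<in>insert j V. ow j = Suc i}"
    using R by (auto simp: gr0_conv_Suc)
  have "\<forall>j'\<in>insert j V. (ord(j := k)) j' < Suc k \<and> big_edge h ((P(j := i)) j') j' \<and>
        ((P(j := i)) j' = u \<or> (\<exists>j''\<in>insert j V. p ((P(j := i)) j') = Suc j'' \<and> (ord(j := k)) j'' < (ord(j := k)) j'))"
  proof
    fix j' assume j': "j' \<in> insert j V"
    show "(ord(j := k)) j' < Suc k \<and> big_edge h ((P(j := i)) j') j' \<and>
        ((P(j := i)) j' = u \<or> (\<exists>j''\<in>insert j V. p ((P(j := i)) j') = Suc j'' \<and> (ord(j := k)) j'' < (ord(j := k)) j'))"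
    proof (cases "j' = j")
      case True
      have "i = u \<or> (\<exists>j''\<in>insert j V. p i = Suc j'' \<and> (ord(j := k)) j'' < k)"
        using new ord(1) j(1) by (metis fun_upd_other insert_iff)
      then show ?thesis using True j(2) by simp
    next
      case False
      then have "j' \<in> V" using j' by simp
      then have "P j' = u \<or> (\<exists>j''\<in>insert j V. p (P j') = Suc j'' \<and> (ord(j := k)) j'' < ord j')"
        using ord(3) j(1) by (metis fun_upd_other insert_iff)
      then show ?thesis using False ord[OF \<open>j' \<in> V\<close>] by simp
    qed
  qed
  moreover have "(if ow j = 0 then Suc j else e) = 0 \<and> (\<forall>j\<in>insert j V. ow j \<noteq> 0) \<or>
      (\<exists>j'\<in>insert j V. (if ow j = 0 then Suc j else e) = Suc j' \<and> ow j' = 0)"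
    using inv by (auto simp: search_inv_def)
  moreover have "(\<forall>i\<in>R. \<forall>j. big_edge h i j \<longrightarrow> j \<in> V) \<or> k \<le> card V" using inv unfolding search_inv_def by blast
  then have "Suc k \<le> card (insert j V)" using i j fin by auto
  ultimately show ?thesis unfolding search_inv_def R'[symmetric] by blast
qed

lemma visit_wp:
  assumes env: "env h s" and R: "indicates n (ints s ''R'') R" and V: "indicates m (ints s ''V'') V"
    and P: "holds_on V (ints s ''P'') P" and ow: "holds m (ints s ''o'') ow" and e: "ints s ''E'' 0 = int e"
    and inv: "search_inv h u p ow k R V P e ord" and mat: "matching h p ow {}"
  shows "wp f M visit_prog (\<lambda>s'. \<exists>R V P e ord. indicates n (ints s' ''R'') R \<and> indicates m (ints s' ''V'') V \<and>
    holds_on V (ints s' ''P'') P \<and> ints s' ''E'' 0 = int e \<and> search_inv h u p ow (Suc k) R V P e ord) s" (is "wp f M _ ?Q s")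
  unfolding visit_prog_def
proof (rule wp_Seq, rule wp_frame[OF find_edge_wp[OF env R V]], goal_cases)
  case (1 s')
  note ag = 1(1) and post = 1(2)
  have v: "ints s' ''m'' 0 = int m" "indicates n (ints s' ''R'') R" "indicates m (ints s' ''V'') V"
    "holds_on V (ints s' ''P'') P" "holds m (ints s' ''o'') ow" "ints s' ''E'' 0 = int e"
    using agree_ints[OF ag] env_simps[OF env] R V P ow e by simp_all
  show ?case
  proof (cases "ints s' ''F'' 0 = 0")
    case True
    then have all: "\<forall>i\<in>R. \<forall>j. big_edge h i j \<longrightarrow> j \<in> V" using post by auto
    have "search_inv h u p ow (Suc k) R V P e ord"
      using inv all unfolding search_inv_def by (meson less_Suc_eq)
    then have "?Q s'" using v by blast
    then show ?thesis using True by (intro wp_Cond wp_Skip) simp_all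
  next
    case False
    then obtain w where w: "w < n * m" "ints s' ''F'' 0 = int w + 1" "w div m \<in> R" "w mod m \<notin> V"
      "big_edge h (w div m) (w mod m)" using post by blast
    define i j where "i = w div m" and "j = w mod m"
    note ix = edge_index[OF w(1), folded i_def j_def]
    note w' = w(3-5)[folded i_def j_def]
    have Vm: "V \<subseteq> {..<m}" using V by (simp add: indicates_def)
    have oj: "ints s' ''o'' (int j) = int (ow j)" using v(5) ix(2) by (simp add: holds_def)
    note inv' = search_inv_visit[OF inv mat Vm w']
    have V': "indicates m ((ints s' ''V'')(int j := 1)) (insert j V)" using v(3) ix(2) by (rule indicates_insert)
    have P': "holds_on (insert j V) ((ints s' ''P'')(int j := int i)) (P(j := i))"
      using v(4) by (simp add: holds_on_def)
    show ?thesis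
    proof (intro wp_intros, goal_cases c1 c2 c3 c4 matched c5 free none)
      case matched
      then have oj0: "ow j \<noteq> 0" using ix w(2) v(1) oj by simp
      then have on: "ow j - 1 < n" using mat ix(2) by (fastforce simp: matching_def)
      have R': "indicates n ((ints s' ''R'')(int (ow j) - 1 := 1)) (insert (ow j - 1) R)"
        using indicates_insert[OF v(2) on] oj0 by (simp add: of_nat_diff)
      show ?case
        by (rule exI[of _ "insert (ow j - 1) R"], rule exI[of _ "insert j V"], rule exI[of _ "P(j := i)"],
            rule exI[of _ e], rule exI[of _ "ord(j := k)"])
          (use inv' oj0 R' V' P' ix w(2) v oj in simp)
    next
      case free
      then have oj0: "ow j = 0" using ix w(2) v(1) oj by simp
      show ?case
        by (rule exI[of _ R], rule exI[of _ "insert j V"], rule exI[of _ "P(j := i)"],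
            rule exI[of _ "Suc j"], rule exI[of _ "ord(j := k)"])
          (use inv' oj0 V' P' ix w(2) v in simp)
    next
      case none
      then show ?case using w(2) by simp
    qed (use ix w(2) v(1) M_bounds(1,2,3) in simp_all)
  qed
qed

lemma search_wp:
  assumes env: "env h s" and u: "u < n" "ints s ''u'' 0 = int u"
    and ow: "holds m (ints s ''o'') ow" and mat: "matching h p ow {}"
  shows "wp f M search_prog (\<lambda>s'. \<exists>R V P e ord. R \<subseteq> {..<n} \<and> V \<subseteq> {..<m} \<and>
    holds_on V (ints s' ''P'') P \<and> ints s' ''E'' 0 = int e \<and> search_inv h u p ow m R V P e ord) s"
  unfolding search_prog_def
proof (rule wp_Seq, rule wp_For[where I = "\<lambda>k s'. \<forall>j<k. ints s' ''R'' (int j) = 0" and N = n],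
    goal_cases _ _ init step expr fin)
  case (step k s')
  then show ?case using M_bounds by (intro wp_intros) (auto simp: less_Suc_eq)
next
  case (fin s1)
  have v1: "ints s1 ''m'' 0 = int m" "ints s1 ''u'' 0 = int u" "ints s1 ''o'' = ints s ''o''" "env h s1"
    using agree_ints[OF fin(2)] env_simps[OF env] u env_agree[OF env fin(2)] by simp_all
  note R1 = fin(1)
  show ?case
  proof (rule wp_Seq, rule wp_For[where I = "\<lambda>k s'. \<forall>j<k. ints s' ''V'' (int j) = 0" and N = m],
      goal_cases _ _ init step expr fin)
    case (step k s')
    then show ?case using M_bounds by (intro wp_intros) (auto simp: less_Suc_eq)
  next
    case (fin s2)
    have v2: "ints s2 ''u'' 0 = int u" "ints s2 ''o'' = ints s ''o''" "env h s2" "ints s2 ''R'' = ints s1 ''R''"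
      using agree_ints[OF fin(2)] v1 env_agree[OF v1(4) fin(2)] by simp_all
    have R2: "indicates n (ints s2 ''R'') {}" and V2: "indicates m (ints s2 ''V'') {}"
      using R1 fin(1) v2(4) by (auto simp: indicates_def)
    show ?case
    proof (intro wp_Seq wp_IAssign, goal_cases _ _ loop)
      case loop
      let ?I = "\<lambda>k s'. \<exists>R V P e ord. indicates n (ints s' ''R'') R \<and> indicates m (ints s' ''V'') V \<and>
        holds_on V (ints s' ''P'') P \<and> ints s' ''E'' 0 = int e \<and> search_inv h u p ow k R V P e ord"
      show ?case
      proof (rule wp_For[where I = ?I and N = m], goal_cases _ _ init step expr fin)
        case init
        have "indicates n ((ints s2 ''R'')(int u := 1)) {u}" using indicates_insert[OF R2 u(1)] .
        moreover have "search_inv h u p ow 0 {u} {} P 0 ord" for P ord by (simp add: search_inv_def)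
        ultimately show ?case using V2 v2
          by (intro exI[of _ "{u}"] exI[of _ "{}"] exI[of _ "\<lambda>_. 0"] exI[of _ 0]) (simp add: holds_on_def)
      next
        case (step k s')
        have "env h s'" "holds m (ints s' ''o'') ow"
          using env_agree[OF _ step(4)] agree_ints[OF step(4)] v2 ow by simp_all
        note v3 = this
        from step(2) obtain R V P e ord where *: "indicates n (ints s' ''R'') R" "indicates m (ints s' ''V'') V"
          "holds_on V (ints s' ''P'') P" "ints s' ''E'' 0 = int e" "search_inv h u p ow k R V P e ord" by blast
        show ?case
          by (rule wp_mono[OF visit_wp[OF v3(1) *(1-3) v3(2) *(4,5) mat]]) simp
      next
        case (fin s')
        then show ?case unfolding indicates_def by blast
      qed (use v2 M_bounds env_simps[OF v2(3)] in \<open>simp_all add: agree_ints\<close>)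
    qed (use M_bounds in simp_all)
  qed (use v1 M_bounds in \<open>simp_all add: agree_ints\<close>)
qed (use M_bounds env_simps[OF env] in \<open>simp_all add: agree_ints\<close>)

text \<open>The path to the free item \<open>e - 1\<close> is flipped from its end, so that after each step all players
  but \<open>u\<close> have a partner again and there is a free item closer to \<open>u\<close>.\<close>

definition flip_inv :: "real \<Rightarrow> nat \<Rightarrow> nat set \<Rightarrow> (nat \<Rightarrow> nat) \<Rightarrow> (nat \<Rightarrow> nat) \<Rightarrow> nat \<Rightarrow>
    (nat \<Rightarrow> nat) \<Rightarrow> (nat \<Rightarrow> nat) \<Rightarrow> nat \<Rightarrow> bool" where
  "flip_inv h u V P ord k p ow e \<longleftrightarrow>
     (if e = 0 then matching h p ow {} \<and> p u \<noteq> 0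
      else matching h p ow {e - 1} \<and> p u = 0 \<and> e - 1 \<in> V \<and> ord (e - 1) < k \<and>
        (\<forall>j\<in>V. ord j \<le> ord (e - 1) \<longrightarrow>
           big_edge h (P j) j \<and> (P j = u \<or> (\<exists>j'\<in>V. p (P j) = Suc j' \<and> ord j' < ord j))))"

text \<open>Moving player \<open>P j\<close> to the free item \<open>j\<close> releases its old
  partner, if any, which has a smaller time stamp; so \<open>k\<close> can be lowered by one. A
  blocked set cannot contain the moved player, since its neighbour \<open>j\<close> would then be
  matched, and hence it stays blocked.\<close>

lemma flip_inv_step:
  assumes inv: "flip_inv h u V P ord k p ow (Suc j)" and V: "V \<subseteq> {..<m}"
  defines "i \<equiv> P j"
  defines "p' \<equiv> p(i := Suc j)"
  defines "ow' \<equiv> ow(j := Suc i)"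
  shows "flip_inv h u V P ord (k - 1) p' ow' (p i)" "0 < k" "i < n" "j < m" "p i \<le> m"
    "\<And>i'. i' \<noteq> u \<Longrightarrow> p' i' = 0 \<longleftrightarrow> p i' = 0"
    "\<And>X. blocked h p X \<Longrightarrow> u \<notin> X \<Longrightarrow> blocked h p' X"
proof -
  have mat: "matching h p ow {j}" and pu: "p u = 0" and jV: "j \<in> V" and ord: "ord j < k"
    and chain: "\<And>j'. j' \<in> V \<Longrightarrow> ord j' \<le> ord j \<Longrightarrow>
       big_edge h (P j') j' \<and> (P j' = u \<or> (\<exists>j''\<in>V. p (P j') = Suc j'' \<and> ord j'' < ord j'))"
    using inv by (auto simp: flip_inv_def)
  have e: "big_edge h i j" and iu: "i = u \<or> (\<exists>j''\<in>V. p i = Suc j'' \<and> ord j'' < ord j)"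
    using chain[OF jV] by (auto simp: i_def)
  show "0 < k" "i < n" "j < m" using ord e by (auto simp: big_edge_def)
  have M1: "big_edge h i' (p i' - 1)" "ow (p i' - 1) = Suc i'" "p i' - 1 \<noteq> j" if "i' < n" "p i' \<noteq> 0" for i'
    using mat that by (auto simp: matching_def)
  have M2: "ow j' \<le> n" "p (ow j' - 1) = Suc j'" if "j' < m" "j' \<noteq> j" "ow j' \<noteq> 0" for j'
    using mat that by (auto simp: matching_def)
  show "p i \<le> m" using M1(1)[OF \<open>i < n\<close>] by (cases "p i") (auto simp: big_edge_def)
  have free: "p i' \<noteq> Suc j" if "i' < n" for i' using M1(3)[OF that] by fastforce
  show same: "p' i' = 0 \<longleftrightarrow> p i' = 0" if "i' \<noteq> u" for i'
    using that iu by (auto simp: p'_def)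
  show "blocked h p' X" if X: "blocked h p X" "u \<notin> X" for X
  proof -
    have "i \<notin> X"
    proof
      assume "i \<in> X"
      then obtain i' where "i' \<in> X" "p i' = Suc j" using X(1) e unfolding blocked_def by blast
      then show False using free X(1) by (auto simp: blocked_def)
    qed
    then show ?thesis using X(1) unfolding blocked_def p'_def by (metis fun_upd_other)
  qed
  show "flip_inv h u V P ord (k - 1) p' ow' (p i)"
  proof (cases "i = u")
    case True
    have "matching h p' ow' {}"
      unfolding matching_def
    proof (intro conjI allI impI)
      fix i' assume i': "i' < n" "p' i' \<noteq> 0"
      show "big_edge h i' (p' i' - 1)" "ow' (p' i' - 1) = Suc i'"
        using M1[OF i'(1)] i' e True by (auto simp: p'_def ow'_def split: if_splits)
    next
      fix j' assume j': "j' < m" "ow' j' \<noteq> 0"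
      show "ow' j' \<le> n" using M2[OF j'(1)] j' \<open>i < n\<close> by (auto simp: ow'_def split: if_splits)
      show "p' (ow' j' - 1) = Suc j'"
        using M2(2)[OF j'(1)] j' pu True by (fastforce simp: p'_def ow'_def split: if_splits)
    qed simp
    then show ?thesis using True pu by (simp add: flip_inv_def p'_def)
  next
    case False
    then obtain j'' where j'': "j'' \<in> V" "p i = Suc j''" "ord j'' < ord j" using iu by blast
    have ne: "j'' \<noteq> j" using j'' by auto
    \<comment> \<open>The entry of \<open>j''\<close> keeps naming \<open>i\<close> after
      \<open>i\<close> has moved on to \<open>j\<close>; it is the outdated entry that the set
      \<open>{j''}\<close> excuses.\<close>
    have owj: "ow j'' = Suc i" using M1(2)[OF \<open>i < n\<close>] j'' by simp
    have "matching h p' ow' {j''}"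
      unfolding matching_def
    proof (intro conjI allI impI)
      fix i' assume i': "i' < n" "p' i' \<noteq> 0"
      show "big_edge h i' (p' i' - 1)" "ow' (p' i' - 1) = Suc i'"
        using M1[OF i'(1)] i' e by (auto simp: p'_def ow'_def split: if_splits)
      show "p' i' - 1 \<notin> {j''}"
        using M1[OF i'(1)] i' ne owj by (auto simp: p'_def split: if_splits)
    next
      fix j' assume j': "j' < m" "j' \<notin> {j''}" "ow' j' \<noteq> 0"
      show "ow' j' \<le> n" using M2[OF j'(1)] j' \<open>i < n\<close> by (auto simp: ow'_def split: if_splits)
      show "p' (ow' j' - 1) = Suc j'"
        using M2(2)[OF j'(1)] j' j''(2) by (fastforce simp: p'_def ow'_def split: if_splits)
    qed
    moreover have "big_edge h (P j1) j1 \<and> (P j1 = u \<or> (\<exists>j2\<in>V. p' (P j1) = Suc j2 \<and> ord j2 < ord j1))"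
      if j1: "j1 \<in> V" "ord j1 \<le> ord j''" for j1
    proof -
      have c: "big_edge h (P j1) j1 \<and> (P j1 = u \<or> (\<exists>j2\<in>V. p (P j1) = Suc j2 \<and> ord j2 < ord j1))"
        using chain[OF j1(1)] j1(2) j''(3) by simp
      then have "P j1 \<noteq> i" using j''(2) j1(2) False by auto
      then show ?thesis using c by (simp add: p'_def)
    qed
    moreover have "p' u = 0" using pu False by (simp add: p'_def)
    ultimately show ?thesis using j'' ord by (simp add: flip_inv_def)
  qed
qed

lemma flip_wp:
  assumes p: "holds n (ints s ''p'') p" and ow: "holds m (ints s ''o'') ow" and P: "holds_on V (ints s ''P'') P"
    and e: "ints s ''E'' 0 = int e" "e \<noteq> 0" and inv: "flip_inv h u V P ord m p ow e" and V: "V \<subseteq> {..<m}"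
  shows "wp f M flip_prog (\<lambda>s'. \<exists>p' ow'. holds n (ints s' ''p'') p' \<and> holds m (ints s' ''o'') ow' \<and>
    matching h p' ow' {} \<and> p' u \<noteq> 0 \<and> (\<forall>i. i \<noteq> u \<longrightarrow> (p' i = 0 \<longleftrightarrow> p i = 0)) \<and>
    (\<forall>X. blocked h p X \<longrightarrow> u \<notin> X \<longrightarrow> blocked h p' X)) s"
  unfolding flip_prog_def
proof (rule wp_While[where k = m and I = "\<lambda>k s'. \<exists>p' ow' e. holds n (ints s' ''p'') p' \<and>
    holds m (ints s' ''o'') ow' \<and> holds_on V (ints s' ''P'') P \<and> ints s' ''E'' 0 = int e \<and>
    flip_inv h u V P ord k p' ow' e \<and> (\<forall>i. i \<noteq> u \<longrightarrow> (p' i = 0 \<longleftrightarrow> p i = 0)) \<and>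
    (\<forall>X. blocked h p X \<longrightarrow> u \<notin> X \<longrightarrow> blocked h p' X)"], goal_cases init bound step fin)
  case init
  show ?case using assms by blast
next
  case bound
  show ?case using M_bounds by simp
next
  case (step k s')
  then obtain p' ow' e' where *: "holds n (ints s' ''p'') p'" "holds m (ints s' ''o'') ow'"
    "holds_on V (ints s' ''P'') P" "ints s' ''E'' 0 = int e'" "flip_inv h u V P ord k p' ow' e'"
    "\<forall>i. i \<noteq> u \<longrightarrow> (p' i = 0 \<longleftrightarrow> p i = 0)" "\<forall>X. blocked h p X \<longrightarrow> u \<notin> X \<longrightarrow> blocked h p' X" by blast
  have "e' \<noteq> 0" using step(2) *(4) by simp
  then obtain j where j: "e' = Suc j" using not0_implies_Suc by blast
  note st = flip_inv_step[OF *(5)[unfolded j] V]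
  have r: "ints s' ''P'' (int j) = int (P j)" "ints s' ''p'' (int (P j)) = int (p' (P j))"
    using * st(3) j by (simp_all add: holds_def holds_on_def flip_inv_def)
  have E: "ints s' ''E'' 0 = int j + 1" using *(4) j by simp
  have hp: "holds n ((ints s' ''p'')(int (P j) := int j + 1)) (p'(P j := Suc j))"
    using *(1) by (rule holds_upd) auto
  have ho: "holds m ((ints s' ''o'')(int j := int (P j) + 1)) (ow'(j := Suc (P j)))"
    using *(2) by (rule holds_upd) auto
  show ?case
  proof (rule conjI[OF st(2)], intro wp_intros, goal_cases _ _ _ _ _ fin)
    case fin
    show ?case
      by (rule exI[of _ "p'(P j := Suc j)"], rule exI[of _ "ow'(j := Suc (P j))"], rule exI[of _ "p' (P j)"])
        (use *(1-3,5-7) r E hp ho st(1,6,7) in simp)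
  qed (use r E st(3-5) M_bounds in simp_all)
next
  case (fin k s')
  then show ?case by (force simp: flip_inv_def)
qed

section \<open>Matroid greedy algorithm over players of decreasing cost\<close>

definition matching_inv :: "real \<Rightarrow> (nat \<Rightarrow> nat) \<Rightarrow> nat set \<Rightarrow> (nat \<Rightarrow> nat) \<Rightarrow> (nat \<Rightarrow> nat) \<Rightarrow> bool" where
  "matching_inv h c D p ow \<longleftrightarrow> matching h p ow {} \<and> (\<forall>i. i \<notin> D \<longrightarrow> p i = 0) \<and>
     (\<exists>X. blocked h p X \<and> X \<subseteq> D \<and> (\<forall>i\<in>D. p i = 0 \<longrightarrow> i \<in> X)) \<and>
     (\<forall>i\<in>D. \<forall>i'<n. i' \<notin> D \<longrightarrow> c i' \<le> c i) \<and>
     (\<forall>b. hall n m (big_edge h) b \<longrightarrow>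
        weight_dominates b (\<lambda>i. real (c i)) D {i \<in> D. p i \<noteq> 0})"

text \<open>The blocked set certifies that no larger set of processed players is matchable. This is
  the rank inequality for the current prefix of players, and \<open>weight_dominates_insert\<close>
  turns it into the comparison with every fractional \<open>b\<close>.\<close>

lemma matching_inv_insert:
  assumes inv: "matching_inv h c D p ow" and D: "D \<subseteq> {..<n}" and u: "u < n" "u \<notin> D"
    and max: "\<forall>i<n. i \<notin> D \<longrightarrow> c i \<le> c u" and mat: "matching h p' ow' {}"
    and out: "\<And>i. i \<noteq> u \<Longrightarrow> p' i = 0 \<longleftrightarrow> p i = 0"
    and X: "\<exists>X. blocked h p' X \<and> X \<subseteq> insert u D \<and> (\<forall>i\<in>insert u D. p' i = 0 \<longrightarrow> i \<in> X)"
  shows "matching_inv h c (insert u D) p' ow'"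
proof -
  let ?S = "{i \<in> D. p i \<noteq> 0}" and ?S' = "{i \<in> insert u D. p' i \<noteq> 0}"
  obtain X where X: "blocked h p' X" "X \<subseteq> insert u D" "\<forall>i\<in>insert u D. p' i = 0 \<longrightarrow> i \<in> X"
    using X by blast
  have fin: "finite D" using D finite_subset by blast
  have "weight_dominates b (\<lambda>i. real (c i)) (insert u D) ?S'" if hall: "hall n m (big_edge h) b" for b
  proof (rule weight_dominates_insert)
    show "weight_dominates b (\<lambda>i. real (c i)) D ?S" using inv hall by (simp add: matching_inv_def)
    have "?S = {i \<in> D. p' i \<noteq> 0}" using out u(2) by (intro Collect_cong) metis
    then show "?S' = ?S \<or> ?S' = insert u ?S" by (cases "p' u = 0") auto
    show "sum b (insert u D) \<le> card ?S'"
    proof (rule hall_sum_le_card[OF hall, where X = X and p = p'])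
      fix i j assume ij: "i \<in> X" "j < m" "big_edge h i j"
      then obtain i' where "i' \<in> X" "p' i' = Suc j" using X(1) unfolding blocked_def by blast
      then show "\<exists>i'\<in>X \<inter> ?S'. p' i' = Suc j" using X(2) by auto
    qed (use D u X in auto)
    show "real (c u) \<le> real (c i)" if "i \<in> D" for i using inv that u by (simp add: matching_inv_def)
  qed (use fin u in auto)
  moreover have "\<forall>i. i \<notin> insert u D \<longrightarrow> p' i = 0" using inv out by (auto simp: matching_inv_def)
  moreover have "\<forall>i\<in>insert u D. \<forall>i'<n. i' \<notin> insert u D \<longrightarrow> c i' \<le> c i"
    using inv max by (auto simp: matching_inv_def)
  ultimately show ?thesis using mat X unfolding matching_inv_def by blast
qed

text \<open>A failed search leaves the matching alone; the reached players join the certificate, and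
  they are processed because all of them except \<open>u\<close> are matched. A successful search
  matches \<open>u\<close> and leaves nobody else unmatched who had a partner, so the old
  certificate still covers all unmatched players.\<close>

lemma augment_wp:
  assumes env: "env h s" and u: "u < n" "u \<notin> D" "ints s ''u'' 0 = int u" and D: "D \<subseteq> {..<n}"
    and p: "holds n (ints s ''p'') p" and ow: "holds m (ints s ''o'') ow"
    and inv: "matching_inv h c D p ow" and max: "\<forall>i<n. i \<notin> D \<longrightarrow> c i \<le> c u"
  shows "wp f M (search_prog ;; flip_prog) (\<lambda>s'. \<exists>p ow. holds n (ints s' ''p'') p \<and>
    holds m (ints s' ''o'') ow \<and> matching_inv h c (insert u D) p ow) s"
proof -
  have mat: "matching h p ow {}" and pu: "p u = 0" using inv u by (auto simp: matching_inv_def)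
  obtain X where X: "blocked h p X" "X \<subseteq> D" "\<forall>i\<in>D. p i = 0 \<longrightarrow> i \<in> X"
    using inv by (auto simp: matching_inv_def)
  show ?thesis
  proof (rule wp_Seq, rule wp_frame[OF search_wp[OF env u(1,3) ow mat]], goal_cases)
    case (1 s')
    note ag = 1(1)
    from 1(2) obtain R V P e ord where s': "R \<subseteq> {..<n}" "V \<subseteq> {..<m}" "holds_on V (ints s' ''P'') P"
      "ints s' ''E'' 0 = int e" and si: "search_inv h u p ow m R V P e ord" by blast
    have v: "holds n (ints s' ''p'') p" "holds m (ints s' ''o'') ow"
      using agree_ints[OF ag] p ow by simp_all
    show ?case
    proof (cases "e = 0")
      case True
      have R: "R = insert u {i. \<exists>j\<in>V. ow j = Suc i}" using si by (simp add: search_inv_def)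
      have o0: "\<forall>j\<in>V. ow j \<noteq> 0" using si True by (auto simp: search_inv_def)
      have all: "j \<in> V" if "i \<in> R" "big_edge h i j" for i j
      proof -
        have "m \<le> card V \<Longrightarrow> V = {..<m}"
          using s'(2) card_subset_eq[of "{..<m}" V] card_mono[OF _ s'(2)] by simp
        then show ?thesis using si that unfolding search_inv_def big_edge_def by blast
      qed
      have own: "p (ow j - 1) = Suc j" if "j \<in> V" for j
        using mat o0 that s'(2) unfolding matching_def by blast
      have "blocked h p R"
        unfolding blocked_def
      proof (intro conjI ballI allI impI)
        fix i j assume "i \<in> R" "big_edge h i j"
        then have "j \<in> V" by (rule all)
        then have "ow j = Suc (ow j - 1)" using o0 by simp
        then have "ow j - 1 \<in> R" using R \<open>j \<in> V\<close> by blast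
        then show "\<exists>i'\<in>R. p i' = Suc j" using own[OF \<open>j \<in> V\<close>] by blast
      qed (rule s'(1))
      \<comment> \<open>Blocked sets are closed under union.\<close>
      then have "blocked h p (X \<union> R)" using X(1) unfolding blocked_def by blast
      moreover have "R \<subseteq> insert u D"
      proof
        fix i assume "i \<in> R"
        then consider "i = u" | j where "j \<in> V" "ow j = Suc i" using R by blast
        then show "i \<in> insert u D"
        proof cases
          case 2
          then have "p i \<noteq> 0" using own[of j] by simp
          moreover have "\<And>i. i \<notin> D \<Longrightarrow> p i = 0" using inv by (simp add: matching_inv_def)
          ultimately show ?thesis by auto
        qed simp
      qed
      ultimately have "\<exists>X. blocked h p X \<and> X \<subseteq> insert u D \<and> (\<forall>i\<in>insert u D. p i = 0 \<longrightarrow> i \<in> X)"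
        using X R by (intro exI[of _ "X \<union> R"]) auto
      then have "matching_inv h c (insert u D) p ow"
        using matching_inv_insert[OF inv D u(1,2) max mat] by blast
      \<comment> \<open>With \<open>E = 0\<close> the flipping loop is not entered.\<close>
      then show ?thesis unfolding flip_prog_def using v True s'(4)
        by (intro wp_While[where k = 0 and I = "\<lambda>k t. t = s'"]) auto
    next
      case False
      have fi: "flip_inv h u V P ord m p ow e"
      proof -
        obtain j where j: "j \<in> V" "e = Suc j" "ow j = 0" using si False by (auto simp: search_inv_def)
        have "matching h p ow {j}" using mat j(3) by (auto simp: matching_def)
        moreover have "\<forall>j'\<in>V. ord j' < m \<and> big_edge h (P j') j' \<and>
            (P j' = u \<or> (\<exists>j''\<in>V. p (P j') = Suc j'' \<and> ord j'' < ord j'))"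
          using si unfolding search_inv_def by blast
        ultimately show ?thesis using j pu by (auto simp: flip_inv_def)
      qed
      show ?thesis
      proof (rule wp_mono[OF flip_wp[OF v s'(3,4) False fi s'(2)]], goal_cases)
        case (1 t)
        then obtain p' ow' where t: "holds n (ints t ''p'') p'" "holds m (ints t ''o'') ow'"
          "matching h p' ow' {}" "p' u \<noteq> 0" "\<And>i. i \<noteq> u \<Longrightarrow> (p' i = 0 \<longleftrightarrow> p i = 0)"
          "\<And>X. blocked h p X \<Longrightarrow> u \<notin> X \<Longrightarrow> blocked h p' X" by blast
        have "matching_inv h c (insert u D) p' ow'"
        proof (rule matching_inv_insert[OF inv D u(1,2) max t(3,5)])
          have "blocked h p' X" using t(6) X u(2) by blast
          moreover have "i \<in> X" if "i \<in> insert u D" "p' i = 0" for i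
            using that X(3) t(4) t(5)[of i] by (cases "i = u") auto
          ultimately show "\<exists>X. blocked h p' X \<and> X \<subseteq> insert u D \<and> (\<forall>i\<in>insert u D. p' i = 0 \<longrightarrow> i \<in> X)"
            using X(2) by (intro exI[of _ X]) auto
        qed
        then show ?case using t by blast
      qed
    qed
  qed
qed

lemma matching_wp:
  assumes env: "env h s" and c: "holds n (ints s ''C'') c" "\<And>i. i < n \<Longrightarrow> c i \<le> M"
  shows "wp f M matching_prog (\<lambda>s'. \<exists>p. holds n (ints s' ''p'') p \<and>
    (\<forall>i<n. p i \<noteq> 0 \<longrightarrow> big_edge h i (p i - 1)) \<and> inj_on p {i. i < n \<and> p i \<noteq> 0} \<and>
    (\<forall>b. hall n m (big_edge h) b \<longrightarrow> (\<Sum>i<n. b i * c i) \<le> (\<Sum>i\<in>{i. i < n \<and> p i \<noteq> 0}. real (c i)))) s"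
  unfolding matching_prog_def
proof (rule wp_Seq, rule wp_For[where I = "\<lambda>k s'. \<forall>j<k. ints s' ''p'' (int j) = 0 \<and> ints s' ''d'' (int j) = 0" and N = n],
    goal_cases _ _ init step expr fin)
  case (step k s')
  then show ?case using M_bounds by (intro wp_intros) (auto simp: less_Suc_eq)
next
  case (fin s1)
  have v1: "ints s1 ''m'' 0 = int m" "ints s1 ''C'' = ints s ''C''" "env h s1"
    using agree_ints[OF fin(2)] env_simps[OF env] env_agree[OF env fin(2)] by simp_all
  note p1 = fin(1)
  show ?case
  proof (rule wp_Seq, rule wp_For[where I = "\<lambda>k s'. \<forall>j<k. ints s' ''o'' (int j) = 0" and N = m],
      goal_cases _ _ init step expr fin)
    case (step k s')
    then show ?case using M_bounds by (intro wp_intros) (auto simp: less_Suc_eq)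
  next
    case (fin s2)
    have v2: "ints s2 ''p'' = ints s1 ''p''" "ints s2 ''d'' = ints s1 ''d''" "ints s2 ''C'' = ints s ''C''" "env h s2"
      using agree_ints[OF fin(2)] v1 env_agree[OF v1(3) fin(2)] by simp_all
    let ?I = "\<lambda>k s'. \<exists>D p ow. indicates n (ints s' ''d'') D \<and> card D = k \<and> holds n (ints s' ''p'') p \<and>
      holds m (ints s' ''o'') ow \<and> matching_inv h c D p ow"
    show ?case
    proof (rule wp_For[where I = ?I and N = n], goal_cases _ _ init step expr fin)
      case init
      have "matching_inv h c {} (\<lambda>_. 0) (\<lambda>_. 0)"
        by (auto simp: matching_inv_def matching_def weight_dominates_def blocked_def)
      moreover have "indicates n (ints s2 ''d'') {}" "holds n (ints s2 ''p'') (\<lambda>_. 0)" "holds m (ints s2 ''o'') (\<lambda>_. 0)"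
        using p1 fin(1) v2 by (auto simp: indicates_def holds_def)
      ultimately show ?case by (intro exI[of _ "{}"] exI[of _ "\<lambda>_. 0"]) simp
    next
      case (step k s')
      then obtain D p ow where D: "indicates n (ints s' ''d'') D" "card D = k" and p: "holds n (ints s' ''p'') p"
        and ow: "holds m (ints s' ''o'') ow" and inv: "matching_inv h c D p ow" by blast
      have v3: "env h s'" "holds n (ints s' ''C'') c"
        using env_agree[OF v2(4) step(4)] agree_ints[OF step(4)] v2(3) c(1) by simp_all
      have Dn: "D \<noteq> {..<n}" "D \<subseteq> {..<n}" "finite D"
        using D step(1) by (auto simp: indicates_def intro: finite_subset)
      show ?case
      proof (rule wp_Seq, rule wp_frame[OF next_player_wp[OF v3(1) D(1) Dn(1) v3(2) c(2)]], assumption, goal_cases)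
        case (1 s3)
        note ag = 1(1)
        from 1(2) obtain u where u: "u < n" "u \<notin> D" "\<forall>i<n. i \<notin> D \<longrightarrow> c i \<le> c u"
          "ints s3 ''u'' 0 = int u" "indicates n (ints s3 ''d'') (insert u D)" by blast
        have v4: "env h s3" "holds n (ints s3 ''p'') p" "holds m (ints s3 ''o'') ow"
          using env_agree[OF v3(1) ag] agree_ints[OF ag] p ow by simp_all
        show ?case
        proof (rule wp_frame[OF augment_wp[OF v4(1) u(1,2,4) Dn(2) v4(2,3) inv u(3)]], goal_cases)
          case (1 t)
          have "ints t ''d'' = ints s3 ''d''" using agree_ints[OF 1(1)] by simp
          then have "indicates n (ints t ''d'') (insert u D)" "card (insert u D) = Suc k"
            using u(2,5) D(2) Dn(3) by simp_all
          moreover obtain p ow where "holds n (ints t ''p'') p" "holds m (ints t ''o'') ow"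
            "matching_inv h c (insert u D) p ow" using 1(2) by blast
          ultimately show ?case
            by (intro exI[of _ "insert u D"] exI[of _ p] exI[of _ ow]) simp
        qed
      qed
    next
      case (fin s')
      then obtain D p ow where D: "indicates n (ints s' ''d'') D" "card D = n" and p: "holds n (ints s' ''p'') p"
        and inv: "matching_inv h c D p ow" by blast
      have Dn: "D = {..<n}" using D card_subset_eq[of "{..<n}" D] by (simp add: indicates_def)
      have mat: "matching h p ow {}" using inv by (simp add: matching_inv_def)
      have "(\<Sum>i<n. b i * c i) \<le> (\<Sum>i\<in>{i. i < n \<and> p i \<noteq> 0}. real (c i))" if "hall n m (big_edge h) b" for b
      proof -
        have "weight_dominates b (\<lambda>i. real (c i)) {..<n} {i. i < n \<and> p i \<noteq> 0}"
          using inv that Dn by (simp add: matching_inv_def)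
        then show ?thesis unfolding weight_dominates_def by (elim allE[of _ 0]) simp
      qed
      moreover have "\<forall>i<n. p i \<noteq> 0 \<longrightarrow> big_edge h i (p i - 1)" using mat by (simp add: matching_def)
      moreover have "inj_on p {i. i < n \<and> p i \<noteq> 0}"
      proof (rule inj_onI)
        fix i i' assume "i \<in> {i. i < n \<and> p i \<noteq> 0}" "i' \<in> {i. i < n \<and> p i \<noteq> 0}" "p i = p i'"
        moreover have "ow (p k - 1) = Suc k" if "k < n" "p k \<noteq> 0" for k
          using mat that by (simp add: matching_def)
        ultimately have "Suc i = Suc i'" by (metis (mono_tags, lifting) mem_Collect_eq)
        then show "i = i'" by simp
      qed
      ultimately show ?case using p by blast
    qed (use v2 M_bounds env_simps[OF v2(4)] in \<open>simp_all add: agree_ints\<close>)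
  qed (use v1 M_bounds in \<open>simp_all add: agree_ints\<close>)
qed (use M_bounds env_simps[OF env] in \<open>simp_all add: agree_ints\<close>)


section \<open>Correctness of the rounds\<close>

lemma assign_wp:
  assumes env: "env h s" and i: "i < n" "ints s ''i'' 0 = int i" and r: "ints s ''r'' 0 = int r"
    and G: "row s (r * n + i) G" and p: "ints s ''p'' (int i) = int p" "p \<le> m"
    and L: "holds m (ints s ''L'') L" "\<And>j. j < m \<Longrightarrow> L j < M"
    and x: "ints s ''X'' 0 = int x" "ints s ''C'' (int i) = int c" "x + c \<le> M"
    and w: "reals s ''w'' (int i) = f G" and t: "reals s ''t'' 0 = t"
  defines "A \<equiv> (if p = 0 then G else {p - 1})"
  shows "wp f M assign_prog (\<lambda>s'. row s' (r * n + i) A \<and>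
    (\<forall>q B. q \<noteq> r * n + i \<longrightarrow> row s q B \<longrightarrow> row s' q B) \<and>
    holds m (ints s' ''L'') (\<lambda>j. L j + (if p = 0 \<and> j \<in> G then 1 else 0)) \<and>
    ints s' ''X'' 0 = int (x + (if p = 0 then c else 0)) \<and> reals s' ''t'' 0 = min t (f A) \<and>
    (\<forall>i'. i' \<noteq> i \<longrightarrow> reals s' ''w'' (int i') = reals s ''w'' (int i'))) s" (is "wp f M _ ?Post s")
proof -
  let ?q = "r * n + i"
  let ?Q = "\<lambda>s'. row s' ?q A \<and> (\<forall>q B. q \<noteq> ?q \<longrightarrow> row s q B \<longrightarrow> row s' q B) \<and>
    holds m (ints s' ''L'') (\<lambda>j. L j + (if p = 0 \<and> j \<in> G then 1 else 0)) \<and>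
    ints s' ''X'' 0 = int (x + (if p = 0 then c else 0)) \<and>
    (\<forall>i'. i' \<noteq> i \<longrightarrow> reals s' ''w'' (int i') = reals s ''w'' (int i'))"
  have last: "wp f M (Cond (RLess (RRead ''w'' (IVar ''i'')) (RVar ''t''))
       (RSet ''t'' (RRead ''w'' (IVar ''i''))) Skip) ?Post s'"
    if "?Q s'" "reals s' ''w'' (int i) = f A" "ints s' ''i'' 0 = int i" "reals s' ''t'' 0 = t" for s'
    by (intro wp_intros) (use that in \<open>simp_all add: min_def\<close>)
  have ix: "int r * int n + int i = int ?q" by simp
  show ?thesis
    unfolding assign_prog_def
  proof (rule wp_Seq, rule wp_Cond, goal_cases T F)
    case T
    then have p0: "p \<noteq> 0" using p i by simp
    let ?J = "\<lambda>k s'. (\<forall>j<k. ints s' ''W'' (int ?q * int m + int j) = 0) \<and>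
      (\<forall>q j. q \<noteq> ?q \<longrightarrow> j < m \<longrightarrow> ints s' ''W'' (int q * int m + int j) = ints s ''W'' (int q * int m + int j))"
    show ?case
    proof (rule wp_Seq, rule wp_For[where I = ?J and N = m], goal_cases _ _ init step expr fin)
      case (step k s')
      have v: "ints s' ''i'' 0 = int i" "ints s' ''r'' 0 = int r" "ints s' ''n'' 0 = int n" "ints s' ''m'' 0 = int m"
        using agree_ints[OF step(4)] env_simps[OF env] i r by simp_all
      show ?case
      proof (intro wp_intros, goal_cases _ fin)
        case fin
        show ?case using step(1-3) v cell_eq_iff[of _ k _ ?q]
          by (simp add: ix less_Suc_eq del: of_nat_add of_nat_mult)
      qed simp
    next
      case (fin s')
      have v: "ints s' ''i'' 0 = int i" "ints s' ''r'' 0 = int r" "ints s' ''n'' 0 = int n" "ints s' ''m'' 0 = int m"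
        "ints s' ''p'' (int i) = int p" "ints s' ''L'' = ints s ''L''" "ints s' ''X'' = ints s ''X''"
        "reals s' = reals s"
        using agree_ints[OF fin(2)] agree_reals[OF fin(2)] env_simps[OF env] i r p by (simp_all add: fun_eq_iff)
      obtain g where g: "p = Suc g" using p0 not0_implies_Suc by blast
      have gm: "g < m" using g p(2) by simp
      have sv: "reals s ''s'' (int g) = f {g}" using env_simps(5)[OF env gm] .
      let ?t = "iupdate ''W'' (int ?q * int m + int g) 1 s'"
      have row1: "row ?t ?q {g}"
        using fin(1) gm by (simp add: indicates_def)
      have row2: "row ?t q B" if "q \<noteq> ?q" "row s q B" for q B
        using fin(1) gm that cell_eq_iff[of _ g q ?q] by (simp add: indicates_def del: of_nat_add of_nat_mult)
      show ?case
      proof (rule wp_Seq, rule wp_IAssign, goal_cases _ post)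
        case post
        have st: "iupdate ''W'' (ival (current_cell (ISub (IRead ''p'' (IVar ''i'')) (IConst 1))) s') (ival (IConst 1) s') s' = ?t"
          using v g by simp
        show ?case unfolding st
          by (rule wp_RAssign, rule last)
            (use row1 row2 v g sv L x t in \<open>simp_all add: A_def\<close>)
      qed (use M_bounds in simp)
    qed (use M_bounds env_simps[OF env] in \<open>simp_all add: agree_ints\<close>)
  next
    case F
    then have p0: "p = 0" using p i by simp
    have Gw: "ints s ''W'' (int ?q * int m + int j) = (if j \<in> G then 1 else 0)" if "j < m" for j
      using G that by (simp add: indicates_def)
    let ?J = "\<lambda>k s'. \<forall>j<m. ints s' ''L'' (int j) = int (L j + (if j < k \<and> j \<in> G then 1 else 0))"
    show ?case
    proof (rule wp_Seq, rule wp_For[where I = ?J and N = m], goal_cases _ _ init step expr fin)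
      case init
      then show ?case using L by (simp add: holds_def)
    next
      case (step k s')
      have v: "ints s' ''i'' 0 = int i" "ints s' ''r'' 0 = int r" "ints s' ''n'' 0 = int n" "ints s' ''m'' 0 = int m"
        "ints s' ''W'' = ints s ''W''"
        using agree_ints[OF step(4)] env_simps[OF env] i r by simp_all
      show ?case
        by (intro wp_intros)
          (use step(1-3) v Gw[OF step(1)] L(2)[OF step(1)] in
            \<open>auto simp: ix less_Suc_eq simp del: of_nat_add of_nat_mult\<close>)
    next
      case (fin s')
      have v: "ints s' ''i'' 0 = int i" "ints s' ''W'' = ints s ''W''" "ints s' ''X'' 0 = int x"
        "ints s' ''C'' (int i) = int c" "reals s' = reals s"
        using agree_ints[OF fin(2)] agree_reals[OF fin(2)] i x by (simp_all add: fun_eq_iff)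
      show ?case
        by (rule wp_IAssign, use v x in simp, rule last)
          (use fin(1) v G p0 x w t in \<open>simp_all add: A_def holds_def\<close>)
    qed (use M_bounds env_simps[OF env] in \<open>simp_all add: agree_ints\<close>)
  qed
qed

definition target_feasible :: "real \<Rightarrow> bool" where
  "target_feasible h \<longleftrightarrow> (\<exists>T. config_LP_feasible {..<n} {..<m} \<Gamma> f T \<and> good_target h T)"

text \<open>\<open>ok\<close> lies between two conditions: \<open>target_feasible\<close> implies
  it, and it implies the value bound and the balance. The loads \<open>L\<close> describe small
  items; a big item occurs at most \<open>r\<close> times because each matching uses it at most
  once.\<close>

definition rounds_inv :: "real \<Rightarrow> nat \<Rightarrow> (nat \<Rightarrow> nat set) \<Rightarrow> (nat \<Rightarrow> nat) \<Rightarrow> bool \<Rightarrow> real \<Rightarrow> bool" where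
  "rounds_inv h r W L ok t \<longleftrightarrow>
     (\<forall>j<m. L j \<le> n * r) \<and>
     (\<forall>q<r * n. W q \<subseteq> \<Gamma> (q mod n) \<and> t \<le> f (W q)) \<and>
     (\<forall>j<m. if j \<in> big_items h then card {q. q < r * n \<and> j \<in> W q} \<le> r
        else card {q. q < r * n \<and> j \<in> W q} = L j) \<and>
     (ok \<longrightarrow> h \<le> 64 * real m * t \<and>
        (\<Sum>j<m. (overload (8 * m) r (L j))\<^sup>2) \<le> int r * (3 * int m * (int (8 * m))\<^sup>2 * (int n)\<^sup>2)) \<and>
     (target_feasible h \<longrightarrow> ok)"

text \<open>With the greedy costs as weights, \<open>LP_solution_matching\<close> splits an LP
  solution into a part \<open>b\<close> served by big items and a rest whose cost fits into the
  scaled budget. The matching removes at least the cost that \<open>b\<close> removes, so the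
  unmatched players cost no more than the rest.\<close>

lemma round_check_passes:
  fixes z c p :: "nat \<Rightarrow> nat"
  assumes feas: "target_feasible h" and m: "0 < m"
    and greedy: "\<And>i. i < n \<Longrightarrow> greedy_spec h i z (G i) (c i)"
    and opt: "\<And>b. hall n m (big_edge h) b \<Longrightarrow> (\<Sum>i<n. b i * c i) \<le> (\<Sum>i\<in>{i. i < n \<and> p i \<noteq> 0}. real (c i))"
  shows "8 * m * (\<Sum>i<n. if p i = 0 then c i else 0) \<le> (8 * m - 1) * (\<Sum>j<m. z j)"
proof -
  obtain T x where x: "config_LP_solution {..<n} {..<m} \<Gamma> f T x" and T: "good_target h T"
    using feas by (auto simp: target_feasible_def config_LP_feasible_def)
  define \<rho> where "\<rho> = real (8 * m - 1) / real (8 * m)"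
  have "\<exists>b. hall n m (\<lambda>i j. j \<in> \<Gamma> i \<and> j \<in> big_items h) b \<and>
    (\<Sum>i<n. (1 - b i) * real (c i)) \<le> \<rho> * real (\<Sum>j<m. z j)"
  proof (rule LP_solution_matching[OF x])
    fix i C assume i: "i < n" and C: "C \<subseteq> \<Gamma> i" "C \<inter> big_items h = {}" "T \<le> f C"
    have "C \<subseteq> small_items h i" using C by (auto simp: small_items_def big_items_def)
    moreover have "good_target h (f C)"
    proof -
      have e1: "1 / exp 1 \<le> (1 :: real)" by simp
      have "greedy_factor * T \<le> greedy_factor * f C"
        using C(3) e1 by (intro mult_left_mono mult_nonneg_nonneg) auto
      then have "64 * real m * (greedy_factor * T)
          \<le> 64 * real m * (greedy_factor * f C)"
        by (rule mult_left_mono) simp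
      then show ?thesis using T unfolding good_target_def by linarith
    qed
    ultimately have "8 * m * c i \<le> (8 * m - 1) * sum z C" using greedy[OF i] by (simp add: greedy_spec_def)
    then have "real (8 * m) * real (c i) \<le> real (8 * m - 1) * real (sum z C)"
      by (simp only: of_nat_mult[symmetric] of_nat_le_iff)
    then show "real (c i) \<le> \<rho> * real (sum z C)" using m by (simp add: \<rho>_def field_simps)
  qed (auto simp: \<rho>_def)
  then obtain b where b: "hall n m (\<lambda>i j. j \<in> \<Gamma> i \<and> j \<in> big_items h) b"
    "(\<Sum>i<n. (1 - b i) * real (c i)) \<le> \<rho> * real (\<Sum>j<m. z j)" by blast
  have "{j. j < m \<and> (\<exists>i\<in>X. big_edge h i j)} = {j. j < m \<and> (\<exists>i\<in>X. j \<in> \<Gamma> i \<and> j \<in> big_items h)}"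
    if "X \<subseteq> {..<n}" for X
    using that by (auto simp: big_edge_def)
  then have "hall n m (big_edge h) b" using b(1) by (auto simp: hall_def)
  from opt[OF this] have o: "(\<Sum>i<n. b i * c i) \<le> (\<Sum>i\<in>{i. i < n \<and> p i \<noteq> 0}. real (c i))" .
  have "real (\<Sum>i<n. if p i = 0 then c i else 0) + (\<Sum>i\<in>{i. i < n \<and> p i \<noteq> 0}. real (c i)) = (\<Sum>i<n. real (c i))"
  proof -
    have "(\<Sum>i\<in>{i \<in> {..<n}. p i \<noteq> 0}. real (c i)) = (\<Sum>i<n. if p i \<noteq> 0 then real (c i) else 0)"
      by (rule sum.inter_filter) simp
    moreover have "{i \<in> {..<n}. p i \<noteq> 0} = {i. i < n \<and> p i \<noteq> 0}" by auto
    ultimately have "(\<Sum>i\<in>{i. i < n \<and> p i \<noteq> 0}. real (c i)) = (\<Sum>i<n. if p i \<noteq> 0 then real (c i) else 0)" by simp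
    then show ?thesis by (simp add: sum.distrib[symmetric] if_distrib cong: if_cong)
  qed
  moreover have "(\<Sum>i<n. (1 - b i) * real (c i)) = (\<Sum>i<n. real (c i)) - (\<Sum>i<n. b i * c i)"
    by (simp add: left_diff_distrib sum_subtractf)
  ultimately have "real (\<Sum>i<n. if p i = 0 then c i else 0) \<le> \<rho> * real (\<Sum>j<m. z j)" using o b(2) by linarith
  then have "real (8 * m) * real (\<Sum>i<n. if p i = 0 then c i else 0) \<le> real (8 * m - 1) * real (\<Sum>j<m. z j)"
    using m by (simp add: \<rho>_def field_simps del: of_nat_sum)
  then show ?thesis by (simp only: of_nat_mult[symmetric] of_nat_le_iff)
qed

lemma rounds_inv_step:
  fixes c p :: "nat \<Rightarrow> nat"
  assumes inv: "rounds_inv h r W L ok t" and m: "0 < m"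
    and greedy: "\<And>i. i < n \<Longrightarrow> greedy_spec h i (price r L) (G i) (c i)"
    and p: "\<And>i. i < n \<Longrightarrow> p i \<noteq> 0 \<Longrightarrow> big_edge h i (p i - 1)" "inj_on p {i. i < n \<and> p i \<noteq> 0}"
    and opt: "\<And>b. hall n m (big_edge h) b \<Longrightarrow> (\<Sum>i<n. b i * c i) \<le> (\<Sum>i\<in>{i. i < n \<and> p i \<noteq> 0}. real (c i))"
    and A: "\<And>i. A i = (if p i = 0 then G i else {p i - 1})"
    and W': "\<And>q. q < r * n \<Longrightarrow> W' q = W q" "\<And>i. i < n \<Longrightarrow> W' (r * n + i) = A i"
    and L': "\<And>j. L' j = L j + card {i. i < n \<and> p i = 0 \<and> j \<in> G i}"
    and t': "t' \<le> t" "\<And>i. i < n \<Longrightarrow> t' \<le> f (A i)" "t' = t \<or> (\<exists>i<n. t' = f (A i))"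
    and ok': "ok' \<longleftrightarrow> ok \<and> 8 * m * (\<Sum>i<n. if p i = 0 then c i else 0) \<le> (8 * m - 1) * (\<Sum>j<m. price r L j)"
  shows "rounds_inv h (Suc r) W' L' ok' t'"
proof -
  let ?z = "price r L"
  let ?l = "\<lambda>j. card {i. i < n \<and> p i = 0 \<and> j \<in> G i}"
  let ?x = "\<Sum>i<n. if p i = 0 then c i else 0"
  let ?Y = "\<Sum>j<m. ?z j"
  have Gs: "G i \<subseteq> small_items h i" if "i < n" for i using greedy[OF that] by (simp add: greedy_spec_def)
  have l_le: "?l j \<le> n" for j
    using card_mono[of "{..<n}" "{i. i < n \<and> p i = 0 \<and> j \<in> G i}"] by auto
  have split: "q < Suc r * n \<longleftrightarrow> q < r * n \<or> (\<exists>i<n. q = r * n + i)" for q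
    by (auto simp: less_diff_conv2 intro: exI[of _ "q - r * n"])
  have count: "card {q. q < Suc r * n \<and> j \<in> W' q} = card {q. q < r * n \<and> j \<in> W q} + card {i. i < n \<and> j \<in> A i}" for j
  proof -
    have "{q. q < Suc r * n \<and> j \<in> W' q} = {q. q < r * n \<and> j \<in> W q} \<union> (\<lambda>i. r * n + i) ` {i. i < n \<and> j \<in> A i}"
      by (rule set_eqI, simp only: mem_Collect_eq Un_iff image_iff split) (use W' in auto)
    moreover have "card ((\<lambda>i. r * n + i) ` {i. i < n \<and> j \<in> A i}) = card {i. i < n \<and> j \<in> A i}"
      by (rule card_image) simp
    moreover have "{q. q < r * n \<and> j \<in> W q} \<inter> (\<lambda>i. r * n + i) ` {i. i < n \<and> j \<in> A i} = {}" by auto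
    ultimately show ?thesis by (simp add: card_Un_disjoint)
  qed
  have mods: "(r * n + i) mod n = i" if "i < n" for i using that by simp
  have rows: "W' q \<subseteq> \<Gamma> (q mod n) \<and> t' \<le> f (W' q)" if q: "q < Suc r * n" for q
  proof (cases "q < r * n")
    case True
    then have "W q \<subseteq> \<Gamma> (q mod n) \<and> t \<le> f (W q)" using inv by (simp add: rounds_inv_def)
    then show ?thesis using True W'(1) t'(1) by auto
  next
    case False
    then obtain i where i: "i < n" "q = r * n + i" using split[of q] q by blast
    have "A i \<subseteq> \<Gamma> i" using Gs[OF i(1)] p(1)[OF i(1)] by (auto simp: A small_items_def big_edge_def)
    then show ?thesis using i W'(2) t'(2) by simp
  qed
  have loads: "if j \<in> big_items h then card {q. q < Suc r * n \<and> j \<in> W' q} \<le> Suc r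
      else card {q. q < Suc r * n \<and> j \<in> W' q} = L' j" if j: "j < m" for j
  proof (cases "j \<in> big_items h")
    case True
    have "j \<in> A i \<Longrightarrow> p i = Suc j" if "i < n" for i
      using Gs[OF that] True by (auto simp: A small_items_def big_items_def split: if_splits)
    then have "card {i. i < n \<and> j \<in> A i} \<le> card {Suc j}"
      using p(2) by (intro card_inj_on_le[of p]) (auto simp: inj_on_def)
    moreover have "card {q. q < r * n \<and> j \<in> W q} \<le> r" using inv True j by (simp add: rounds_inv_def)
    ultimately show ?thesis using True count by simp
  next
    case False
    have "j \<in> A i \<longleftrightarrow> p i = 0 \<and> j \<in> G i" if "i < n" for i
      using p(1)[OF that] False by (auto simp: A big_edge_def)
    then have "{i. i < n \<and> j \<in> A i} = {i. i < n \<and> p i = 0 \<and> j \<in> G i}" by auto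
    moreover have "card {q. q < r * n \<and> j \<in> W q} = L j" using inv False j by (simp add: rounds_inv_def)
    ultimately show ?thesis using False count L' by simp
  qed
  have Lb: "L' j \<le> n * Suc r" if "j < m" for j
  proof -
    have "L j \<le> n * r" using inv that by (simp add: rounds_inv_def)
    then show ?thesis using l_le[of j] by (simp add: L')
  qed
  have okp: "h \<le> 64 * real m * t' \<and>
      (\<Sum>j<m. (overload (8 * m) (Suc r) (L' j))\<^sup>2) \<le> int (Suc r) * (3 * int m * (int (8 * m))\<^sup>2 * (int n)\<^sup>2)"
    if "ok'"
  proof
    have ok: ok and chk: "8 * m * ?x \<le> (8 * m - 1) * ?Y" using that ok' by auto
    have ht: "h \<le> 64 * real m * t" and pot:
      "(\<Sum>j<m. (overload (8 * m) r (L j))\<^sup>2) \<le> int r * (3 * int m * (int (8 * m))\<^sup>2 * (int n)\<^sup>2)"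
      using inv ok by (auto simp: rounds_inv_def)
    have fin: "h \<le> 64 * real m * f (G i) \<and> c i = sum ?z (G i)" if i: "i < n" "p i = 0" for i
    proof -
      \<comment> \<open>The penalty of even one unmatched player exceeds the budget of the
        check.\<close>
      have "c i \<noteq> ?Y + 1"
      proof
        assume eq: "c i = ?Y + 1"
        have "c i \<le> ?x" using member_le_sum[of i "{..<n}" "\<lambda>i. if p i = 0 then c i else 0"] i by simp
        then have "8 * m * (?Y + 1) \<le> 8 * m * ?x" using eq by (intro mult_left_mono) auto
        also have "\<dots> \<le> (8 * m - 1) * ?Y" by (rule chk)
        also have "\<dots> \<le> 8 * m * ?Y" by (intro mult_right_mono) auto
        finally show False using m by simp
      qed
      then show ?thesis using greedy[OF i(1)] by (auto simp: greedy_spec_def)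
    qed
    have "h \<le> 64 * real m * f (A i)" if i: "i < n" for i
      using fin[OF i] p(1)[OF i] by (auto simp: A big_edge_def big_items_def)
    then show "h \<le> 64 * real m * t'" using t'(3) ht by auto
    \<comment> \<open>Double counting: the cost of the unmatched players is summed item by
      item.\<close>
    have xs: "(\<Sum>j<m. ?z j * ?l j) = ?x"
    proof -
      have "(\<Sum>j<m. ?z j * ?l j) = (\<Sum>j<m. \<Sum>i<n. if p i = 0 \<and> j \<in> G i then ?z j else 0)"
      proof (intro sum.cong refl)
        fix j
        have "(\<Sum>i<n. if p i = 0 \<and> j \<in> G i then ?z j else 0) = (\<Sum>i\<in>{i \<in> {..<n}. p i = 0 \<and> j \<in> G i}. ?z j)"
          by (rule sum.inter_filter[symmetric]) simp
        also have "{i \<in> {..<n}. p i = 0 \<and> j \<in> G i} = {i. i < n \<and> p i = 0 \<and> j \<in> G i}" by auto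
        finally show "?z j * ?l j = (\<Sum>i<n. if p i = 0 \<and> j \<in> G i then ?z j else 0)" by (simp add: mult.commute)
      qed
      also have "\<dots> = (\<Sum>i<n. \<Sum>j<m. if p i = 0 \<and> j \<in> G i then ?z j else 0)" by (rule sum.swap)
      also have "\<dots> = ?x"
      proof (intro sum.cong refl)
        fix i assume "i \<in> {..<n}"
        then have i: "i < n" by simp
        have Gm: "G i \<subseteq> {..<m}" using Gs[OF i] small_items_sub[OF i] by blast
        have "(\<Sum>j<m. if j \<in> G i then ?z j else 0) = sum ?z ({..<m} \<inter> G i)" by (simp add: sum.inter_restrict)
        also have "{..<m} \<inter> G i = G i" using Gm by auto
        finally show "(\<Sum>j<m. if p i = 0 \<and> j \<in> G i then ?z j else 0) = (if p i = 0 then c i else 0)"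
          using fin[OF i] by auto
      qed
      finally show ?thesis .
    qed
    show "(\<Sum>j<m. (overload (8 * m) (Suc r) (L' j))\<^sup>2) \<le> int (Suc r) * (3 * int m * (int (8 * m))\<^sup>2 * (int n)\<^sup>2)"
    \<comment> \<open>The square step presupposes a player; without players all loads and overloads
      vanish.\<close>
    proof (cases "n = 0")
      case True
      have "overload (8 * m) (Suc r) (L' j) = 0" if "j < m" for j
        using Lb[OF that] True m by (simp add: overload_def)
      then show ?thesis using True by simp
    next
      case False
      have "int (8 * m) * (\<Sum>j<m. (1 + overload (8 * m) r (L j)) * int (?l j)) = int (8 * m * ?x)"
        unfolding xs[symmetric] by (simp add: int_price)
      also have "\<dots> \<le> int ((8 * m - 1) * ?Y)" using chk by (simp only: of_nat_le_iff)
      also have "\<dots> = (int (8 * m) - 1) * (\<Sum>j<m. 1 + overload (8 * m) r (L j))"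
        using m by (simp add: int_price of_nat_diff)
      finally have "(\<Sum>j<m. (overload (8 * m) (Suc r) (L j + ?l j))\<^sup>2)
          \<le> (\<Sum>j<m. (overload (8 * m) r (L j))\<^sup>2) + 3 * int m * (int (8 * m))\<^sup>2 * (int n)\<^sup>2"
        using m False l_le by (intro sum_overload_square_step) auto
      also have "\<dots> \<le> int r * (3 * int m * (int (8 * m))\<^sup>2 * (int n)\<^sup>2) + 3 * int m * (int (8 * m))\<^sup>2 * (int n)\<^sup>2"
        using pot by simp
      finally show ?thesis unfolding L' by (simp add: algebra_simps)
    qed
  qed
  have "ok'" if "target_feasible h"
    using round_check_passes[OF that m greedy opt] inv that ok' by (simp add: rounds_inv_def)
  then show ?thesis unfolding rounds_inv_def using Lb rows loads okp by blast
qed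

lemma sum_price_le: "(\<And>j. j < m \<Longrightarrow> L j \<le> n * N) \<Longrightarrow> (\<Sum>j<m. price r L j) + 1 \<le> cost_bound n m"
  using sum_bounded_above[of "{..<m}" "price r L" "price_bound n m"] price_le
  by (simp add: cost_bound_def)

definition min_value :: "real \<Rightarrow> (nat \<Rightarrow> nat set) \<Rightarrow> nat \<Rightarrow> real \<Rightarrow> bool" where
  "min_value t A k t' \<longleftrightarrow> t' \<le> t \<and> (\<forall>i<k. t' \<le> f (A i)) \<and> (t' = t \<or> (\<exists>i<k. t' = f (A i)))"

lemma round_wp:
  assumes env: "env h s" and m: "0 < m" and r: "r < N" "ints s ''r'' 0 = int r"
    and L: "holds m (ints s ''L'') L" and W: "\<And>q. q < r * n \<Longrightarrow> row s q (W q)"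
    and inv: "rounds_inv h r W L (ints s ''O'' 0 \<noteq> 0) (reals s ''t'' 0)"
  shows "wp f M round_prog (\<lambda>s'. \<exists>W L. holds m (ints s' ''L'') L \<and> (\<forall>q<Suc r * n. row s' q (W q)) \<and>
    rounds_inv h (Suc r) W L (ints s' ''O'' 0 \<noteq> 0) (reals s' ''t'' 0) \<and>
    (ints s' ''O'' 0 = ints s ''O'' 0 \<or> ints s' ''O'' 0 = 0)) s"
proof -
  let ?z = "price r L"
  let ?Y = "\<Sum>j<m. ?z j"
  let ?t = "reals s ''t'' 0"
  have Lr: "L j \<le> n * r" if "j < m" for j using inv that by (simp add: rounds_inv_def)
  have LN: "L j \<le> n * N" if "j < m" for j
    using Lr[OF that] r(1) by (meson less_imp_le mult_le_mono2 order_trans)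
  have zpos: "0 < ?z j" for j by (rule price_pos)
  have Yc: "?Y + 1 \<le> cost_bound n m" by (rule sum_price_le[OF LN])
  then have YM: "?Y + 1 \<le> M" using M_bounds(11) by linarith
  have L': "ints s ''L'' (int j) = int (L j)" if "j < m" for j using L that by (simp add: holds_def)
  show ?thesis unfolding round_prog_def
  proof (rule wp_Seq, rule wp_frame[OF prices_wp[OF env r(2) L' LN]], assumption, assumption, rule wp_Seq, goal_cases)
    case (1 s1)
    note ag1 = 1(1)
    have z1: "\<And>j. j < m \<Longrightarrow> ints s1 ''z'' (int j) = int (?z j)" "ints s1 ''y'' 0 = int ?Y" using 1(2) by auto
    have v1: "env h s1" "ints s1 ''r'' 0 = int r" "ints s1 ''L'' = ints s ''L''" "ints s1 ''W'' = ints s ''W''"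
      "ints s1 ''O'' = ints s ''O''" "reals s1 ''t'' 0 = ?t"
      using env_agree[OF env ag1] agree_ints[OF ag1] agree_reals[OF ag1] r by simp_all
    let ?I = "\<lambda>k s'. (\<forall>q<r * n. row s' q (W q)) \<and> (\<forall>i<k. \<exists>G c. greedy_spec h i ?z G c \<and>
       row s' (r * n + i) G \<and> ints s' ''C'' (int i) = int c \<and> reals s' ''w'' (int i) = f G)"
    show ?case
    proof (rule wp_For[where I = ?I and N = n], goal_cases _ _ init step expr fin)
      case init
      then show ?case using W v1(4) by simp
    next
      case (step k s')
      have v2: "env h s'" "ints s' ''r'' 0 = int r" "ints s' ''y'' 0 = int ?Y"
        "\<And>j. j < m \<Longrightarrow> ints s' ''z'' (int j) = int (?z j)"
        using env_agree[OF v1(1) step(4)] agree_ints[OF step(4)] v1 z1 by simp_all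
      show ?case
      proof (rule wp_mono[OF greedy_wp[OF v2(1) step(1,3) v2(2) v2(4) zpos YM v2(3)]], assumption, goal_cases)
        case (1 s'')
        then obtain G cst where g: "greedy_spec h k ?z G cst" "row s'' (r * n + k) G"
          "\<And>q A. q \<noteq> r * n + k \<Longrightarrow> row s' q A \<Longrightarrow> row s'' q A"
          "ints s'' ''C'' = (ints s' ''C'')(int k := int cst)" "reals s'' ''w'' = (reals s' ''w'')(int k := f G)"
          by blast
        have "\<exists>G c. greedy_spec h i ?z G c \<and> row s'' (r * n + i) G \<and> ints s'' ''C'' (int i) = int c \<and>
            reals s'' ''w'' (int i) = f G" if "i < Suc k" for i
        proof (cases "i = k")
          case True
          then show ?thesis using g(1,2,4,5) by auto
        next
          case False
          then have "i < k" using that by simp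
          then obtain G' c' where "greedy_spec h i ?z G' c'" "row s' (r * n + i) G'" "ints s' ''C'' (int i) = int c'"
            "reals s' ''w'' (int i) = f G'" using step(2) by blast
          then show ?thesis using False g(3)[of "r * n + i" G'] g(4,5) by (intro exI[of _ G'] exI[of _ c']) simp
        qed
        moreover have "row s'' q (W q)" if "q < r * n" for q using step(2) that g(3)[of q] by simp
        ultimately show "?I (Suc k) (iupdate ''i'' 0 (int (Suc k)) s'')" by simp
      qed
    next
      case (fin s2)
      have "\<forall>i. \<exists>G c. i < n \<longrightarrow> greedy_spec h i ?z G c \<and>
         row s2 (r * n + i) G \<and> ints s2 ''C'' (int i) = int c \<and> reals s2 ''w'' (int i) = f G"
        using fin(1) by blast
      then obtain G c where gc: "\<And>i. i < n \<Longrightarrow> greedy_spec h i ?z (G i) (c i)"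
        "\<And>i. i < n \<Longrightarrow> row s2 (r * n + i) (G i)" "\<And>i. i < n \<Longrightarrow> ints s2 ''C'' (int i) = int (c i)"
        "\<And>i. i < n \<Longrightarrow> reals s2 ''w'' (int i) = f (G i)" by metis
      have v2: "env h s2" "ints s2 ''r'' 0 = int r" "ints s2 ''y'' 0 = int ?Y" "ints s2 ''L'' = ints s ''L''"
        "ints s2 ''O'' = ints s ''O''" "reals s2 ''t'' 0 = ?t"
        using env_agree[OF v1(1) fin(2)] agree_ints[OF fin(2)] agree_reals[OF fin(2)] v1 z1 by simp_all
      have W2: "row s2 q (W q)" if "q < r * n" for q using fin(1) that by blast
      have cb: "c i \<le> cost_bound n m" if "i < n" for i
        using gc(1)[OF that] Yc by (simp add: greedy_spec_def)
      then have cM: "c i \<le> M" if "i < n" for i using that M_bounds(11) by (meson order_trans)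
      have hc: "holds n (ints s2 ''C'') c" using gc(3) by (simp add: holds_def)
      show ?case
      proof (rule wp_Seq, rule wp_frame[OF matching_wp[OF v2(1) hc cM]], assumption, goal_cases)
        case (1 s3)
        note ag3 = 1(1)
        from 1(2) obtain p where p: "holds n (ints s3 ''p'') p" "\<And>i. i < n \<Longrightarrow> p i \<noteq> 0 \<Longrightarrow> big_edge h i (p i - 1)"
          "inj_on p {i. i < n \<and> p i \<noteq> 0}" "\<And>b. hall n m (big_edge h) b \<Longrightarrow>
            (\<Sum>i<n. b i * c i) \<le> (\<Sum>i\<in>{i. i < n \<and> p i \<noteq> 0}. real (c i))" by blast
        have v3: "env h s3" "ints s3 ''r'' 0 = int r" "ints s3 ''y'' 0 = int ?Y" "ints s3 ''L'' = ints s ''L''"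
          "ints s3 ''O'' = ints s ''O''" "reals s3 ''t'' 0 = ?t" "ints s3 ''C'' = ints s2 ''C''" "reals s3 ''w'' = reals s2 ''w''"
          "ints s3 ''W'' = ints s2 ''W''"
          using env_agree[OF v2(1) ag3] agree_ints[OF ag3] agree_reals[OF ag3] v2 by simp_all
        define A where "A = (\<lambda>i. if p i = 0 then G i else {p i - 1})"
        define Lk where "Lk = (\<lambda>k j. L j + card {i. i < k \<and> p i = 0 \<and> j \<in> G i})"
        define xk where "xk = (\<lambda>k. \<Sum>i<k. if p i = 0 then c i else 0)"
        have Lk_less: "Lk k j < M" if "j < m" "k < n" for j k
        proof -
          have "card {i. i < k \<and> p i = 0 \<and> j \<in> G i} \<le> card {..<k}" by (intro card_mono) auto
          then have "Lk k j < n * r + n" using that Lr[OF that(1)] by (simp add: Lk_def)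
          also have "\<dots> = n * Suc r" by simp
          also have "\<dots> \<le> n * N" using r(1) by (intro mult_le_mono2) simp
          also have "\<dots> \<le> M" by (rule M_bounds(9))
          finally show ?thesis .
        qed
        have Lk_Suc: "Lk (Suc k) j = Lk k j + (if p k = 0 \<and> j \<in> G k then 1 else 0)" for k j
        proof -
          have "{i. i < Suc k \<and> p i = 0 \<and> j \<in> G i} = (if p k = 0 \<and> j \<in> G k
              then insert k {i. i < k \<and> p i = 0 \<and> j \<in> G i} else {i. i < k \<and> p i = 0 \<and> j \<in> G i})"
            by (auto simp: less_Suc_eq)
          then show ?thesis by (simp add: Lk_def)
        qed
        \<comment> \<open>Players below \<open>k\<close> already hold their final sets; the others
          still hold their greedy sets, which \<open>assign_prog\<close> reads from the same
          rows.\<close>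
        let ?J = "\<lambda>k s'. (\<forall>q<r * n. row s' q (W q)) \<and> (\<forall>i<k. row s' (r * n + i) (A i)) \<and>
          (\<forall>i<n. k \<le> i \<longrightarrow> row s' (r * n + i) (G i) \<and> reals s' ''w'' (int i) = f (G i)) \<and>
          holds m (ints s' ''L'') (Lk k) \<and> ints s' ''X'' 0 = int (xk k) \<and> min_value ?t A k (reals s' ''t'' 0)"
        show ?case
        proof (intro wp_Seq wp_IAssign, goal_cases _ loop)
          case loop
          show ?case
          proof (rule wp_For[where I = ?J and N = n], goal_cases _ _ init step expr fin)
            case init
            then show ?case using W2 gc v3 L by (simp add: Lk_def xk_def min_value_def)
          next
            case (step k s')
            have v4: "env h s'" "ints s' ''r'' 0 = int r" "ints s' ''p'' (int k) = int (p k)" "ints s' ''C'' (int k) = int (c k)"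
              using env_agree[OF _ step(4)] agree_ints[OF step(4)] v3 p(1) gc(3) step(1) by (simp_all add: holds_def)
            have pk: "p k \<le> m" using p(2)[OF step(1)] by (cases "p k") (auto simp: big_edge_def)
            have xc: "xk k + c k \<le> M"
            proof -
              have "xk k \<le> k * cost_bound n m"
                unfolding xk_def using sum_bounded_above[of "{..<k}" "\<lambda>i. if p i = 0 then c i else 0" "cost_bound n m"]
                  cb step(1) by simp
              then have "xk k + c k \<le> Suc k * cost_bound n m" using cb[OF step(1)] by simp
              also have "\<dots> \<le> n * cost_bound n m" using step(1) by (intro mult_le_mono1) simp
              finally show ?thesis using M_bounds(12) by linarith
            qed
            have J: "row s' (r * n + k) (G k)" "reals s' ''w'' (int k) = f (G k)" "holds m (ints s' ''L'') (Lk k)"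
              "ints s' ''X'' 0 = int (xk k)"
              using step(1,2) by auto
            show ?case
            proof (rule wp_mono[OF assign_wp[OF v4(1) step(1,3) v4(2) J(1) v4(3) pk J(3) Lk_less[OF _ step(1)] J(4) v4(4) xc J(2) refl]],
                assumption, goal_cases)
              case (1 s'')
              have a: "row s'' (r * n + k) (A k)" "\<And>q B. q \<noteq> r * n + k \<Longrightarrow> row s' q B \<Longrightarrow> row s'' q B"
                "holds m (ints s'' ''L'') (Lk (Suc k))" "ints s'' ''X'' 0 = int (xk (Suc k))"
                "reals s'' ''t'' 0 = min (reals s' ''t'' 0) (f (A k))"
                "\<And>i. i \<noteq> k \<Longrightarrow> reals s'' ''w'' (int i) = reals s' ''w'' (int i)"
                using 1 by (auto simp: A_def Lk_Suc[abs_def] xk_def)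
              have "row s'' q (W q)" if "q < r * n" for q using a(2)[of q] that step(2) by simp
              moreover have "row s'' (r * n + i) (A i)" if "i < Suc k" for i
                using a(1) a(2)[of "r * n + i" "A i"] that step(2) by (cases "i = k") auto
              moreover have "row s'' (r * n + i) (G i) \<and> reals s'' ''w'' (int i) = f (G i)" if "i < n" "Suc k \<le> i" for i
                using a(2)[of "r * n + i" "G i"] a(6)[of i] that step(2) by auto
              moreover have "min_value ?t A (Suc k) (reals s'' ''t'' 0)"
                using step(2) unfolding a(5) min_value_def by (auto simp: less_Suc_eq min_def)
              ultimately show ?case using a(3,4) by simp
            qed
          next
            case (fin s4)
            have v5: "ints s4 ''m'' 0 = int m" "ints s4 ''y'' 0 = int ?Y" "ints s4 ''O'' = ints s ''O''"
              using agree_ints[OF fin(2)] v3 env_simps[OF v3(1)] by simp_all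
            have X5: "ints s4 ''X'' 0 = int (xk n)" and t5: "min_value ?t A n (reals s4 ''t'' 0)" and L5: "holds m (ints s4 ''L'') (Lk n)"
              using fin(1) by auto
            define W' where "W' = (\<lambda>q. if q < r * n then W q else A (q - r * n))"
            have rows: "row s4 q (W' q)" if "q < Suc r * n" for q
            proof (cases "q < r * n")
              case False
              then have eq: "r * n + (q - r * n) = q" and lt: "q - r * n < n" using that by auto
              have "row s4 (r * n + (q - r * n)) (A (q - r * n))" using fin(1) lt by blast
              then show ?thesis unfolding eq using False by (simp add: W'_def)
            qed (use fin(1) in \<open>simp add: W'_def\<close>)
            have cond: "(8 * int m - 1) * int ?Y < 8 * int m * int (xk n) \<longleftrightarrow> \<not> 8 * m * xk n \<le> (8 * m - 1) * ?Y"
            proof -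
              have "(8 * int m - 1) * int ?Y = int ((8 * m - 1) * ?Y)" "8 * int m * int (xk n) = int (8 * m * xk n)"
                using m by (simp_all add: of_nat_diff)
              then show ?thesis by (simp only: of_nat_less_iff not_le)
            qed
            have ri: "rounds_inv h (Suc r) W' (Lk n) ok' (reals s4 ''t'' 0)"
              if "ok' \<longleftrightarrow> ints s ''O'' 0 \<noteq> 0 \<and> 8 * m * xk n \<le> (8 * m - 1) * ?Y" for ok'
              by (rule rounds_inv_step[OF inv m gc(1) p(2-4)])
                (use t5 that in \<open>auto simp: A_def W'_def Lk_def xk_def min_value_def\<close>)
            show ?case
            proof (intro wp_Cond wp_IAssign wp_Skip, goal_cases _ T F)
              case T
              then have "\<not> 8 * m * xk n \<le> (8 * m - 1) * ?Y" using cond v5 X5 by simp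
              then have "rounds_inv h (Suc r) W' (Lk n) False (reals s4 ''t'' 0)" by (intro ri) simp
              then show ?case using L5 rows by (intro exI[of _ W'] exI[of _ "Lk n"]) simp
            next
              case F
              then have "8 * m * xk n \<le> (8 * m - 1) * ?Y" using cond v5 X5 by simp
              then have "rounds_inv h (Suc r) W' (Lk n) (ints s4 ''O'' 0 \<noteq> 0) (reals s4 ''t'' 0)"
                by (intro ri) (simp add: v5)
              then show ?case using L5 rows v5(3) by auto
            qed simp
          qed (use M_bounds env_simps[OF v3(1)] in \<open>simp_all add: agree_ints\<close>)
        qed simp
      qed
    qed (use M_bounds env_simps[OF v1(1)] in \<open>simp_all add: agree_ints\<close>)
  qed
qed

lemma try_target_wp:
  assumes env: "env h s" and m: "0 < m" and h: "0 \<le> h"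
  shows "wp f M try_target_prog (\<lambda>s'. (target_feasible h \<longrightarrow> ints s' ''O'' 0 \<noteq> 0) \<and> 0 \<le> ints s' ''O'' 0 \<and>
    (ints s' ''O'' 0 \<noteq> 0 \<longrightarrow> h \<le> 64 * real m * reals s' ''t'' 0 \<and>
      (\<exists>W. (\<forall>q<N * n. row s' q (W q)) \<and> valid_rows N (reals s' ''t'' 0) W))) s"
  unfolding try_target_prog_def
proof (rule wp_Seq, rule wp_For[where I = "\<lambda>k s'. \<forall>j<k. ints s' ''L'' (int j) = 0" and N = m],
    goal_cases _ _ init step expr fin)
  case (step k s')
  then show ?case using M_bounds by (intro wp_intros) (auto simp: less_Suc_eq)
next
  case (fin s1)
  have v1: "env h s1" "ints s1 ''N'' 0 = int N" "reals s1 ''h'' 0 = h"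
    using env_agree[OF env fin(2)] agree_ints[OF fin(2)] agree_reals[OF fin(2)] env_simps[OF env] by simp_all
  show ?case
  proof (intro wp_Seq wp_IAssign wp_RAssign, goal_cases _ loop)
    case loop
    let ?I = "\<lambda>r s'. 0 \<le> ints s' ''O'' 0 \<and> (\<exists>W L. holds m (ints s' ''L'') L \<and> (\<forall>q<r * n. row s' q (W q)) \<and>
      rounds_inv h r W L (ints s' ''O'' 0 \<noteq> 0) (reals s' ''t'' 0))"
    show ?case
    proof (rule wp_For[where I = ?I and N = N], goal_cases _ _ init step expr fin)
      case init
      \<comment> \<open>The running minimum \<open>t\<close> starts at \<open>h\<close>, not at the
        target \<open>h / (64 * m)\<close>: any start at or above the target is harmless, and
        without players this value remains.\<close>
      have "1 * h \<le> 64 * real m * h" using m h by (intro mult_right_mono) auto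
      then have "rounds_inv h 0 (\<lambda>_. {}) (\<lambda>_. 0) True h" by (simp add: rounds_inv_def overload_def)
      then show ?case using fin(1) v1 by (auto intro!: exI[of _ "\<lambda>_. 0"] simp: holds_def)
    next
      case (step r s')
      then obtain W L where WL: "holds m (ints s' ''L'') L" "\<And>q. q < r * n \<Longrightarrow> row s' q (W q)"
        "rounds_inv h r W L (ints s' ''O'' 0 \<noteq> 0) (reals s' ''t'' 0)" by blast
      have e: "env h s'" using env_agree[OF _ step(4)] v1 by simp
      show ?case
        by (rule wp_mono[OF round_wp[OF e m step(1,3) WL]], assumption) (use step(2) in auto)
    next
      case (fin s')
      then obtain W L where W: "\<forall>q<N * n. row s' q (W q)"
        "rounds_inv h N W L (ints s' ''O'' 0 \<noteq> 0) (reals s' ''t'' 0)" by blast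
      have "valid_rows N (reals s' ''t'' 0) W" if "ints s' ''O'' 0 \<noteq> 0"
      proof -
        have "(\<Sum>j<m. (overload (8 * m) N (L j))\<^sup>2) \<le> int N * (3 * int m * (int (8 * m))\<^sup>2 * (int n)\<^sup>2)"
          using W(2) that by (simp add: rounds_inv_def)
        also have "3 * int m * (int (8 * m))\<^sup>2 * (int n)\<^sup>2 \<le> int N"
          by (simp add: rounds_def power2_eq_square)
        finally have "(\<Sum>j<m. (overload (8 * m) N (L j))\<^sup>2) \<le> (int N)\<^sup>2"
          by (simp add: power2_eq_square mult_left_mono)
        then have "L j \<le> N" if "j < m" for j
          using load_le_of_sum_overload_square[of "8 * m" N L m j] that m by simp
        then show ?thesis using W(2) by (fastforce simp: valid_rows_def rounds_inv_def split: if_splits)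
      qed
      then show ?case using fin(1) W by (auto simp: rounds_inv_def)
    qed (use v1 M_bounds in \<open>simp_all add: agree_ints\<close>)
  qed (use M_bounds in simp)
qed (use M_bounds env_simps[OF env] in \<open>simp_all add: agree_ints\<close>)


section \<open>Choice of the target\<close>

definition output_ok :: "state \<Rightarrow> bool" where
  "output_ok s \<longleftrightarrow> 0 \<le> reals s ''T'' 0 \<and>
     (\<exists>W. (\<forall>q<N * n. segment_set s ''config'' (int (q * m)) (int m) = W q) \<and> valid_rows N (reals s ''T'' 0) W)"

lemma output_ok_cong:
  assumes "ints s' ''config'' = ints s ''config''" "reals s' ''T'' = reals s ''T''"
  shows "output_ok s' \<longleftrightarrow> output_ok s"
  using assms by (simp add: output_ok_def segment_set_def)

lemma keep_best_wp:
  assumes env: "env h s" and out: "output_ok s"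
    and O: "ints s ''O'' 0 \<noteq> 0 \<Longrightarrow> \<exists>W. (\<forall>q<N * n. row s q (W q)) \<and> valid_rows N (reals s ''t'' 0) W"
      "0 \<le> ints s ''O'' 0"
  shows "wp f M keep_best_prog (\<lambda>s'. output_ok s' \<and> reals s ''T'' 0 \<le> reals s' ''T'' 0 \<and>
    (ints s ''O'' 0 \<noteq> 0 \<longrightarrow> reals s ''t'' 0 \<le> reals s' ''T'' 0)) s"
  unfolding keep_best_prog_def
proof (rule wp_Cond, goal_cases T F)
  case T
  then have T: "ints s ''O'' 0 \<noteq> 0" "reals s ''T'' 0 < reals s ''t'' 0" by auto
  obtain W where W: "\<And>q. q < N * n \<Longrightarrow> row s q (W q)" "valid_rows N (reals s ''t'' 0) W"
    using O(1)[OF T(1)] by blast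
  show ?case
  proof (rule wp_Seq, rule wp_For[where N = "N * n * m" and
        I = "\<lambda>k s'. \<forall>a<k. ints s' ''config'' (int a) = ints s ''W'' (int a)"], goal_cases _ _ init step expr fin)
    case (step k s')
    have W: "ints s' ''W'' = ints s ''W''" using agree_ints[OF step(4)] by simp
    show ?case
    proof (intro wp_intros, goal_cases bound fin)
      case bound
      then have "\<bar>ints s' ''W'' (int k)\<bar> \<le> int M" unfolding bnd_def by blast
      then show ?case using step(3) by simp
    next
      case fin
      then show ?case using step(2,3) W by (auto simp: less_Suc_eq)
    qed
  next
    case (fin s')
    have t: "reals s' = reals s" using agree_reals[OF fin(2)] by (simp add: fun_eq_iff)
    have "segment_set s' ''config'' (int (q * m)) (int m) = W q" if q: "q < N * n" for q
    proof -
      have "ints s' ''config'' (int (q * m) + int j) = (if j \<in> W q then 1 else 0)" if "j < m" for j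
      proof -
        have "q * m + j < Suc q * m" using that by simp
        also have "\<dots> \<le> N * n * m" using q by (intro mult_le_mono1) simp
        finally have "ints s' ''config'' (int (q * m + j)) = ints s ''W'' (int (q * m + j))" using fin(1) by blast
        then show ?thesis using W(1)[OF q] that by (simp add: indicates_def)
      qed
      then show ?thesis using W(1)[OF q] by (auto simp: segment_set_def indicates_def split: if_splits)
    qed
    then have "output_ok (rupdate ''T'' 0 (reals s ''t'' 0) s')"
      using W(2) T(2) out by (auto simp: output_ok_def segment_set_def)
    then show ?case using t T(2) by (intro wp_RAssign) simp
  qed (use M_bounds env_simps[OF env] in \<open>simp_all add: agree_ints\<close>)
next
  case F
  then have "ints s ''O'' 0 \<noteq> 0 \<Longrightarrow> reals s ''t'' 0 \<le> reals s ''T'' 0" using O(2) by auto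
  then show ?case using out by (intro wp_Skip) auto
qed

definition header_ok :: "state \<Rightarrow> bool" where
  "header_ok s \<longleftrightarrow> ints s ''length'' 0 = int (N * n) \<and> (\<forall>q<N * n. ints s ''player'' (int q) = int (q mod n) \<and>
     ints s ''num'' (int q) = 1 \<and> ints s ''den'' (int q) = int N)"

lemma header_ok_cong:
  assumes "ints s' ''length'' = ints s ''length''" "ints s' ''player'' = ints s ''player''"
    "ints s' ''num'' = ints s ''num''" "ints s' ''den'' = ints s ''den''"
  shows "header_ok s' \<longleftrightarrow> header_ok s"
  using assms by (simp add: header_ok_def)

lemma bnd_input: "bnd M (input_state n m \<Gamma>)"
  using M_bounds by (auto simp: bnd_def input_state_def)

text \<open>Empty rows have value 0 and cause no load, so the initial state already represents a
  solution for \<open>T = 0\<close>, which remains if no target is accepted.\<close>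

lemma output_ok_input:
  assumes "ints s ''config'' = ints (input_state n m \<Gamma>) ''config''" "reals s ''T'' = reals (input_state n m \<Gamma>) ''T''"
  shows "output_ok s"
  unfolding output_ok_def
proof (intro conjI exI[of _ "\<lambda>_. {}"] allI impI)
  show "0 \<le> reals s ''T'' 0" using assms by (simp add: input_state_def)
  show "segment_set s ''config'' (int (q * m)) (int m) = {}" for q
    using assms by (simp add: segment_set_def input_state_def)
  show "valid_rows N (reals s ''T'' 0) (\<lambda>_. {})" using assms by (simp add: valid_rows_def input_state_def)
qed

lemma rounds_int: "1 + 192 * int m * int m * int m * int n * int n = int N"
  by (simp add: rounds_def)

lemma setup_wp: "wp f M setup_prog (\<lambda>s'. env 0 s' \<and> header_ok s' \<and> output_ok s') (input_state n m \<Gamma>)"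
  unfolding setup_prog_def
proof (intro wp_Seq wp_IAssign, goal_cases _ _ loop)
  case loop
  let ?s0 = "input_state n m \<Gamma>"
  have i0: "ints ?s0 ''n'' 0 = int n" "ints ?s0 ''m'' 0 = int m" "ints ?s0 ''G'' = (\<lambda>_. 0)" "reals ?s0 = (\<lambda>_ _. 0)"
    by (auto simp: input_state_def)
  have Gam: "ints ?s0 ''Gamma'' (int i * int m + int j) = (if j \<in> \<Gamma> i then 1 else 0)" if "i < n" "j < m" for i j
  proof -
    have "(\<exists>i'<n. \<exists>j'<m. j' \<in> \<Gamma> i' \<and> int i * int m + int j = int (i' * m + j')) \<longleftrightarrow> j \<in> \<Gamma> i"
      using that cell_eq_iff[OF that(2)] by auto
    then show ?thesis by (simp add: input_state_def)
  qed
  let ?I = "\<lambda>k s'. \<forall>q<k. ints s' ''player'' (int q) = int (q mod n) \<and>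
     ints s' ''num'' (int q) = 1 \<and> ints s' ''den'' (int q) = int N"
  show ?case
  proof (rule wp_For[where I = ?I and N = "N * n"], goal_cases _ _ init step expr fin)
    case (step k s')
    have v: "ints s' ''n'' 0 = int n" "ints s' ''N'' 0 = int N"
      using agree_ints[OF step(4)] i0 by (simp_all add: rounds_int)
    have "0 < n" using step(1) by (cases n) auto
    then have "k mod n \<le> M" using M_bounds(2) mod_less_divisor[of n k] by linarith
    then have md: "int (k mod n) \<le> int M" "int k - int n * (int k div int n) = int (k mod n)"
      by (simp only: of_nat_le_iff) (simp add: minus_mult_div_eq_mod zmod_int)
    show ?case
      by (intro wp_intros)
        (use step(2,3) v md M_bounds in \<open>simp_all add: less_Suc_eq del: of_nat_mod\<close>)
  next
    case (fin s1)
    have v1: "ints s1 ''n'' 0 = int n" "ints s1 ''m'' 0 = int m" "ints s1 ''N'' 0 = int N" "ints s1 ''length'' 0 = int (N * n)"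
      "ints s1 ''G'' = (\<lambda>_. 0)" "ints s1 ''Gamma'' = ints ?s0 ''Gamma''" "ints s1 ''config'' = ints ?s0 ''config''"
      "reals s1 = reals ?s0"
      using agree_ints[OF fin(2)] agree_reals[OF fin(2)] i0 by (simp_all add: rounds_int fun_eq_iff)
    note hdr = fin(1)
    show ?case
    proof (rule wp_For[where I = "\<lambda>k s'. indicates m (ints s' ''G'') {} \<and> (\<forall>j<k. reals s' ''s'' (int j) = f {j})" and N = m],
        goal_cases _ _ init step expr fin)
      case init
      then show ?case using v1 by (simp add: indicates_def)
    next
      case (step k s')
      have vm: "ints s' ''m'' 0 = int m" using agree_ints[OF step(4)] v1 by simp
      have G: "indicates m (ints s' ''G'') {}" using step(2) by simp
      have "segment_set (iupdate ''G'' (int k) 1 s') ''G'' 0 (int m) = {k}"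
        using indicates_insert[OF G step(1)] by (intro indicates_segment_set) simp
      then show ?case
        by (intro wp_intros)
          (use step(2,3) vm M_bounds indicates_remove[OF G step(1)] in \<open>simp_all add: less_Suc_eq\<close>)
    next
      case (fin s2)
      have v2: "ints s2 ''n'' 0 = int n" "ints s2 ''m'' 0 = int m" "ints s2 ''N'' 0 = int N" "ints s2 ''length'' 0 = int (N * n)"
        "ints s2 ''Gamma'' = ints ?s0 ''Gamma''" "ints s2 ''config'' = ints ?s0 ''config''"
        "reals s2 ''h'' = reals ?s0 ''h''" "reals s2 ''T'' = reals ?s0 ''T''"
        "ints s2 ''player'' = ints s1 ''player''" "ints s2 ''num'' = ints s1 ''num''" "ints s2 ''den'' = ints s1 ''den''"
        using agree_ints[OF fin(2)] agree_reals[OF fin(2)] v1 by simp_all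
      have "env 0 s2" unfolding env_def using v2 fin(1) Gam i0 by simp
      moreover have "header_ok s2" unfolding header_ok_def using v2 hdr by simp
      moreover have "output_ok s2" using v2 by (intro output_ok_input)
      ultimately show ?case by simp
    qed (use v1 M_bounds in \<open>simp_all add: agree_ints\<close>)
  qed (use i0 M_bounds in \<open>simp_all add: agree_ints rounds_int\<close>)
qed (use M_bounds(5,6) rounds_int in \<open>simp_all add: input_state_def flip: of_nat_mult\<close>)

text \<open>Lexicographic progress through the grid. As the stored \<open>T\<close> never decreases,
  what earlier targets have secured persists.\<close>

definition targets_done :: "nat \<Rightarrow> nat \<Rightarrow> real \<Rightarrow> bool" where
  "targets_done a k T \<longleftrightarrow> (\<forall>a'<m. \<forall>k'\<le>64 * m * m. a' < a \<or> a' = a \<and> k' < k \<longrightarrow>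
     target_feasible (real k' * f {a'}) \<longrightarrow> real k' * f {a'} \<le> 64 * real m * T)"

lemma santa_claus_wp:
  "wp f M santa_claus_prog (\<lambda>s'. header_ok s' \<and> output_ok s' \<and> targets_done m 0 (reals s' ''T'' 0)) (input_state n m \<Gamma>)"
  unfolding santa_claus_prog_def
proof (rule wp_Seq, rule wp_mono[OF setup_wp], goal_cases)
  case (1 s1)
  then have s1: "env 0 s1" "header_ok s1" "output_ok s1" by auto
  let ?I = "\<lambda>a k s'. (\<exists>h. env h s') \<and> header_ok s' \<and> output_ok s' \<and> targets_done a k (reals s' ''T'' 0)"
  have upd: "?I a k (iupdate x c v s)" if "?I a k s" "x \<in> {''a'', ''k''}" for a k x c v s
  proof -
    have "output_ok (iupdate x c v s) = output_ok s" using that by (intro output_ok_cong) auto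
    moreover have "header_ok (iupdate x c v s) = header_ok s" using that by (intro header_ok_cong) auto
    moreover have "env h (iupdate x c v s) = env h s" for h using that by (intro env_iupdate) auto
    ultimately show ?thesis using that(1) by simp
  qed
  show ?case
  proof (rule wp_For[where I = "\<lambda>a. ?I a 0" and N = m], goal_cases _ _ init step expr fin)
    case init
    have "targets_done 0 0 T" for T by (simp add: targets_done_def)
    then show ?case using s1 by (intro upd) auto
  next
    case (step a s2)
    show ?case
    proof (rule wp_For[where I = "?I a" and N = "64 * m * m + 1"], goal_cases _ _ init' step' expr' fin')
      case init'
      show ?case using step(2) by (intro upd) simp_all
    next
      case (step' k s3)
      obtain h0 where "env h0 s3" using step'(2) by blast
      have v3: "ints s3 ''k'' 0 = int k" "ints s3 ''a'' 0 = int a" "reals s3 ''s'' (int a) = f {a}"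
        using step'(3) agree_ints[OF step'(4)] step(3) env_simps(5)[OF \<open>env h0 s3\<close> step(1)] by simp_all
      let ?h = "real k * f {a}"
      have h0: "0 \<le> ?h" using f_nonneg[of "{a}"] step(1) by simp
      have m: "0 < m" using step(1) by simp
      let ?s4 = "rupdate ''h'' 0 ?h s3"
      have e4: "env ?h ?s4" using \<open>env h0 s3\<close> by (simp add: env_def)
      show ?case
      proof (intro wp_Seq wp_RAssign, goal_cases target)
        case target
        have st: "rupdate ''h'' (ival (IConst 0) s3) (rval (RScale (IVar ''k'') (RRead ''s'' (IVar ''a''))) s3) s3 = ?s4"
          using v3 by simp
        show ?case unfolding st
        proof (rule wp_frame[OF try_target_wp[OF e4 m h0]], goal_cases)
          case (1 s5)
          note tried = 1(2)
          have o5: "output_ok s5"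
            using step'(2) agree_ints[OF 1(1)] agree_reals[OF 1(1)] by (subst output_ok_cong[of _ s3]) auto
          have e5: "env ?h s5" using env_agree[OF e4 1(1)] by simp
          have T5: "reals s5 ''T'' = reals s3 ''T''" using agree_reals[OF 1(1)] by simp
          have h5: "header_ok s5" using step'(2) agree_ints[OF 1(1)] by (simp add: header_ok_def)
          show ?case
          proof (rule wp_frame[OF keep_best_wp[OF e5 o5]], goal_cases)
            case 1
            then show ?case using tried by blast
          next
            case 2
            then show ?case using tried by blast
          next
            case (3 s6)
            have "env ?h s6" using env_agree[OF e5 3(1)] by simp
            moreover have "header_ok s6" using h5 agree_ints[OF 3(1)] by (simp add: header_ok_def)
            moreover have "targets_done a (Suc k) (reals s6 ''T'' 0)"
              unfolding targets_done_def
            proof (intro allI impI)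
              fix a' k' assume ak: "a' < m" "k' \<le> 64 * m * m" "a' < a \<or> a' = a \<and> k' < Suc k"
                "target_feasible (real k' * f {a'})"
              show "real k' * f {a'} \<le> 64 * real m * reals s6 ''T'' 0"
              proof (cases "a' = a \<and> k' = k")
                case True
                then have "?h \<le> 64 * real m * reals s5 ''t'' 0" "reals s5 ''t'' 0 \<le> reals s6 ''T'' 0"
                  using ak(4) tried 3(2) by auto
                then show ?thesis using True by (meson mult_left_mono of_nat_0_le_iff order_trans zero_le_mult_iff zero_le_numeral)
              next
                case False
                then have "real k' * f {a'} \<le> 64 * real m * reals s3 ''T'' 0"
                  using step'(2) ak unfolding targets_done_def by (metis less_SucE)
                also have "\<dots> \<le> 64 * real m * reals s6 ''T'' 0" using 3(2) T5 by (intro mult_left_mono) auto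
                finally show ?thesis .
              qed
            qed
            ultimately show ?case using 3(2) by (intro upd) auto
          qed
        qed
      qed
    next
      case (expr' k s3)
      then show ?case by (auto simp: env_simps)
    next
      case (fin' s3)
      have "targets_done (Suc a) 0 T" if "targets_done a (64 * m * m + 1) T" for T
        unfolding targets_done_def
      proof (intro allI impI)
        fix a' k'
        assume ak: "a' < m" "k' \<le> 64 * m * m" "a' < Suc a \<or> a' = Suc a \<and> k' < 0"
          "target_feasible (real k' * f {a'})"
        then have "a' < a \<or> a' = a \<and> k' < 64 * m * m + 1" by auto
        then show "real k' * f {a'} \<le> 64 * real m * T" using that ak unfolding targets_done_def by blast
      qed
      then show ?case using fin'(1) by (intro upd) auto
    qed (use M_bounds in simp_all)
  next
    case (expr k s3)
    then show ?case by (auto simp: env_simps)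
  qed (use M_bounds in auto)
qed

lemma santa_claus_correct:
  "\<exists>t s. exec f santa_claus_prog (input_state n m \<Gamma>) t s \<and> t \<le> costb M santa_claus_prog \<and> 0 \<le> output_T s \<and>
     config_LP_solution {..<n} {..<m} \<Gamma> f (output_T s) (output_x m s) \<and> output_length s = N * n \<and>
     card {(i, C). output_x m s i C \<noteq> 0} \<le> N * n \<and>
     (\<forall>T_opt. is_T_opt {..<n} {..<m} \<Gamma> f T_opt \<longrightarrow> (1 - 1 / exp 1) / 2 * T_opt \<le> output_T s)"
proof -
  obtain t s where ex: "exec f santa_claus_prog (input_state n m \<Gamma>) t s" "t \<le> costb M santa_claus_prog"
    and h: "header_ok s" and out: "output_ok s" and all: "targets_done m 0 (reals s ''T'' 0)"
    using santa_claus_wp bnd_input by (auto simp: wp_def)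
  obtain W where W: "\<And>q. q < N * n \<Longrightarrow> segment_set s ''config'' (int (q * m)) (int m) = W q"
    "valid_rows N (output_T s) W" and T0: "0 \<le> output_T s"
    using out by (auto simp: output_ok_def output_T_def)
  have len: "output_length s = N * n" using h by (simp add: header_ok_def output_length_def flip: of_nat_mult)
  have x: "output_x m s i C = (\<Sum>q \<in> {q. q < N * n \<and> q mod n = i \<and> W q = C}. 1 / real N)" for i C
  proof -
    have "{k. k < output_length s \<and> ints s ''player'' (int k) = int i \<and>
        segment_set s ''config'' (int (k * m)) (int m) = C} = {q. q < N * n \<and> q mod n = i \<and> W q = C}"
      using h W(1) by (auto simp: len header_ok_def)
    then show ?thesis unfolding output_x_def using h by (intro sum.cong) (auto simp: header_ok_def)
  qed
  have N1: "1 \<le> N" by (simp add: rounds_def)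
  have "(1 - 1 / exp 1) / 2 * T \<le> output_T s" if opt: "is_T_opt {..<n} {..<m} \<Gamma> f T" for T
  \<comment> \<open>A zero optimum is treated apart, since the grid is built on a singleton of
    positive value.\<close>
  proof (cases "T = 0")
    case False
    then have "0 < T" using opt by (simp add: is_T_opt_def)
    from target_grid[OF opt this] obtain a k where a: "a < m" "k \<le> 64 * m * m"
      "(1 - 1 / exp 1) / 2 * T * (64 * real m) \<le> real k * f {a}"
      "2 * (real k * f {a}) \<le> 64 * real m * (greedy_factor * T)" by blast
    have "target_feasible (real k * f {a})"
      using opt a(4) by (auto simp: target_feasible_def good_target_def is_T_opt_def)
    then have "real k * f {a} \<le> 64 * real m * output_T s"
      using all a(1,2) by (auto simp: targets_done_def output_T_def)
    then have "(64 * real m) * ((1 - 1 / exp 1) / 2 * T) \<le> (64 * real m) * output_T s"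
      using a(3) by (simp only: mult.commute)
    then show ?thesis using a(1) by (simp only: mult_le_cancel_left_pos)
  qed (use T0 in simp)
  then show ?thesis using ex T0 len valid_rows_LP_solution[OF W(2) N1 x] by blast
qed

end

text \<open>Both sizes are replaced by their sum, because the final polynomial has a single
  argument.\<close>

lemma cell_bound_le: "cell_bound n m \<le> cell_bound (n + m) (n + m)"
  unfolding cell_bound_def cost_bound_def price_bound_def rounds_def
  by (intro add_mono mult_le_mono order_refl) auto

lemma poly_bounded_cell_bound: "poly_bounded (\<lambda>x. cell_bound x x)"
  unfolding cell_bound_def cost_bound_def price_bound_def rounds_def
  by (intro poly_bounded_intros)

theorem theorem2:
  shows "\<exists>(c :: com) (p :: nat poly).
    \<forall>(n :: nat) (m :: nat) (\<Gamma> :: nat \<Rightarrow> nat set) (f :: nat set \<Rightarrow> real).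
      santa_claus_instance {..<n} {..<m} \<Gamma> f \<longrightarrow>
      (\<exists>t s. exec f c (input_state n m \<Gamma>) t s \<and>
         t \<le> poly p (n + m) \<and>
         0 \<le> output_T s \<and>
         config_LP_solution {..<n} {..<m} \<Gamma> f (output_T s) (output_x m s) \<and>
         output_length s \<le> poly p (n + m) \<and>
         card {(i, C). output_x m s i C \<noteq> 0} \<le> poly p (n + m) \<and>
         (\<forall>T_opt. is_T_opt {..<n} {..<m} \<Gamma> f T_opt \<longrightarrow>
            (1 - 1 / exp 1) / 2 * T_opt \<le> output_T s))"
proof -
  obtain q where q: "costb M santa_claus_prog \<le> poly q M" for M
    using poly_bounded_costb[of santa_claus_prog] by (auto simp: poly_bounded_def)
  have pq: "poly_bounded (poly q)" unfolding poly_bounded_def by blast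
  have "poly_bounded (\<lambda>x. poly q (cell_bound x x) + cell_bound x x)"
    by (rule poly_bounded_add[OF poly_bounded_compose[OF pq poly_bounded_cell_bound] poly_bounded_cell_bound])
  then obtain p where p: "poly q (cell_bound x x) + cell_bound x x \<le> poly p x" for x
    by (auto simp: poly_bounded_def)
  show ?thesis
  proof (intro exI[of _ santa_claus_prog] exI[of _ p] allI impI, goal_cases)
    case (1 n m \<Gamma> f)
    then interpret santa_claus n m \<Gamma> f by unfold_locales
    have "cell_bound n m \<le> cell_bound (n + m) (n + m)" by (rule cell_bound_le)
    then have "costb (cell_bound n m) santa_claus_prog \<le> poly p (n + m)" "rounds n m * n \<le> poly p (n + m)"
      using q[of "cell_bound n m"] poly_nat_mono[of "cell_bound n m" "cell_bound (n + m) (n + m)" q]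
        p[of "n + m"] M_bounds(6) by linarith+
    note bounds = this
    obtain t s where ts: "exec f santa_claus_prog (input_state n m \<Gamma>) t s" "0 \<le> output_T s"
      "config_LP_solution {..<n} {..<m} \<Gamma> f (output_T s) (output_x m s)"
      "\<forall>T_opt. is_T_opt {..<n} {..<m} \<Gamma> f T_opt \<longrightarrow> (1 - 1 / exp 1) / 2 * T_opt \<le> output_T s"
      and le: "t \<le> costb (cell_bound n m) santa_claus_prog" "output_length s = rounds n m * n"
        "card {(i, C). output_x m s i C \<noteq> 0} \<le> rounds n m * n"
      using santa_claus_correct by blast
    have "t \<le> poly p (n + m)" "output_length s \<le> poly p (n + m)"
      "card {(i, C). output_x m s i C \<noteq> 0} \<le> poly p (n + m)"
      using le bounds by linarith+
    with ts show ?case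
      by blast
  qed
qed

end
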